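(* Suppose that for all $x,x_1,x_2\in\mathbb{R}^n$ and $(s,a)\in\mathcal{S}\times\mathcal{A}$: $|r_{sa}(x)|\le C_r$, $\|\nabla r_{sa}(x)\|_2\le C_{rx}$, $\|\nabla r_{sa}(x_1)-\nabla r_{sa}(x_2)\|_2\le L_r\|x_1-x_2\|_2$; and that for all trajectory tuples $\boldsymbol d=(d_1,\dots,d_I)$ and $x,x_1,x_2\in\mathbb{R}^n$: $|l(\boldsymbol d;x)|\le C_l$, $l(\boldsymbol d;\cdot)$ is continuously differentiable, $|l(\boldsymbol d;x_1)-l(\boldsymbol d;x_2)|\le L_l\|x_1-x_2\|_2$, $\|\nabla l(\boldsymbol d;x_1)-\nabla l(\boldsymbol d;x_2)\|_2\le L_{l1}\|x_1-x_2\|_2$. Given the iteration number $K$, one can choose sampling configurations $M\sim\mathcal{O}(K^{4/3})$, $J\sim\mathcal{O}(1)$, $T\sim\mathcal{O}(\log K)$ such that, with the parameters $$\beta_k=\frac1{(n_\beta+k)^{1/3}},\qquad\mu_{k+1}=\max\Big\{\frac{15}{16},1-\beta_k^2\Big\},\qquad\epsilon_k=\beta_k^2,\qquad k=1,\dots,K,$$ where the integer $n_\beta\ge3$ (independent of $K$) satisfies $$\frac{L_\phi}{(n_\beta+1)^{1/3}}+\frac{2(L_S+L_\phi)}{(n_\beta+1)^{2/3}}\le1,$$ the iterates $\{x_k\}$ generated by Stoc-SoBiRL satisfy $$\frac1K\sum_{k=1}^K\mathbb{E}\left[\|\nabla\phi(x_k)\|_2^2\right]=\mathcal{O}\left(\frac{\log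 K}{K^{2/3}}\right)=\widetilde{\mathcal{O}}(K^{-2/3}),$$ where the expectation is with respect to the stochasticity of the algorithm.
   Context: Lower level. $\mathcal{S},\mathcal{A}$ finite nonempty sets, $P_{sas'}=P(s'|s,a)$ a transition kernel, $\gamma\in(0,1)$, $\tau>0$, $r:\mathbb{R}^n\to\mathbb{R}^{|\mathcal{S}||\mathcal{A}|}$ a continuously differentiable parameterized reward. A policy is $\pi=(\pi_s)_s$ with each $\pi_s=\pi(\cdot|s)$ a probability distribution on $\mathcal{A}$, viewed in $\mathbb{R}^{|\mathcal{S}||\mathcal{A}|}$. With $h(\pi_s)=-\sum_a\pi_{sa}\log\pi_{sa}$ ($0\log0=0$), $V^\pi_s(x)=\mathbb{E}[\sum_{t\ge0}\gamma^t(r_{s_ta_t}(x)+\tau h(\pi_{s_t}))\mid s_0=s,\pi]$ (with $a_t\sim\pi(\cdot|s_t)$, $s_{t+1}\sim P(\cdot|s_t,a_t)$). For $\rho$ a distribution on $\mathcal{S}$ with positive entries, $\pi^*(x)$ is the unique maximizer over policies of $\sum_s\rho_sV^\pi_s(x)$. Upper level. $\bar P$ is a transition kernel and $\bar\rho$ an initial distribution on the same $\mathcal{S},\mathcal{A}$; $I,H\ge1$ integers. For a policy $\pi$, $\rho(d;\pi)$ is the distribution on $H$-step trajectories $d=\{(s_h,a_h)\}_{h=0}^{H-1}$ with $P(d;\pi)=\bar\rho(s_0)[\prod_{h=0}^{H-2}\pi(a_h|s_h)\bar P(s_{h+1}|s_h,a_h)]\pi(a_{H-1}|s_{H-1})$.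 The hyper-objective is $\phi(x)=f(x,\pi^*(x))$, $f(x,\pi)=\mathbb{E}[l(d_1,\dots,d_I;x)]$ with $d_1,\dots,d_I$ independent draws from $\rho(d;\pi)$. Constants: $L_\pi=\frac{2\sqrt{|\mathcal{S}||\mathcal{A}|}C_{rx}}{\tau(1-\gamma)}$, $L_{V1}=\frac{(1+\gamma)C_{rx}L_\pi\sqrt{|\mathcal{A}|}}{(1-\gamma)^2}+\frac{L_r}{1-\gamma}$, $L_\phi=L_{l1}+L_lHIL_\pi\sqrt{|\mathcal{A}|}+2\tau^{-1}HI(C_lL_{V1}+\frac{C_{rx}}{1-\gamma}L_l)+\frac{2H^2I^2C_lC_{rx}L_\pi}{\tau(1-\gamma)}\sqrt{|\mathcal{A}|}$, $L_S=L_{l1}+\frac{2HI}{\tau(1-\gamma)}(C_lL_r+C_{rx}L_l)$. Sampling scheme (policy $\pi$, configuration $M,J,T$). Draw $M$ independent tuples $\boldsymbol d^m=(d_1^m,\dots,d_I^m)$, each $d_i^m=\{(s_h^{m,i},a_h^{m,i})\}_{h=0}^{H-1}$ drawn independently from $\rho(d;\pi)$; write $\boldsymbol D=(\boldsymbol d^1,\dots,\boldsymbol d^M)$. For each $m,i,h$ draw, independently given $\boldsymbol D$, $2J$ trajectories of length $T$ following $\pi$ and $P$: $J$ of them, $(s_{q,t}^{m,i,h,j},a_{q,t}^{m,i,h,j})_{t=0}^{T-1}$, start from the state-action pair $(s_h^{m,i},a_h^{m,i})$ (all collected in $\boldsymbol\xi$); and $J$, $(s_{v,t}^{m,i,h,j},a_{v,t}^{m,i,h,j})_{t=0}^{T-1}$,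 start from the state $s_h^{m,i}$ with the first action drawn from $\pi$ (all collected in $\boldsymbol\zeta$). For these samples and any $x$, put $\bar\nabla Q^{\boldsymbol\xi}_{s_h^{m,i}a_h^{m,i}}(x,\pi)=\frac1J\sum_{j=1}^J\sum_{t=0}^{T-1}\gamma^t\nabla r_{s_{q,t}^{m,i,h,j}a_{q,t}^{m,i,h,j}}(x)$, $\bar\nabla V^{\boldsymbol\zeta}_{s_h^{m,i}}(x,\pi)=\frac1J\sum_{j=1}^J\sum_{t=0}^{T-1}\gamma^t\nabla r_{s_{v,t}^{m,i,h,j}a_{v,t}^{m,i,h,j}}(x)$, and $$\bar\nabla\phi(\boldsymbol D,\boldsymbol\xi,\boldsymbol\zeta;x,\pi)=\frac1M\sum_{m=1}^M\nabla l(\boldsymbol d^m;x)+\frac1{\tau M}\sum_{m=1}^Ml(\boldsymbol d^m;x)\sum_{i=1}^I\sum_{h=0}^{H-1}\big(\bar\nabla Q^{\boldsymbol\xi}_{s_h^{m,i}a_h^{m,i}}-\bar\nabla V^{\boldsymbol\zeta}_{s_h^{m,i}}\big)(x,\pi).$$ (For fixed samples this expression depends only on $x$.) Algorithm Stoc-SoBiRL (initial $x_1$, $\pi_0$, $h_0$; convention $x_0:=x_1$ and $\mu_1\in[0,1]$ arbitrary). For $k=1,\dots,K$: (1) obtain a policy $\pi_k$ with $\|\pi_k-\pi^*(x_k)\|_2^2\le\epsilon_k$; (2) draw fresh samples $(\boldsymbol D_k,\boldsymbol\xi_k,\boldsymbol\zeta_k)$ by the scheme with policy $\pi_k$; (3)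 $h_k=\bar\nabla\phi(\boldsymbol D_k,\boldsymbol\xi_k,\boldsymbol\zeta_k;x_k,\pi_k)+(1-\mu_k)\big(h_{k-1}-\bar\nabla\phi(\boldsymbol D_k,\boldsymbol\xi_k,\boldsymbol\zeta_k;x_{k-1},\pi_{k-1})\big)$; (4) $x_{k+1}=x_k-\beta_kh_k$. $\mathcal{O}(\cdot)$ is as $K\to\infty$ with constants independent of $K$; $\widetilde{\mathcal{O}}$ hides logarithmic factors. *)

theory Defs
  imports "HOL-Probability.Probability"
begin

section \<open>Gradients\<close>

definition grad :: "(real^'n \<Rightarrow> real) \<Rightarrow> real^'n \<Rightarrow> real^'n" where
  "grad g x = (THE D. GDERIV g x :> D)"

definition cont_diff :: "(real^'n \<Rightarrow> real) \<Rightarrow> bool" where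
  "cont_diff g \<longleftrightarrow> (\<forall>x. g differentiable (at x)) \<and> continuous_on UNIV (grad g)"

lemma grad_eqI:
  fixes g :: "real^'n \<Rightarrow> real"
  assumes "GDERIV g x :> D"
  shows "grad g x = D"
proof -
  have "D' = D" if "GDERIV g x :> D'" for D'
  proof -
    have "(\<lambda>h. inner h D') = (\<lambda>h. inner h D)"
      using assms that has_derivative_unique unfolding gderiv_def by blast
    thus ?thesis
      by (metis inner_commute vector_eq_ldot)
  qed
  thus ?thesis
    unfolding grad_def using assms by blast
qed


section \<open>Policies and trajectories\<close>

type_synonym ('s, 'a) policy = "'s \<Rightarrow> 'a pmf"
type_synonym ('s, 'a) kernel = "'s \<Rightarrow> 'a \<Rightarrow> 's pmf"
type_synonym ('s, 'a) traj = "('s \<times> 'a) list"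

text \<open>The norm of \<^typ>\<open>real^'a^'s\<close> is the Euclidean norm of all entries.\<close>

definition policy_vec :: "('s::finite, 'a::finite) policy \<Rightarrow> real^'a^'s" where
  "policy_vec \<pi> = (\<chi> s a. pmf (\<pi> s) a)"

definition sa_init :: "('s, 'a) policy \<Rightarrow> 's \<Rightarrow> ('s \<times> 'a) pmf" where
  "sa_init \<pi> s = map_pmf (Pair s) (\<pi> s)"

definition sa_step :: "('s, 'a) kernel \<Rightarrow> ('s, 'a) policy \<Rightarrow> 's \<times> 'a \<Rightarrow> ('s \<times> 'a) pmf" where
  "sa_step P \<pi> z = bind_pmf (P (fst z) (snd z)) (sa_init \<pi>)"

text \<open>Trajectory of length \<open>n\<close> with first entry \<open>z\<close>.\<close>

primrec roll_sa :: "('s, 'a) kernel \<Rightarrow> ('s, 'a) policy \<Rightarrow> nat \<Rightarrow> 's \<times> 'a \<Rightarrow> ('s, 'a) traj pmf" where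
  "roll_sa P \<pi> 0 z = return_pmf []"
| "roll_sa P \<pi> (Suc n) z = map_pmf ((#) z) (bind_pmf (sa_step P \<pi> z) (roll_sa P \<pi> n))"

definition roll_s :: "('s, 'a) kernel \<Rightarrow> ('s, 'a) policy \<Rightarrow> nat \<Rightarrow> 's \<Rightarrow> ('s, 'a) traj pmf" where
  "roll_s P \<pi> n s = bind_pmf (sa_init \<pi> s) (roll_sa P \<pi> n)"

definition traj_pmf :: "'s pmf \<Rightarrow> ('s, 'a) kernel \<Rightarrow> nat \<Rightarrow> ('s, 'a) policy \<Rightarrow> ('s, 'a) traj pmf" where
  "traj_pmf \<rho> P H \<pi> = bind_pmf \<rho> (roll_s P \<pi> H)"

lemma pmf_sa_init: "pmf (sa_init \<pi> s) z = (if fst z = s then pmf (\<pi> s) (snd z) else 0)"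
proof (cases "fst z = s")
  case True
  then have "z = Pair s (snd z)" by (metis prod.collapse)
  moreover have "inj (Pair s)" by (auto intro: injI)
  ultimately show ?thesis
    using True unfolding sa_init_def by (metis pmf_map_inj')
next
  case False
  then show ?thesis
    by (auto simp: sa_init_def pmf_eq_0_set_pmf)
qed

lemma pmf_bind_single:
  assumes "\<And>y. y \<noteq> z \<Longrightarrow> pmf (f y) w = 0"
  shows "pmf (bind_pmf p f) w = pmf p z * pmf (f z) w"
proof -
  have "pmf (bind_pmf p f) w = (\<integral>y. pmf (f z) w * indicat_real {z} y \<partial>measure_pmf p)"
    unfolding pmf_bind using assms by (intro Bochner_Integration.integral_cong) (auto simp: indicator_def)
  also have "\<dots> = pmf p z * pmf (f z) w"
    by (simp add: measure_pmf_single)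
  finally show ?thesis .
qed

lemma pmf_sa_step:
  "pmf (sa_step P \<pi> z) w = pmf (P (fst z) (snd z)) (fst w) * pmf (\<pi> (fst w)) (snd w)"
  unfolding sa_step_def
  by (subst pmf_bind_single[where z = "fst w"]) (auto simp: pmf_sa_init)

lemma pmf_roll_sa:
  assumes "length ws = n"
  shows "pmf (roll_sa P \<pi> (Suc n) z) (w # ws) =
    (if w = z then \<Prod>h<n. pmf (sa_step P \<pi> ((w # ws) ! h)) (ws ! h) else 0)"
  using assms
proof (induction n arbitrary: z w ws)
  case 0
  have "roll_sa P \<pi> 0 = (\<lambda>_. return_pmf [])"
    by (intro ext) simp
  then have "roll_sa P \<pi> (Suc 0) z = return_pmf [z]"
    by (simp only: roll_sa.simps(2) bind_pmf_const map_return_pmf)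
  with 0 show ?case by simp
next
  case (Suc n)
  then obtain v vs where ws: "ws = v # vs" "length vs = n"
    by (metis length_Suc_conv)
  have "pmf (roll_sa P \<pi> (Suc (Suc n)) z) (w # ws) =
      (if w = z then pmf (bind_pmf (sa_step P \<pi> z) (roll_sa P \<pi> (Suc n))) ws else 0)"
  proof (cases "w = z")
    case True
    then show ?thesis
      using pmf_map_inj'[of "(#) z" "bind_pmf (sa_step P \<pi> z) (roll_sa P \<pi> (Suc n))" ws]
      by (simp add: inj_on_def del: roll_sa.simps(2) add: roll_sa.simps(2)[of P \<pi> "Suc n" z])
  next
    case False
    then show ?thesis
      by (auto simp: pmf_eq_0_set_pmf)
  qed
  also have "pmf (bind_pmf (sa_step P \<pi> z) (roll_sa P \<pi> (Suc n))) ws =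
      pmf (sa_step P \<pi> z) v * (\<Prod>h<n. pmf (sa_step P \<pi> ((v # vs) ! h)) (vs ! h))"
    using Suc.IH[OF ws(2)] unfolding ws(1)
    by (subst pmf_bind_single[where z = v]) (auto simp del: roll_sa.simps)
  finally show ?case
    by (simp add: ws(1) prod.lessThan_Suc_shift del: roll_sa.simps prod.lessThan_Suc)
qed

text \<open>Explicit probability of an \<open>H\<close>-step trajectory.\<close>

lemma pmf_traj_pmf:
  assumes "H \<ge> 1" "length d = H"
  shows "pmf (traj_pmf \<rho> P H \<pi>) d =
    pmf \<rho> (fst (d ! 0)) *
    (\<Prod>h<H-1. pmf (\<pi> (fst (d ! h))) (snd (d ! h)) *
                pmf (P (fst (d ! h)) (snd (d ! h))) (fst (d ! (h + 1)))) *
    pmf (\<pi> (fst (d ! (H - 1)))) (snd (d ! (H - 1)))"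
proof -
  obtain n w ws where d: "H = Suc n" "d = w # ws" "length ws = n"
    using assms by (cases H; cases d) auto
  have shift: "pmf (\<pi> (fst w)) (snd w) * (\<Prod>h<m. pmf (sa_step P \<pi> ((w # ws) ! h)) (ws ! h)) =
      (\<Prod>h<m. pmf (\<pi> (fst (d ! h))) (snd (d ! h)) *
              pmf (P (fst (d ! h)) (snd (d ! h))) (fst (d ! (h + 1)))) *
      pmf (\<pi> (fst (d ! m))) (snd (d ! m))" for m
    by (induction m) (auto simp: d(2) pmf_sa_step algebra_simps)
  have roll: "pmf (roll_s P \<pi> H s) d =
      pmf (sa_init \<pi> s) w * (\<Prod>h<n. pmf (sa_step P \<pi> ((w # ws) ! h)) (ws ! h))" for s
    unfolding roll_s_def d(1,2)
    by (subst pmf_bind_single[where z = w]) (simp_all add: pmf_roll_sa[OF d(3)] del: roll_sa.simps)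
  show ?thesis
    unfolding traj_pmf_def
    using shift[of n]
    by (subst pmf_bind_single[where z = "fst w"])
       (simp_all add: roll pmf_sa_init, simp_all add: d mult.assoc)
qed


section \<open>Lower level\<close>

definition policy_entropy :: "'a::finite pmf \<Rightarrow> real" where
  "policy_entropy p = - (\<Sum>a\<in>UNIV. pmf p a * ln (pmf p a))"

text \<open>Law of the infinite trajectory \<open>(s\<^sub>t, a\<^sub>t)\<close> started in \<open>s\<close>, by the Ionescu-Tulcea construction.\<close>

definition traj_kernel ::
  "('s, 'a) kernel \<Rightarrow> ('s, 'a) policy \<Rightarrow> 's \<Rightarrow> nat \<Rightarrow> (nat \<Rightarrow> 's \<times> 'a) \<Rightarrow> ('s \<times> 'a) measure" where
  "traj_kernel P \<pi> s n \<omega> =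
     measure_pmf (if n = 0 then sa_init \<pi> s else sa_step P \<pi> (\<omega> (n - 1)))"

definition traj_measure ::
  "('s, 'a) kernel \<Rightarrow> ('s, 'a) policy \<Rightarrow> 's \<Rightarrow> (nat \<Rightarrow> 's \<times> 'a) measure" where
  "traj_measure P \<pi> s =
     projective_family.lim UNIV
       (Ionescu_Tulcea.CI (traj_kernel P \<pi> s) (\<lambda>_. count_space UNIV)) (\<lambda>_. count_space UNIV)"

lemma Ionescu_Tulcea_traj_kernel:
  fixes P :: "('s::finite, 'a::finite) kernel"
  shows "Ionescu_Tulcea (traj_kernel P \<pi> s) (\<lambda>_. count_space UNIV)"
proof (rule Ionescu_Tulcea.intro)
  fix i
  show "traj_kernel P \<pi> s i \<in> measurable (PiM {0..<i} (\<lambda>_. count_space UNIV))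
          (subprob_algebra (count_space UNIV))"
  proof (cases "i = 0")
    case True
    then show ?thesis
      by (simp add: traj_kernel_def[abs_def] measure_pmf_in_subprob_algebra)
  next
    case False
    then have "(\<lambda>\<omega>. \<omega> (i - 1)) \<in> measurable (PiM {0..<i} (\<lambda>_. count_space UNIV))
        (count_space (UNIV :: ('s \<times> 'a) set))"
      by (intro measurable_component_singleton) auto
    moreover have "(\<lambda>z. measure_pmf (sa_step P \<pi> z)) \<in> measurable (count_space UNIV)
        (subprob_algebra (count_space UNIV))"
      by (simp add: measure_pmf_in_subprob_algebra)
    ultimately show ?thesis
      using False by (simp add: traj_kernel_def[abs_def] measurable_compose)
  qed
qed (auto simp: traj_kernel_def intro: measure_pmf.prob_space_axioms)

lemma emeasure_traj_measure:
  fixes P :: "('s::finite, 'a::finite) kernel"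
  assumes "finite J" "X \<in> sets (PiM J (\<lambda>_. count_space UNIV))"
  shows "emeasure (traj_measure P \<pi> s) (prod_emb UNIV (\<lambda>_. count_space UNIV) J X) =
    emeasure (Ionescu_Tulcea.CI (traj_kernel P \<pi> s) (\<lambda>_. count_space UNIV) J) X"
  unfolding traj_measure_def by (rule Ionescu_Tulcea.lim[OF Ionescu_Tulcea_traj_kernel assms])

definition V_fun ::
  "('s::finite, 'a::finite) kernel \<Rightarrow> real \<Rightarrow> real \<Rightarrow> ('s \<Rightarrow> 'a \<Rightarrow> real^'n \<Rightarrow> real) \<Rightarrow>
   real^'n \<Rightarrow> ('s, 'a) policy \<Rightarrow> 's \<Rightarrow> real" where
  "V_fun P \<gamma> \<tau> r x \<pi> s =
     (\<integral>\<omega>. (\<Sum>t. \<gamma>^t * (r (fst (\<omega> t)) (snd (\<omega> t)) x + \<tau> * policy_entropy (\<pi> (fst (\<omega> t)))))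
        \<partial>traj_measure P \<pi> s)"

definition opt_policy ::
  "'s pmf \<Rightarrow> ('s::finite, 'a::finite) kernel \<Rightarrow> real \<Rightarrow> real \<Rightarrow> ('s \<Rightarrow> 'a \<Rightarrow> real^'n \<Rightarrow> real) \<Rightarrow>
   real^'n \<Rightarrow> ('s, 'a) policy" where
  "opt_policy \<rho> P \<gamma> \<tau> r x =
     (THE \<pi>. \<forall>\<pi>'. (\<Sum>s\<in>UNIV. pmf \<rho> s * V_fun P \<gamma> \<tau> r x \<pi>' s)
                 \<le> (\<Sum>s\<in>UNIV. pmf \<rho> s * V_fun P \<gamma> \<tau> r x \<pi> s))"


section \<open>Upper level\<close>

definition traj_tuples :: "nat \<Rightarrow> nat \<Rightarrow> ('s, 'a) traj list set" where
  "traj_tuples I H = {d. length d = I \<and> (\<forall>t\<in>set d. length t = H)}"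

definition upper_obj ::
  "'s pmf \<Rightarrow> ('s, 'a) kernel \<Rightarrow> nat \<Rightarrow> nat \<Rightarrow> (('s, 'a) traj list \<Rightarrow> real^'n \<Rightarrow> real) \<Rightarrow>
   real^'n \<Rightarrow> ('s, 'a) policy \<Rightarrow> real" where
  "upper_obj \<rho>' P' I H l x \<pi> =
     measure_pmf.expectation (replicate_pmf I (traj_pmf \<rho>' P' H \<pi>)) (\<lambda>d. l d x)"

definition hyper_obj ::
  "'s pmf \<Rightarrow> ('s::finite, 'a::finite) kernel \<Rightarrow> real \<Rightarrow> real \<Rightarrow> ('s \<Rightarrow> 'a \<Rightarrow> real^'n \<Rightarrow> real) \<Rightarrow>
   's pmf \<Rightarrow> ('s, 'a) kernel \<Rightarrow> nat \<Rightarrow> nat \<Rightarrow> (('s, 'a) traj list \<Rightarrow> real^'n \<Rightarrow> real) \<Rightarrow>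
   real^'n \<Rightarrow> real" where
  "hyper_obj \<rho> P \<gamma> \<tau> r \<rho>' P' I H l x = upper_obj \<rho>' P' I H l x (opt_policy \<rho> P \<gamma> \<tau> r x)"


section \<open>Sampling scheme and gradient estimator\<close>

text \<open>Independent draws, one from \<open>f y\<close> for each entry \<open>y\<close> of a list.\<close>

primrec map_draw :: "('b \<Rightarrow> 'c pmf) \<Rightarrow> 'b list \<Rightarrow> 'c list pmf" where
  "map_draw f [] = return_pmf []"
| "map_draw f (y # ys) =
     bind_pmf (f y) (\<lambda>z. bind_pmf (map_draw f ys) (\<lambda>zs. return_pmf (z # zs)))"

text \<open>
  A sample is a triple \<open>(D, \<xi>, \<zeta>)\<close>, where \<open>D ! m ! i ! h\<close> is the \<open>h\<close>-th state-action pair of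
  \<open>d\<^sub>i\<^sup>m\<close>, and \<open>\<xi> ! m ! i ! h ! j ! t\<close> and \<open>\<zeta> ! m ! i ! h ! j ! t\<close> are the \<open>t\<close>-th pairs of
  the \<open>j\<close>-th trajectories branching off at that pair, respectively at its state. All indices start
  at zero.
\<close>

type_synonym ('s, 'a) sample =
  "('s, 'a) traj list list \<times> ('s, 'a) traj list list list list \<times> ('s, 'a) traj list list list list"

definition sample_pmf ::
  "'s pmf \<Rightarrow> ('s, 'a) kernel \<Rightarrow> nat \<Rightarrow> nat \<Rightarrow> ('s, 'a) kernel \<Rightarrow> nat \<Rightarrow> nat \<Rightarrow> nat \<Rightarrow>
   ('s, 'a) policy \<Rightarrow> ('s, 'a) sample pmf" where
  "sample_pmf \<rho>' P' I H P M J T \<pi> =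
     bind_pmf (replicate_pmf M (replicate_pmf I (traj_pmf \<rho>' P' H \<pi>))) (\<lambda>D.
       map_pmf (Pair D)
         (pair_pmf
           (map_draw (map_draw (map_draw (\<lambda>z. replicate_pmf J (roll_sa P \<pi> T z)))) D)
           (map_draw (map_draw (map_draw (\<lambda>z. replicate_pmf J (roll_s P \<pi> T (fst z))))) D)))"

definition disc_grad_est ::
  "real \<Rightarrow> ('s \<Rightarrow> 'a \<Rightarrow> real^'n \<Rightarrow> real) \<Rightarrow> nat \<Rightarrow> nat \<Rightarrow> ('s, 'a) traj list \<Rightarrow> real^'n \<Rightarrow> real^'n" where
  "disc_grad_est \<gamma> r J T js x =
     (1 / real J) *\<^sub>R (\<Sum>j<J. \<Sum>t<T.
        \<gamma>^t *\<^sub>R grad (r (fst (js ! j ! t)) (snd (js ! j ! t))) x)"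

definition hypergrad_est ::
  "real \<Rightarrow> real \<Rightarrow> ('s \<Rightarrow> 'a \<Rightarrow> real^'n \<Rightarrow> real) \<Rightarrow> nat \<Rightarrow> nat \<Rightarrow> (('s, 'a) traj list \<Rightarrow> real^'n \<Rightarrow> real) \<Rightarrow>
   nat \<Rightarrow> nat \<Rightarrow> nat \<Rightarrow> ('s, 'a) sample \<Rightarrow> real^'n \<Rightarrow> real^'n" where
  "hypergrad_est \<gamma> \<tau> r I H l M J T smp x = (case smp of (D, \<xi>, \<zeta>) \<Rightarrow>
     (1 / real M) *\<^sub>R (\<Sum>m<M. grad (l (D ! m)) x) +
     (1 / (\<tau> * real M)) *\<^sub>R (\<Sum>m<M. l (D ! m) x *\<^sub>R (\<Sum>i<I. \<Sum>h<H.
        disc_grad_est \<gamma> r J T (\<xi> ! m ! i ! h) x - disc_grad_est \<gamma> r J T (\<zeta> ! m ! i ! h) x)))"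


section \<open>Stoc-SoBiRL\<close>

text \<open>
  \<open>W\<close> is the probability space carrying the run and \<open>F k\<close> the information available just before
  the \<open>k\<close>-th samples are drawn, so \<open>\<pi>\<^sub>k\<close> may depend in any, possibly randomized, way on the past.
  That the \<open>k\<close>-th samples are fresh draws from the scheme with policy \<open>\<pi>\<^sub>k\<close> means that this is
  their conditional distribution given \<open>F k\<close>.
\<close>

definition stoc_sobirl_run ::
  "'s pmf \<Rightarrow> ('s::finite, 'a::finite) kernel \<Rightarrow> real \<Rightarrow> real \<Rightarrow> ('s \<Rightarrow> 'a \<Rightarrow> real^'n \<Rightarrow> real) \<Rightarrow>
   's pmf \<Rightarrow> ('s, 'a) kernel \<Rightarrow> nat \<Rightarrow> nat \<Rightarrow> (('s, 'a) traj list \<Rightarrow> real^'n \<Rightarrow> real) \<Rightarrow>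
   nat \<Rightarrow> nat \<Rightarrow> nat \<Rightarrow> nat \<Rightarrow> (nat \<Rightarrow> real) \<Rightarrow> (nat \<Rightarrow> real) \<Rightarrow> (nat \<Rightarrow> real) \<Rightarrow> real^'n \<Rightarrow> real^'n \<Rightarrow>
   'w measure \<Rightarrow> (nat \<Rightarrow> 'w measure) \<Rightarrow>
   (nat \<Rightarrow> 'w \<Rightarrow> ('s, 'a) policy) \<Rightarrow> (nat \<Rightarrow> 'w \<Rightarrow> ('s, 'a) sample) \<Rightarrow>
   (nat \<Rightarrow> 'w \<Rightarrow> real^'n) \<Rightarrow> (nat \<Rightarrow> 'w \<Rightarrow> real^'n) \<Rightarrow> bool" where
  "stoc_sobirl_run \<rho> P \<gamma> \<tau> r \<rho>' P' I H l K M J T \<beta> \<mu> \<epsilon> x\<^sub>1 h\<^sub>0 W F \<pi> smp x h \<longleftrightarrow>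
     prob_space W \<and>
     (\<forall>k\<in>{1..K}. subalgebra W (F k)) \<and>
     (\<forall>j\<in>{1..K}. \<forall>k\<in>{1..K}. j \<le> k \<longrightarrow> subalgebra (F k) (F j)) \<and>
     (\<forall>k\<in>{1..K}. x k \<in> borel_measurable (F k) \<and> h (k - 1) \<in> borel_measurable (F k)) \<and>
     (\<forall>k\<in>{1..K}. (\<lambda>\<omega>. policy_vec (\<pi> k \<omega>)) \<in> borel_measurable (F k)) \<and>
     (\<forall>k\<in>{1..K}. smp k \<in> measurable W (count_space UNIV)) \<and>
     (\<forall>j\<in>{1..K}. \<forall>k\<in>{1..K}. j < k \<longrightarrow> smp j \<in> measurable (F k) (count_space UNIV)) \<and>
     (\<forall>\<omega>\<in>space W. x 0 \<omega> = x\<^sub>1 \<and> x 1 \<omega> = x\<^sub>1 \<and> h 0 \<omega> = h\<^sub>0) \<and>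
     (\<forall>k\<in>{1..K}. AE \<omega> in W.
        (norm (policy_vec (\<pi> k \<omega>) - policy_vec (opt_policy \<rho> P \<gamma> \<tau> r (x k \<omega>))))\<^sup>2 \<le> \<epsilon> k) \<and>
     (\<forall>k\<in>{1..K}. \<forall>d. AE \<omega> in W.
        real_cond_exp W (F k) (indicat_real {\<omega> \<in> space W. smp k \<omega> = d}) \<omega> =
          pmf (sample_pmf \<rho>' P' I H P M J T (\<pi> k \<omega>)) d) \<and>
     (\<forall>k\<in>{1..K}. \<forall>\<omega>\<in>space W.
        h k \<omega> = hypergrad_est \<gamma> \<tau> r I H l M J T (smp k \<omega>) (x k \<omega>) +
          (1 - \<mu> k) *\<^sub>R (h (k - 1) \<omega> - hypergrad_est \<gamma> \<tau> r I H l M J T (smp k \<omega>) (x (k - 1) \<omega>))) \<and>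
     (\<forall>k\<in>{1..K}. \<forall>\<omega>\<in>space W. x (k + 1) \<omega> = x k \<omega> - \<beta> k *\<^sub>R h k \<omega>)"


section \<open>Asymptotics\<close>

definition soft_bigo :: "(nat \<Rightarrow> real) \<Rightarrow> (nat \<Rightarrow> real) set" where
  "soft_bigo g = {f. \<exists>p::nat. f \<in> O(\<lambda>K. g K * (ln (real K))^p)}"

end

theory Submission
  imports Defs "HOL-Real_Asymp.Real_Asymp"
begin

text \<open>
  The optimal policy is the softmax of the fixed point of the soft Bellman operator, unique by Gibbs'
  inequality. An envelope argument makes the optimal values differentiable in \<open>x\<close>, with gradient the
  discounted value of \<open>\<nabla>r\<close> under the optimal policy; hence \<open>\<phi>\<close> has a bounded Lipschitz gradient, the
  expectation of the score-function estimator. With \<open>M \<ge> K\<close>, one branch trajectory per pair and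
  \<open>\<gamma>\<^sup>T \<le> 1 / K\<close>, the estimator has conditional mean square error
  \<open>O(1 / M + \<gamma>\<^sup>T + \<epsilon>\<^sub>k)\<close>. Since \<open>1 - \<mu>\<^sub>k \<le> \<beta>\<^sub>k\<^sub>-\<^sub>1\<^sup>2\<close> and \<open>h\<close> stays bounded, the momentum term can be
  bounded crudely, and the descent inequality yields
  \<open>\<Sum>\<^sub>k \<beta>\<^sub>k E[\<parallel>\<nabla>\<phi>(x\<^sub>k)\<parallel>\<^sup>2] = O(\<Sum>\<^sub>k 1 / k) = O(log K)\<close>. Dividing by \<open>K \<beta>\<^sub>K\<close>, of order \<open>K\<^sup>2\<^sup>/\<^sup>3\<close>, gives the rate.
\<close>


section \<open>Expectations under finitely supported distributions\<close>

text \<open>The value function is an integral over infinite trajectories, but the state-action chain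
  is finite. Values are therefore treated as solutions of linear fixed-point equations, and
  existence, uniqueness, sensitivity and truncation errors all come from one contraction estimate in
  the sup norm. Constants only have to be independent of \<open>K\<close>, so most Lipschitz bounds
  are obtained from closure properties of a class of functions and never computed. The obstacle in
  the stochastic part is that the correction in \<open>h k\<close> evaluates the previous point on
  trajectories drawn from the current policy, whereas \<open>h (k - 1)\<close> was built with the
  previous one. No recursion for the momentum error is set up: the correction is bounded pathwise by
  a constant times \<open>1 - \<mu> k\<close>, and \<open>\<beta> k * (1 - \<mu> k)^2\<close> is at
  most \<open>1/k\<close>. The fresh estimate must then be accurate by itself, and the configuration
  is chosen so that \<open>\<beta> k\<close> times each of its three errors (variance, truncation,
  inexact policy) is at most of order \<open>1/k\<close> as well.\<close>

abbreviation mean :: "'z pmf \<Rightarrow> ('z \<Rightarrow> 'b) \<Rightarrow> 'b::{banach, second_countable_topology}" where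
  "mean p f \<equiv> measure_pmf.expectation p f"

lemma mean_eq_sum:
  assumes "finite A" "set_pmf p \<subseteq> A"
  shows "mean p f = (\<Sum>a\<in>A. pmf p a *\<^sub>R f a)"
  using assms by (intro integral_measure_pmf) auto

lemma mean_diff:
  assumes "finite (set_pmf p)"
  shows "mean p (\<lambda>a. f a - g a) = mean p f - mean p g"
  using assms by (simp add: integrable_measure_pmf_finite)

lemma mean_add:
  assumes "finite (set_pmf p)"
  shows "mean p (\<lambda>a. f a + g a) = mean p f + mean p g"
  using assms by (simp add: integrable_measure_pmf_finite)

lemma mean_sum:
  assumes "finite (set_pmf p)"
  shows "mean p (\<lambda>a. \<Sum>i\<in>I. f i a) = (\<Sum>i\<in>I. mean p (f i))"
  using assms by (intro Bochner_Integration.integral_sum integrable_measure_pmf_finite)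

lemma mean_cong:
  assumes "\<And>a. a \<in> set_pmf p \<Longrightarrow> f a = g a"
  shows "mean p f = mean p g"
  using assms by (intro integral_cong_AE) (auto simp: AE_measure_pmf_iff)

lemma mean_mono:
  fixes f g :: "'z \<Rightarrow> real"
  assumes "finite (set_pmf p)" "\<And>a. a \<in> set_pmf p \<Longrightarrow> f a \<le> g a"
  shows "mean p f \<le> mean p g"
  using assms by (intro integral_mono_AE integrable_measure_pmf_finite) (auto simp: AE_measure_pmf_iff)

lemma mean_le:
  fixes f :: "'z \<Rightarrow> real"
  assumes "finite (set_pmf p)" "\<And>a. a \<in> set_pmf p \<Longrightarrow> f a \<le> B"
  shows "mean p f \<le> B"
  using mean_mono[of p f "\<lambda>_. B"] assms by simp

lemma norm_mean_le:
  assumes "finite (set_pmf p)" "\<And>a. a \<in> set_pmf p \<Longrightarrow> norm (f a) \<le> B"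
  shows "norm (mean p f) \<le> B"
proof -
  have "norm (mean p f) \<le> mean p (\<lambda>a. norm (f a))"
    by (rule integral_norm_bound)
  also have "\<dots> \<le> mean p (\<lambda>_. B)"
    using assms by (intro mean_mono)
  finally show ?thesis by simp
qed

lemma mean_bind:
  assumes "finite (set_pmf p)" "\<And>a. a \<in> set_pmf p \<Longrightarrow> finite (set_pmf (f a))"
  shows "mean (bind_pmf p f) g = mean p (\<lambda>a. mean (f a) g)"
  using assms by (subst pmf_expectation_bind[of "set_pmf p"]) (auto simp: mean_eq_sum)


section \<open>Contractions on functions over a finite set\<close>

text \<open>Apply \<open>step\<close> with B the largest norm, at a point attaining it: B \<le> C +
  \<gamma> B. For a difference of two solutions, C = 0 gives uniqueness and C > 0 a perturbation
  bound.\<close>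

lemma finite_contraction_le:
  fixes u :: "'z::finite \<Rightarrow> 'b::real_normed_vector"
  assumes "\<gamma> < 1" and step: "\<And>z B. (\<And>w. norm (u w) \<le> B) \<Longrightarrow> norm (u z) \<le> C + \<gamma> * B"
  shows "norm (u z) \<le> C / (1 - \<gamma>)"
proof -
  define B where "B = Max (range (\<lambda>w. norm (u w)))"
  have le: "norm (u w) \<le> B" for w
    unfolding B_def by (intro Max_ge) auto
  have "B \<in> range (\<lambda>w. norm (u w))"
    unfolding B_def by (intro Max_in) auto
  then obtain w where "B = norm (u w)" by auto
  then have "B \<le> C + \<gamma> * B"
    using step[OF le, of w] by simp
  then have "B * (1 - \<gamma>) \<le> C" by (simp add: algebra_simps)
  then have "B \<le> C / (1 - \<gamma>)"
    using assms(1) by (simp add: pos_le_divide_eq)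
  with le[of z] show ?thesis by linarith
qed

text \<open>Banach's fixed-point theorem for the sup norm, iterating from 0. Quantifying over every
  common bound B in the hypothesis on \<open>T\<close> spares a norm on the function space.\<close>

lemma finite_contraction_fixpoint:
  fixes T :: "('z::finite \<Rightarrow> 'b::banach) \<Rightarrow> 'z \<Rightarrow> 'b"
  assumes "0 \<le> \<gamma>" "\<gamma> < 1"
    and T: "\<And>u v B z. (\<And>w. norm (u w - v w) \<le> B) \<Longrightarrow> norm (T u z - T v z) \<le> \<gamma> * B"
  shows "\<exists>u. T u = u"
proof -
  define U where "U n = (T ^^ n) (\<lambda>_. 0)" for n
  define B where "B = (\<Sum>w\<in>UNIV. norm (U 1 w - U 0 w))"
  have B: "norm (U 1 w - U 0 w) \<le> B" for w
    unfolding B_def by (rule member_le_sum) auto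
  have U: "norm (U (Suc n) w - U n w) \<le> \<gamma> ^ n * B" for n w
  proof (induction n arbitrary: w)
    case 0
    then show ?case using B by simp
  next
    case (Suc n)
    from T[OF Suc.IH] show ?case by (simp add: U_def mult.assoc)
  qed
  have summ: "summable (\<lambda>n. U (Suc n) w - U n w)" for w
    by (rule summable_comparison_test'[where g = "\<lambda>n. \<gamma> ^ n * B" and N = 0])
       (use assms U in \<open>auto intro!: summable_mult2 summable_geometric\<close>)
  have "convergent (\<lambda>n. U n w)" for w
    using summ[of w] sum_lessThan_telescope[of "\<lambda>n. U n w"]
    by (simp add: summable_iff_convergent convergent_diff_const_right_iff)
  then obtain u where u: "\<And>w. (\<lambda>n. U n w) \<longlonglongrightarrow> u w"
    unfolding convergent_def by metis
  have "T u z = u z" for z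
  proof -
    \<comment> \<open>The sum of the coordinate errors dominates each of them and is a finite sum of
      null sequences, so it can play the role of the maximum.\<close>
    have lim: "(\<lambda>n. \<gamma> * (\<Sum>w\<in>UNIV. norm (U n w - u w))) \<longlonglongrightarrow> \<gamma> * (\<Sum>w\<in>(UNIV::'z set). norm (u w - u w))"
      by (intro tendsto_intros u)
    have le: "norm (U (Suc n) z - T u z) \<le> \<gamma> * (\<Sum>w\<in>UNIV. norm (U n w - u w))" for n
    proof -
      have "norm (U n w - u w) \<le> (\<Sum>w\<in>UNIV. norm (U n w - u w))" for w
        by (rule member_le_sum[where f = "\<lambda>w. norm (U n w - u w)"]) auto
      from T[OF this] show ?thesis by (simp add: U_def)
    qed
    have "(\<lambda>n. U (Suc n) z - T u z) \<longlonglongrightarrow> 0"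
      by (rule Lim_null_comparison[where g = "\<lambda>n. \<gamma> * (\<Sum>w\<in>UNIV. norm (U n w - u w))"]) (use lim le in \<open>auto intro: always_eventually\<close>)
    then have "(\<lambda>n. U (Suc n) z) \<longlonglongrightarrow> T u z"
      by (simp add: LIM_zero_iff)
    from LIMSEQ_unique[OF this LIMSEQ_Suc[OF u[of z]]] show ?thesis .
  qed
  then show ?thesis by auto
qed


section \<open>Discounted values of a finite Markov chain\<close>

text \<open>The expected discounted sum of \<open>g\<close> along the chain started in
  \<open>z\<close>, encoded by its fixed-point equation. Banach-valued \<open>g\<close> covers both
  rewards and their gradients.\<close>

definition disc ::
  "('z::finite \<Rightarrow> 'z pmf) \<Rightarrow> real \<Rightarrow> ('z \<Rightarrow> 'b) \<Rightarrow> 'z \<Rightarrow> 'b::{banach, second_countable_topology}" where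
  "disc K \<gamma> g = (SOME u. \<forall>z. u z = g z + \<gamma> *\<^sub>R mean (K z) u)"

text \<open>The value cut off after \<open>n\<close> terms, which is what a rollout of length
  \<open>n\<close> estimates.\<close>

primrec disc_upto ::
  "('z \<Rightarrow> 'z pmf) \<Rightarrow> real \<Rightarrow> ('z \<Rightarrow> 'b) \<Rightarrow> nat \<Rightarrow> 'z \<Rightarrow> 'b::{banach, second_countable_topology}" where
  "disc_upto K \<gamma> g 0 z = 0"
| "disc_upto K \<gamma> g (Suc n) z = g z + \<gamma> *\<^sub>R mean (K z) (disc_upto K \<gamma> g n)"

lemma disc_eq:
  fixes g :: "'z::finite \<Rightarrow> 'b::{banach, second_countable_topology}"
  assumes "0 \<le> \<gamma>" "\<gamma> < 1"
  shows "disc K \<gamma> g z = g z + \<gamma> *\<^sub>R mean (K z) (disc K \<gamma> g)"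
proof -
  have "\<exists>u. (\<lambda>z. g z + \<gamma> *\<^sub>R mean (K z) u) = u"
  proof (rule finite_contraction_fixpoint[OF assms])
    fix u v :: "'z \<Rightarrow> 'b" and B z assume "\<And>w. norm (u w - v w) \<le> B"
    then have "norm (mean (K z) (\<lambda>w. u w - v w)) \<le> B"
      by (intro norm_mean_le) auto
    with assms show "norm (g z + \<gamma> *\<^sub>R mean (K z) u - (g z + \<gamma> *\<^sub>R mean (K z) v)) \<le> \<gamma> * B"
      by (simp add: mean_diff mult_left_mono flip: scaleR_diff_right)
  qed
  then obtain u where "\<forall>z. u z = g z + \<gamma> *\<^sub>R mean (K z) u" by metis
  then have "\<forall>z. disc K \<gamma> g z = g z + \<gamma> *\<^sub>R mean (K z) (disc K \<gamma> g)"
    unfolding disc_def by (rule someI[where P = "\<lambda>u. \<forall>z. u z = g z + \<gamma> *\<^sub>R mean (K z) u"])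
  then show ?thesis by blast
qed

lemma disc_unique:
  assumes "0 \<le> \<gamma>" "\<gamma> < 1" "\<And>z. u z = g z + \<gamma> *\<^sub>R mean (K z) u"
  shows "u z = disc K \<gamma> g z"
proof -
  have "norm (u z - disc K \<gamma> g z) \<le> 0 / (1 - \<gamma>)"
  proof (rule finite_contraction_le[OF assms(2)])
    fix z B assume "\<And>w. norm (u w - disc K \<gamma> g w) \<le> B"
    then have "norm (mean (K z) (\<lambda>w. u w - disc K \<gamma> g w)) \<le> B"
      by (intro norm_mean_le) auto
    moreover have "u z - disc K \<gamma> g z = \<gamma> *\<^sub>R mean (K z) (\<lambda>w. u w - disc K \<gamma> g w)"
      by (subst assms(3), subst disc_eq[OF assms(1,2)]) (simp add: mean_diff scaleR_diff_right)
    ultimately show "norm (u z - disc K \<gamma> g z) \<le> 0 + \<gamma> * B"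
      using assms(1) by (simp add: mult_left_mono)
  qed
  then show ?thesis by simp
qed

lemma norm_disc_le:
  assumes "0 \<le> \<gamma>" "\<gamma> < 1" "\<And>z. norm (g z) \<le> C"
  shows "norm (disc K \<gamma> g z) \<le> C / (1 - \<gamma>)"
proof (rule finite_contraction_le[OF assms(2)])
  fix z B assume "\<And>w. norm (disc K \<gamma> g w) \<le> B"
  then have "norm (mean (K z) (disc K \<gamma> g)) \<le> B"
    by (intro norm_mean_le) auto
  then have "\<gamma> * norm (mean (K z) (disc K \<gamma> g)) \<le> \<gamma> * B"
    using assms(1) by (rule mult_left_mono)
  then show "norm (disc K \<gamma> g z) \<le> C + \<gamma> * B"
    using assms(1) assms(3)[of z] norm_triangle_ineq[of "g z" "\<gamma> *\<^sub>R mean (K z) (disc K \<gamma> g)"]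
    by (subst disc_eq[OF assms(1,2)]) auto
qed

lemma disc_bounded_linear:
  fixes f :: "'b::{banach, second_countable_topology} \<Rightarrow> 'c::{banach, second_countable_topology}"
  assumes "0 \<le> \<gamma>" "\<gamma> < 1" "bounded_linear f"
  shows "f (disc K \<gamma> g z) = disc K \<gamma> (\<lambda>z. f (g z)) z"
proof (rule disc_unique[OF assms(1,2), of "\<lambda>z. f (disc K \<gamma> g z)"])
  fix z
  interpret bounded_linear f by fact
  have "f (disc K \<gamma> g z) = f (g z) + \<gamma> *\<^sub>R f (mean (K z) (disc K \<gamma> g))"
    by (subst disc_eq[OF assms(1,2)]) (simp add: add scaleR)
  also have "f (mean (K z) (disc K \<gamma> g)) = mean (K z) (\<lambda>z. f (disc K \<gamma> g z))"
    by (rule integral_bounded_linear[OF assms(3), symmetric]) (simp add: integrable_measure_pmf_finite)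
  finally show "f (disc K \<gamma> g z) = f (g z) + \<gamma> *\<^sub>R mean (K z) (\<lambda>z. f (disc K \<gamma> g z))" .
qed

lemma disc_diff:
  assumes "0 \<le> \<gamma>" "\<gamma> < 1"
  shows "disc K \<gamma> (\<lambda>z. f z - g z) z = disc K \<gamma> f z - disc K \<gamma> g z"
proof (rule disc_unique[OF assms, of "\<lambda>z. disc K \<gamma> f z - disc K \<gamma> g z", symmetric])
  fix z
  show "disc K \<gamma> f z - disc K \<gamma> g z =
      f z - g z + \<gamma> *\<^sub>R mean (K z) (\<lambda>z. disc K \<gamma> f z - disc K \<gamma> g z)"
    by (subst (1 2) disc_eq[OF assms]) (simp add: mean_diff scaleR_diff_right)
qed

text \<open>The difference of the two values splits into \<open>K\<close> applied to that
  difference, which contracts, and the difference of the kernels applied to the second value, which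
  is bounded by C / (1 - \<gamma>) at each of the CARD('z) points.\<close>

lemma norm_disc_kernel_diff_le:
  fixes g :: "'z::finite \<Rightarrow> 'b::{banach, second_countable_topology}"
  assumes \<gamma>: "0 \<le> \<gamma>" "\<gamma> < 1"
    and K: "\<And>z w. \<bar>pmf (K z) w - pmf (K' z) w\<bar> \<le> \<delta>" and g: "\<And>z. norm (g z) \<le> C"
  shows "norm (disc K \<gamma> g z - disc K' \<gamma> g z) \<le> real CARD('z) * \<delta> * (C / (1 - \<gamma>)) / (1 - \<gamma>)"
proof (rule finite_contraction_le[OF \<gamma>(2)])
  let ?u = "disc K \<gamma> g" and ?v = "disc K' \<gamma> g"
  fix z D assume D: "\<And>w. norm (?u w - ?v w) \<le> D"
  have "?u z - ?v z = \<gamma> *\<^sub>R (mean (K z) (\<lambda>w. ?u w - ?v w) + (\<Sum>w\<in>UNIV. (pmf (K z) w - pmf (K' z) w) *\<^sub>R ?v w))"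
    by (subst (1 2) disc_eq[OF \<gamma>])
      (simp add: mean_diff mean_eq_sum[of UNIV] scaleR_diff_right scaleR_diff_left sum_subtractf algebra_simps)
  then have "norm (?u z - ?v z) \<le> \<gamma> * (norm (mean (K z) (\<lambda>w. ?u w - ?v w))
      + norm (\<Sum>w\<in>UNIV. (pmf (K z) w - pmf (K' z) w) *\<^sub>R ?v w))"
    using \<gamma>(1) by (simp add: mult_left_mono norm_triangle_ineq)
  also have "\<dots> \<le> \<gamma> * (D + (\<Sum>w\<in>(UNIV::'z set). \<delta> * (C / (1 - \<gamma>))))"
  proof (intro mult_left_mono add_mono norm_mean_le sum_norm_le \<gamma>)
    fix w
    have "\<bar>pmf (K z) w - pmf (K' z) w\<bar> * norm (?v w) \<le> \<delta> * (C / (1 - \<gamma>))"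
      by (intro mult_mono K norm_disc_le[OF \<gamma>] g) (use order.trans[OF abs_ge_zero K] in auto)
    then show "norm ((pmf (K z) w - pmf (K' z) w) *\<^sub>R ?v w) \<le> \<delta> * (C / (1 - \<gamma>))" by simp
  qed (use D in auto)
  also have "\<dots> \<le> real CARD('z) * \<delta> * (C / (1 - \<gamma>)) + \<gamma> * D"
  proof -
    have "0 \<le> \<delta>" "0 \<le> C"
      using order.trans[OF abs_ge_zero K] order.trans[OF norm_ge_zero g] by blast+
    then have "\<gamma> * (real CARD('z) * \<delta> * (C / (1 - \<gamma>))) \<le> 1 * (real CARD('z) * \<delta> * (C / (1 - \<gamma>)))"
      using \<gamma> by (intro mult_right_mono) auto
    then show ?thesis by (simp add: algebra_simps)
  qed
  finally show "norm (?u z - ?v z) \<le> real CARD('z) * \<delta> * (C / (1 - \<gamma>)) + \<gamma> * D" .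
qed

text \<open>Both sides obey the same recursion, so each further term shrinks the error by \<gamma>,
  starting from the size of \<open>disc\<close> itself.\<close>

lemma norm_disc_upto_diff_le:
  assumes "0 \<le> \<gamma>" "\<gamma> < 1" "\<And>z. norm (g z) \<le> C"
  shows "norm (disc_upto K \<gamma> g n z - disc K \<gamma> g z) \<le> \<gamma> ^ n * (C / (1 - \<gamma>))"
proof (induction n arbitrary: z)
  case 0
  then show ?case using norm_disc_le[OF assms] by simp
next
  case (Suc n)
  have "disc_upto K \<gamma> g (Suc n) z - disc K \<gamma> g z =
      \<gamma> *\<^sub>R mean (K z) (\<lambda>w. disc_upto K \<gamma> g n w - disc K \<gamma> g w)"
    by (subst disc_eq[OF assms(1,2)]) (simp add: mean_diff scaleR_diff_right)
  moreover have "norm (mean (K z) (\<lambda>w. disc_upto K \<gamma> g n w - disc K \<gamma> g w)) \<le> \<gamma> ^ n * (C / (1 - \<gamma>))"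
    using Suc.IH by (intro norm_mean_le) auto
  then have "\<gamma> * norm (mean (K z) (\<lambda>w. disc_upto K \<gamma> g n w - disc K \<gamma> g w)) \<le> \<gamma> * (\<gamma> ^ n * (C / (1 - \<gamma>)))"
    using assms(1) by (rule mult_left_mono)
  ultimately show ?case
    using assms(1) by (simp add: mult.assoc)
qed


section \<open>Bounded Lipschitz functions\<close>

text \<open>Boundedness is included because it makes the class closed under products. The gauge
  \<open>d\<close> is any real function of two arguments, so that points paired with policies fit
  in; the constants stay hidden because only their existence matters for the rate.\<close>

definition bdd_lip :: "('x \<Rightarrow> 'x \<Rightarrow> real) \<Rightarrow> ('x \<Rightarrow> 'b::real_normed_vector) \<Rightarrow> bool" where
  "bdd_lip d f \<longleftrightarrow> (\<exists>B L. 0 \<le> B \<and> 0 \<le> L \<and> (\<forall>x. norm (f x) \<le> B) \<and> (\<forall>x y. norm (f x - f y) \<le> L * d x y))"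

lemma bdd_lipE:
  assumes "bdd_lip d f"
  obtains B L where "0 \<le> B" "0 \<le> L" "\<And>x. norm (f x) \<le> B" "\<And>x y. norm (f x - f y) \<le> L * d x y"
  using assms unfolding bdd_lip_def by metis

lemma bdd_lipI:
  assumes "\<And>x. norm (f x) \<le> B" "\<And>x y. norm (f x - f y) \<le> L * d x y" "\<And>x y. 0 \<le> d x y"
  shows "bdd_lip d f"
proof -
  have "norm (f x - f y) \<le> max L 0 * d x y" for x y
    using order.trans[OF assms(2) mult_right_mono[OF max.cobounded1 assms(3)]] .
  moreover have "0 \<le> B" using order.trans[OF norm_ge_zero assms(1)] .
  ultimately show ?thesis
    unfolding bdd_lip_def using assms(1) by (metis max.cobounded2)
qed

lemma bdd_lip_continuous_on:
  fixes f :: "'v::real_normed_vector \<Rightarrow> 'b::real_normed_vector"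
  assumes "bdd_lip (\<lambda>x y. norm (x - y)) f"
  shows "continuous_on UNIV f"
proof -
  obtain B L where "0 \<le> B" "0 \<le> L" "\<And>x. norm (f x) \<le> B" "\<And>x y. norm (f x - f y) \<le> L * norm (x - y)"
    using assms by (rule bdd_lipE) blast
  then have "L-lipschitz_on UNIV f" by (auto simp: lipschitz_on_def dist_norm)
  then show ?thesis by (rule lipschitz_on_continuous_on)
qed

lemma bdd_lip_const: "bdd_lip d (\<lambda>_. c)"
  unfolding bdd_lip_def by (intro exI[of _ "norm c"] exI[of _ 0]) auto

lemma bdd_lip_add:
  assumes "bdd_lip d f" "bdd_lip d g"
  shows "bdd_lip d (\<lambda>x. f x + g x)"
proof -
  obtain B L where f: "0 \<le> B" "0 \<le> L" "\<And>x. norm (f x) \<le> B" "\<And>x y. norm (f x - f y) \<le> L * d x y"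
    using assms(1) by (rule bdd_lipE) blast
  obtain B' L' where g: "0 \<le> B'" "0 \<le> L'" "\<And>x. norm (g x) \<le> B'" "\<And>x y. norm (g x - g y) \<le> L' * d x y"
    using assms(2) by (rule bdd_lipE) blast
  have "norm (f x + g x) \<le> B + B'" for x
    using norm_triangle_ineq[of "f x" "g x"] f(3)[of x] g(3)[of x] by linarith
  moreover have "norm (f x + g x - (f y + g y)) \<le> (L + L') * d x y" for x y
    using norm_triangle_ineq[of "f x - f y" "g x - g y"] f(4)[of x y] g(4)[of x y]
    by (simp add: algebra_simps)
  ultimately show ?thesis
    unfolding bdd_lip_def using f(1,2) g(1,2) by (metis add_nonneg_nonneg)
qed

lemma bdd_lip_scaleR:
  assumes "bdd_lip d f" "bdd_lip d g"
  shows "bdd_lip d (\<lambda>x. f x *\<^sub>R g x)"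
proof -
  obtain B L where f: "0 \<le> B" "0 \<le> L" "\<And>x. norm (f x) \<le> B" "\<And>x y. norm (f x - f y) \<le> L * d x y"
    using assms(1) by (rule bdd_lipE) blast
  obtain B' L' where g: "0 \<le> B'" "0 \<le> L'" "\<And>x. norm (g x) \<le> B'" "\<And>x y. norm (g x - g y) \<le> L' * d x y"
    using assms(2) by (rule bdd_lipE) blast
  have "norm (f x *\<^sub>R g x) \<le> B * B'" for x
    using f(1) mult_mono[OF f(3)[of x] g(3)[of x]] by simp
  moreover have "norm (f x *\<^sub>R g x - f y *\<^sub>R g y) \<le> (B * L' + L * B') * d x y" for x y
  proof -
    have "f x *\<^sub>R g x - f y *\<^sub>R g y = f x *\<^sub>R (g x - g y) + (f x - f y) *\<^sub>R g y"
      by (simp add: algebra_simps)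
    then have "norm (f x *\<^sub>R g x - f y *\<^sub>R g y) \<le> norm (f x) * norm (g x - g y) + norm (f x - f y) * norm (g y)"
      by (metis norm_scaleR norm_triangle_ineq real_norm_def)
    also have "\<dots> \<le> B * (L' * d x y) + (L * d x y) * B'"
      using f(1) order.trans[OF norm_ge_zero f(4)[of x y]]
      by (intro add_mono mult_mono f g) auto
    finally show ?thesis by (simp add: algebra_simps)
  qed
  moreover have "0 \<le> B * B'" "0 \<le> B * L' + L * B'"
    using f(1,2) g(1,2) by auto
  ultimately show ?thesis
    unfolding bdd_lip_def by blast
qed

lemma bdd_lip_mult:
  fixes f g :: "'x \<Rightarrow> real"
  shows "bdd_lip d f \<Longrightarrow> bdd_lip d g \<Longrightarrow> bdd_lip d (\<lambda>x. f x * g x)"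
  using bdd_lip_scaleR[of d f g] by simp

lemma bdd_lip_diff:
  assumes "bdd_lip d f" "bdd_lip d g"
  shows "bdd_lip d (\<lambda>x. f x - g x)"
  using bdd_lip_add[OF assms(1) bdd_lip_scaleR[OF bdd_lip_const[of d "-1"] assms(2)]] by simp

lemma bdd_lip_sum:
  assumes "\<And>i. i \<in> A \<Longrightarrow> bdd_lip d (f i)"
  shows "bdd_lip d (\<lambda>x. \<Sum>i\<in>A. f i x)"
  using assms by (induction A rule: infinite_finite_induct) (simp_all add: bdd_lip_const bdd_lip_add)

lemma bdd_lip_prod:
  fixes f :: "'i \<Rightarrow> 'x \<Rightarrow> real"
  assumes "\<And>i. i \<in> A \<Longrightarrow> bdd_lip d (f i)"
  shows "bdd_lip d (\<lambda>x. \<Prod>i\<in>A. f i x)"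
  using assms by (induction A rule: infinite_finite_induct) (simp_all add: bdd_lip_const bdd_lip_mult)

text \<open>Over a finite index the sums of the individual constants serve all indices at
  once.\<close>

lemma bdd_lip_uniform:
  fixes f :: "'x \<Rightarrow> 'z::finite \<Rightarrow> 'b::real_normed_vector"
  assumes "\<And>z. bdd_lip d (\<lambda>x. f x z)"
  obtains B L where "0 \<le> B" "0 \<le> L" "\<And>x z. norm (f x z) \<le> B" "\<And>x y z. norm (f x z - f y z) \<le> L * d x y"
proof -
  have "\<forall>z. \<exists>B L. 0 \<le> B \<and> 0 \<le> L \<and> (\<forall>x. norm (f x z) \<le> B) \<and> (\<forall>x y. norm (f x z - f y z) \<le> L * d x y)"
    using assms unfolding bdd_lip_def by blast
  then obtain B L where BL: "\<And>z. 0 \<le> B z" "\<And>z. 0 \<le> L z" "\<And>x z. norm (f x z) \<le> B z"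
      "\<And>x y z. norm (f x z - f y z) \<le> L z * d x y"
    by metis
  have B: "B z \<le> (\<Sum>z\<in>UNIV. B z)" and L: "L z \<le> (\<Sum>z\<in>UNIV. L z)" for z
    using BL by (auto intro!: member_le_sum)
  show ?thesis
  proof
    show "0 \<le> (\<Sum>z\<in>UNIV. B z)" "0 \<le> (\<Sum>z\<in>UNIV. L z)"
      using BL by (auto intro!: sum_nonneg)
    show "norm (f x z) \<le> (\<Sum>z\<in>UNIV. B z)" for x z
      using BL(3) B by (rule order.trans)
    show "norm (f x z - f y z) \<le> (\<Sum>z\<in>UNIV. L z) * d x y" for x y z
    proof (cases "0 \<le> d x y")
      case True
      then show ?thesis
        using BL(4) L by (meson mult_right_mono order.trans)
    next
      case False
      \<comment> \<open>\<open>d\<close> may be negative, and then a nonnegative \<open>L w\<close>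
        with \<open>0 \<le> L w * d x y\<close> must vanish.\<close>
      then have "L w = 0" for w
        using order.trans[OF norm_ge_zero BL(4)[of x w y]] BL(2)[of w]
        by (simp add: zero_le_mult_iff)
      then show ?thesis using BL(4)[of x z y] by simp
    qed
  qed
qed

lemma bdd_lip_mean:
  fixes f :: "'x \<Rightarrow> 'z::finite \<Rightarrow> 'b::{banach, second_countable_topology}"
  assumes "\<And>z. bdd_lip d (\<lambda>x. f x z)" "\<And>z. bdd_lip d (\<lambda>x. pmf (p x) z)"
  shows "bdd_lip d (\<lambda>x. mean (p x) (f x))"
  using assms by (simp add: mean_eq_sum[of UNIV] bdd_lip_sum bdd_lip_scaleR)

text \<open>Reward and kernel both vary with the parameter; the intermediate value with kernel
  \<open>K x\<close> and reward \<open>g y\<close> separates the two changes.\<close>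

lemma bdd_lip_disc:
  fixes g :: "'x \<Rightarrow> 'z::finite \<Rightarrow> 'b::{banach, second_countable_topology}"
  assumes \<gamma>: "0 \<le> \<gamma>" "\<gamma> < 1"
    and "\<And>z. bdd_lip d (\<lambda>x. g x z)" "\<And>z w. bdd_lip d (\<lambda>x. pmf (K x z) w)"
  shows "bdd_lip d (\<lambda>x. disc (K x) \<gamma> (g x) z)"
proof -
  obtain B L where g: "0 \<le> B" "0 \<le> L" "\<And>x z. norm (g x z) \<le> B" "\<And>x y z. norm (g x z - g y z) \<le> L * d x y"
    using bdd_lip_uniform[of d g, OF assms(3)] by blast
  obtain L' where K: "0 \<le> L'" "\<And>x y z w. norm (pmf (K x z) w - pmf (K y z) w) \<le> L' * d x y"
    using bdd_lip_uniform[of d "\<lambda>x zw. pmf (K x (fst zw)) (snd zw)", OF assms(4)] by (metis fst_conv snd_conv)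
  define C where "C = real CARD('z) * (B / (1 - \<gamma>)) / (1 - \<gamma>)"
  have "0 \<le> B / (1 - \<gamma>)" "0 \<le> C" using g(1) \<gamma> by (simp_all add: C_def)
  have "norm (disc (K x) \<gamma> (g x) z - disc (K y) \<gamma> (g y) z) \<le> (L / (1 - \<gamma>) + L' * C) * d x y" for x y
  proof -
    have "norm (disc (K x) \<gamma> (\<lambda>z. g x z - g y z) z) \<le> L * d x y / (1 - \<gamma>)"
      by (rule norm_disc_le[OF \<gamma> g(4)])
    moreover have "norm (disc (K x) \<gamma> (g y) z - disc (K y) \<gamma> (g y) z)
        \<le> real CARD('z) * (L' * d x y) * (B / (1 - \<gamma>)) / (1 - \<gamma>)"
      using K(2) by (intro norm_disc_kernel_diff_le[OF \<gamma> _ g(3)]) simp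
    ultimately have "norm (disc (K x) \<gamma> (g x) z - disc (K y) \<gamma> (g y) z)
        \<le> L * d x y / (1 - \<gamma>) + real CARD('z) * (L' * d x y) * (B / (1 - \<gamma>)) / (1 - \<gamma>)"
      unfolding disc_diff[OF \<gamma>]
      using norm_triangle_ineq[of "disc (K x) \<gamma> (g x) z - disc (K x) \<gamma> (g y) z"
          "disc (K x) \<gamma> (g y) z - disc (K y) \<gamma> (g y) z"] by simp
    then show ?thesis by (simp add: C_def algebra_simps)
  qed
  moreover have "norm (disc (K x) \<gamma> (g x) z) \<le> B / (1 - \<gamma>)" for x
    by (rule norm_disc_le[OF \<gamma> g(3)])
  moreover have "0 \<le> L / (1 - \<gamma>) + L' * C"
    using g(2) K(1) \<gamma> \<open>0 \<le> C\<close> by simp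
  ultimately show ?thesis
    unfolding bdd_lip_def using \<open>0 \<le> B / (1 - \<gamma>)\<close> by blast
qed

lemma bdd_lip_compose:
  assumes "bdd_lip d f" "0 \<le> c" "\<And>x y. d (\<phi> x) (\<phi> y) \<le> c * d' x y"
  shows "bdd_lip d' (\<lambda>x. f (\<phi> x))"
proof -
  obtain B L where f: "0 \<le> B" "0 \<le> L" "\<And>x. norm (f x) \<le> B" "\<And>x y. norm (f x - f y) \<le> L * d x y"
    using assms(1) by (rule bdd_lipE) blast
  have "norm (f (\<phi> x) - f (\<phi> y)) \<le> (L * c) * d' x y" for x y
    using order.trans[OF f(4) mult_left_mono[OF assms(3) f(2)]] by (simp add: mult.assoc)
  then show ?thesis
    unfolding bdd_lip_def using f(1-3) assms(2) by (metis mult_nonneg_nonneg)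
qed


section \<open>The value function as a discounted value of the state-action chain\<close>

text \<open>Forward evolution of the law against backward recursion of the value. The induction is
  over all \<open>p\<close>, since one step replaces \<open>p\<close> by its image under
  \<open>K\<close>.\<close>

lemma sum_funpow_bind_eq_mean_disc_upto:
  fixes g :: "'z::finite \<Rightarrow> 'b::{banach, second_countable_topology}"
  shows "(\<Sum>t<n. \<gamma> ^ t *\<^sub>R mean (((\<lambda>p. bind_pmf p K) ^^ t) p) g) = mean p (disc_upto K \<gamma> g n)"
proof (induction n arbitrary: p)
  case 0
  then show ?case by simp
next
  case (Suc n)
  have "(\<Sum>t<Suc n. \<gamma> ^ t *\<^sub>R mean (((\<lambda>p. bind_pmf p K) ^^ t) p) g) =
      mean p g + \<gamma> *\<^sub>R (\<Sum>t<n. \<gamma> ^ t *\<^sub>R mean (((\<lambda>p. bind_pmf p K) ^^ t) (bind_pmf p K)) g)"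
    by (subst sum.lessThan_Suc_shift) (simp add: scaleR_sum_right funpow_Suc_right del: funpow.simps(2))
  also have "\<dots> = mean p g + \<gamma> *\<^sub>R mean p (\<lambda>z. mean (K z) (disc_upto K \<gamma> g n))"
    by (simp add: Suc mean_bind)
  also have "\<dots> = mean p (\<lambda>z. g z + \<gamma> *\<^sub>R mean (K z) (disc_upto K \<gamma> g n))"
    by (simp add: mean_add)
  also have "\<dots> = mean p (disc_upto K \<gamma> g (Suc n))"
    by (intro mean_cong) simp
  finally show ?case .
qed

lemma sums_funpow_bind:
  fixes g :: "'z::finite \<Rightarrow> 'b::{banach, second_countable_topology}"
  assumes "0 \<le> \<gamma>" "\<gamma> < 1"
  shows "(\<lambda>t. \<gamma> ^ t *\<^sub>R mean (((\<lambda>p. bind_pmf p K) ^^ t) p) g) sums mean p (disc K \<gamma> g)"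
proof -
  define C where "C = (\<Sum>z\<in>UNIV. norm (g z))"
  have C: "norm (g z) \<le> C" for z
    unfolding C_def by (rule member_le_sum[where f = "\<lambda>z. norm (g z)"]) auto
  have le: "norm (mean p (disc_upto K \<gamma> g n) - mean p (disc K \<gamma> g)) \<le> \<gamma> ^ n * (C / (1 - \<gamma>))" for n
    using norm_mean_le[of p "\<lambda>z. disc_upto K \<gamma> g n z - disc K \<gamma> g z", OF _ norm_disc_upto_diff_le[OF assms C]]
    by (simp add: mean_diff)
  have "(\<lambda>n. \<gamma> ^ n * (C / (1 - \<gamma>))) \<longlonglongrightarrow> 0 * (C / (1 - \<gamma>))"
    using assms by (intro tendsto_intros LIMSEQ_realpow_zero)
  then have "(\<lambda>n. \<gamma> ^ n * (C / (1 - \<gamma>))) \<longlonglongrightarrow> 0" by simp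
  then have "(\<lambda>n. mean p (disc_upto K \<gamma> g n) - mean p (disc K \<gamma> g)) \<longlonglongrightarrow> 0"
    by (rule Lim_null_comparison[rotated]) (use le in \<open>auto intro: always_eventually\<close>)
  then show ?thesis
    unfolding sums_def sum_funpow_bind_eq_mean_disc_upto by (simp add: LIM_zero_iff)
qed

text \<open>The value adds up functions of single time points, so of the trajectory law only the
  one-dimensional marginals matter. They follow from the consistency of the projective limit and a
  step-by-step integration of the kernels.\<close>

lemma distr_traj_measure_component:
  fixes P :: "('s::finite, 'a::finite) kernel"
  shows "distr (traj_measure P \<pi> s) (count_space UNIV) (\<lambda>\<omega>. \<omega> n) =
    measure_pmf (((\<lambda>p. bind_pmf p (sa_step P \<pi>)) ^^ n) (sa_init \<pi> s))" (is "?D = measure_pmf (?p n)")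
proof -
  let ?M = "\<lambda>_::nat. count_space (UNIV :: ('s \<times> 'a) set)"
  interpret IT: Ionescu_Tulcea "traj_kernel P \<pi> s" ?M
    by (rule Ionescu_Tulcea_traj_kernel)
  have [measurable]: "(\<lambda>\<omega>. f (\<omega> m)) \<in> borel_measurable (PiM {0..<Suc m} ?M)"
    for f :: "'s \<times> 'a \<Rightarrow> ennreal" and m
    by (rule measurable_compose[OF measurable_component_singleton]) auto
  \<comment> \<open>Integrating a function of the newest coordinate only requires the last kernel;
    the earlier coordinates keep their law.\<close>
  have C_Suc: "(\<integral>\<^sup>+\<omega>. f (\<omega> n) \<partial>IT.C 0 (Suc n) (\<lambda>_. undefined)) =
      (\<integral>\<^sup>+\<omega>. (\<integral>\<^sup>+z. f z \<partial>traj_kernel P \<pi> s n \<omega>) \<partial>IT.C 0 n (\<lambda>_. undefined))" for f :: "'s \<times> 'a \<Rightarrow> ennreal" and n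
  proof -
    have "sets (IT.C 0 n (\<lambda>_. undefined)) = sets (PiM {0..<n} ?M)"
      using IT.sets_C[of "\<lambda>_. undefined" 0 n] by simp
    then have eP: "IT.eP n \<in> measurable (IT.C 0 n (\<lambda>_. undefined)) (subprob_algebra (PiM {0..<Suc n} ?M))"
      using IT.measurable_eP[of n] by (simp cong: measurable_cong_sets)
    have f: "(\<lambda>\<omega>. f (\<omega> n)) \<in> borel_measurable (PiM {0..<Suc n} ?M)" by measurable
    have "(\<integral>\<^sup>+\<omega>. f (\<omega> n) \<partial>IT.C 0 (Suc n) (\<lambda>_. undefined)) =
        (\<integral>\<^sup>+\<omega>. (\<integral>\<^sup>+\<omega>. f (\<omega> n) \<partial>IT.eP n \<omega>) \<partial>IT.C 0 n (\<lambda>_. undefined))"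
      using nn_integral_bind[OF f eP] by simp
    also have "\<dots> = (\<integral>\<^sup>+\<omega>. (\<integral>\<^sup>+z. f z \<partial>traj_kernel P \<pi> s n \<omega>) \<partial>IT.C 0 n (\<lambda>_. undefined))"
      using IT.space_C[of "\<lambda>_. undefined" 0 n]
      by (intro nn_integral_cong, subst IT.nn_integral_eP[OF _ f]) auto
    finally show ?thesis .
  qed
  have C: "(\<integral>\<^sup>+\<omega>. f (\<omega> n) \<partial>IT.C 0 (Suc n) (\<lambda>_. undefined)) = (\<integral>\<^sup>+z. f z \<partial>?p n)"
    for f :: "'s \<times> 'a \<Rightarrow> ennreal" and n
  proof (induction n arbitrary: f)
    case 0
    have "(\<integral>\<^sup>+\<omega>. f (\<omega> 0) \<partial>IT.C 0 (Suc 0) (\<lambda>_. undefined)) =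
        (\<integral>\<^sup>+\<omega>. (\<integral>\<^sup>+z. f z \<partial>sa_init \<pi> s) \<partial>IT.C 0 0 (\<lambda>_. undefined))"
      unfolding C_Suc by (simp add: traj_kernel_def del: IT.C.simps nn_integral_map_pmf)
    also have "\<dots> = (\<integral>\<^sup>+z. f z \<partial>?p 0)"
      using IT.prob_space_C[of "\<lambda>_. undefined" 0 0]
      by (simp add: prob_space.emeasure_space_1 del: IT.C.simps nn_integral_map_pmf)
    finally show ?case .
  next
    case (Suc n)
    have "(\<integral>\<^sup>+\<omega>. f (\<omega> (Suc n)) \<partial>IT.C 0 (Suc (Suc n)) (\<lambda>_. undefined)) =
        (\<integral>\<^sup>+\<omega>. (\<integral>\<^sup>+z. f z \<partial>sa_step P \<pi> (\<omega> n)) \<partial>IT.C 0 (Suc n) (\<lambda>_. undefined))"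
      unfolding C_Suc[of "Suc n" f] by (simp add: traj_kernel_def del: IT.C.simps)
    also have "\<dots> = (\<integral>\<^sup>+z. f z \<partial>?p (Suc n))"
      by (subst Suc) simp
    finally show ?case .
  qed
  show ?thesis
  proof (rule measure_eqI)
    fix A assume "A \<in> sets ?D"
    have [measurable]: "(\<lambda>\<omega>. \<omega> n) \<in> measurable (PiM UNIV ?M) (count_space UNIV)"
      by (rule measurable_component_singleton) auto
    have sets: "sets (traj_measure P \<pi> s) = sets (PiM UNIV ?M)"
      unfolding traj_measure_def by simp
    have sp: "space (traj_measure P \<pi> s) = UNIV"
      unfolding sets_eq_imp_space_eq[OF sets] by (simp add: space_PiM)
    have meas: "(\<lambda>\<omega>. \<omega> n) \<in> measurable (traj_measure P \<pi> s) (count_space UNIV)"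
      by (simp add: measurable_cong_sets[OF sets refl])
    \<comment> \<open>The event concerns coordinate \<open>n\<close> alone, so it is the cylinder
      over the one-element index set {n}.\<close>
    define X where "X = (\<Pi>\<^sub>E i\<in>{n}. A)"
    have X: "X \<in> Sigma_Algebra.sets (PiM {n} ?M)"
      unfolding X_def by (intro sets_PiM_I_finite) auto
    have "emeasure ?D A = emeasure (traj_measure P \<pi> s) (prod_emb UNIV ?M {n} X)"
      by (subst emeasure_distr[OF meas]) (auto simp: sp X_def prod_emb_def PiE_iff intro!: arg_cong2[where f = emeasure])
    also have "\<dots> = emeasure (IT.CI {n}) X"
      by (rule emeasure_traj_measure) (use X in auto)
    also have "\<dots> = emeasure (IT.C 0 (Suc n) (\<lambda>_. undefined)) (prod_emb {0..<Suc n} ?M {n} X)"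
      by (rule IT.emeasure_CI) (use X in auto)
    also have "\<dots> = (\<integral>\<^sup>+\<omega>. indicator (prod_emb {0..<Suc n} ?M {n} X) \<omega> \<partial>IT.C 0 (Suc n) (\<lambda>_. undefined))"
    proof (rule nn_integral_indicator[symmetric])
      have "Sigma_Algebra.sets (IT.C 0 (Suc n) (\<lambda>_. undefined)) = Sigma_Algebra.sets (PiM {0..<Suc n} ?M)"
        using IT.sets_C[of "\<lambda>_. undefined" 0 "Suc n"] by simp
      then show "prod_emb {0..<Suc n} ?M {n} X \<in> Sigma_Algebra.sets (IT.C 0 (Suc n) (\<lambda>_. undefined))"
        using measurable_prod_emb[OF _ X, of "{0..<Suc n}"] by simp
    qed
    also have "\<dots> = (\<integral>\<^sup>+\<omega>. indicator A (\<omega> n) \<partial>IT.C 0 (Suc n) (\<lambda>_. undefined))"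
    proof (rule nn_integral_cong)
      have "space (IT.C 0 (Suc n) (\<lambda>_. undefined)) = space (PiM {0..<Suc n} ?M)"
        using IT.space_C[of "\<lambda>_. undefined" 0 "Suc n"] by (simp del: IT.C.simps)
      then show "indicator (prod_emb {0..<Suc n} ?M {n} X) \<omega> = (indicator A (\<omega> n) :: ennreal)"
        if "\<omega> \<in> space (IT.C 0 (Suc n) (\<lambda>_. undefined))" for \<omega>
        using that by (simp add: prod_emb_def X_def space_PiM PiE_iff indicator_def del: IT.C.simps)
    qed
    also have "\<dots> = emeasure (measure_pmf (?p n)) A"
      by (subst C) simp
    finally show "emeasure ?D A = emeasure (measure_pmf (?p n)) A" .
  qed simp
qed

text \<open>On a finite space the rewards are bounded, so the geometric series dominates and lets
  sum and integral be exchanged; what remains depends only on the marginals.\<close>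

lemma V_fun_eq_mean_disc:
  fixes P :: "('s::finite, 'a::finite) kernel"
  assumes "0 < \<gamma>" "\<gamma> < 1"
  shows "V_fun P \<gamma> \<tau> r x \<pi> s = mean (sa_init \<pi> s)
    (disc (sa_step P \<pi>) \<gamma> (\<lambda>z. r (fst z) (snd z) x + \<tau> * policy_entropy (\<pi> (fst z))))"
proof -
  define g where "g = (\<lambda>z. r (fst z) (snd z) x + \<tau> * policy_entropy (\<pi> (fst z)))"
  define N where "N = traj_measure P \<pi> s"
  define C where "C = (\<Sum>z\<in>UNIV. \<bar>g z\<bar>)"
  have C: "\<bar>g z\<bar> \<le> C" for z
    unfolding C_def by (rule member_le_sum[where f = "\<lambda>z. \<bar>g z\<bar>"]) auto
  interpret IT: Ionescu_Tulcea "traj_kernel P \<pi> s" "\<lambda>_. count_space UNIV"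
    by (rule Ionescu_Tulcea_traj_kernel)
  have sets: "sets N = sets (PiM UNIV (\<lambda>_. count_space UNIV))"
    unfolding N_def traj_measure_def by simp
  have meas[measurable]: "(\<lambda>\<omega>. \<omega> t) \<in> measurable N (count_space UNIV)" for t
    unfolding measurable_cong_sets[OF sets refl] by (rule measurable_component_singleton) auto
  note D = distr_traj_measure_component[of P \<pi> s, folded N_def]
  interpret N: prob_space N
  proof
    have "emeasure (distr N (count_space UNIV) (\<lambda>\<omega>. \<omega> 0)) UNIV = 1"
      unfolding D using measure_pmf.emeasure_space_1 by simp
    then show "emeasure N (space N) = 1"
      by (simp add: emeasure_distr)
  qed
  have int: "integrable N (\<lambda>\<omega>. \<gamma> ^ t * g (\<omega> t))" for t
  proof (rule N.integrable_const_bound[of _ "\<gamma> ^ t * C"])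
    show "(\<lambda>\<omega>. \<gamma> ^ t * g (\<omega> t)) \<in> borel_measurable N"
      by (intro borel_measurable_times borel_measurable_const measurable_compose[OF meas]) auto
  qed (use C assms in \<open>auto simp: abs_mult\<close>)
  have le: "\<bar>\<gamma> ^ t * g (\<omega> t)\<bar> \<le> \<gamma> ^ t * C" for t and \<omega> :: "nat \<Rightarrow> 's \<times> 'a"
    using C assms by (simp add: abs_mult)
  have summ: "summable (\<lambda>t. \<gamma> ^ t * C)"
    using assms by (intro summable_mult2 summable_geometric) auto
  have int_sum: "(\<integral>\<omega>. (\<Sum>t. \<gamma> ^ t * g (\<omega> t)) \<partial>N) = (\<Sum>t. \<integral>\<omega>. \<gamma> ^ t * g (\<omega> t) \<partial>N)"
  proof (rule integral_suminf[OF int])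
    show "AE \<omega> in N. summable (\<lambda>t. norm (\<gamma> ^ t * g (\<omega> t)))"
      by (intro AE_I2 summable_comparison_test'[OF summ, of 0]) (use le in auto)
    have "(\<integral>\<omega>. norm (\<gamma> ^ t * g (\<omega> t)) \<partial>N) \<le> (\<integral>\<omega>. \<gamma> ^ t * C \<partial>N)" for t
      using le by (intro integral_mono integrable_norm int) auto
    then show "summable (\<lambda>t. \<integral>\<omega>. norm (\<gamma> ^ t * g (\<omega> t)) \<partial>N)"
      by (intro summable_comparison_test'[OF summ, of 0]) (auto simp: N.prob_space)
  qed
  have int_term: "(\<integral>\<omega>. \<gamma> ^ t * g (\<omega> t) \<partial>N) =
      \<gamma> ^ t *\<^sub>R mean (((\<lambda>p. bind_pmf p (sa_step P \<pi>)) ^^ t) (sa_init \<pi> s)) g" for t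
    unfolding D[symmetric] by (subst integral_distr[OF meas]) auto
  have "(\<Sum>t. \<gamma> ^ t *\<^sub>R mean (((\<lambda>p. bind_pmf p (sa_step P \<pi>)) ^^ t) (sa_init \<pi> s)) g) =
      mean (sa_init \<pi> s) (disc (sa_step P \<pi>) \<gamma> g)"
    using assms by (intro sums_unique[symmetric] sums_funpow_bind) auto
  then have "(\<integral>\<omega>. (\<Sum>t. \<gamma> ^ t * g (\<omega> t)) \<partial>N) = mean (sa_init \<pi> s) (disc (sa_step P \<pi>) \<gamma> g)"
    unfolding int_sum int_term .
  then show ?thesis
    unfolding V_fun_def N_def g_def .
qed


section \<open>Entropy-regularized optimality\<close>

text \<open>With the regularized reward this is the value function of \<open>\<pi>\<close>; with the
  reward gradients it is the vector that becomes the gradient of the optimal value.\<close>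

definition policy_val ::
  "('s::finite, 'a::finite) kernel \<Rightarrow> real \<Rightarrow> ('s, 'a) policy \<Rightarrow> ('s \<times> 'a \<Rightarrow> 'b) \<Rightarrow> 's \<Rightarrow>
   'b::{banach, second_countable_topology}" where
  "policy_val P \<gamma> \<pi> g s = mean (sa_init \<pi> s) (disc (sa_step P \<pi>) \<gamma> g)"

lemma policy_val_eq: "policy_val P \<gamma> \<pi> g s = mean (\<pi> s) (\<lambda>a. disc (sa_step P \<pi>) \<gamma> g (s, a))"
  by (simp add: policy_val_def sa_init_def)

lemma disc_sa_step_eq:
  fixes P :: "('s::finite, 'a::finite) kernel"
  assumes "0 \<le> \<gamma>" "\<gamma> < 1"
  shows "disc (sa_step P \<pi>) \<gamma> g z = g z + \<gamma> *\<^sub>R mean (P (fst z) (snd z)) (policy_val P \<gamma> \<pi> g)"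
  by (subst disc_eq[OF assms]) (simp add: sa_step_def mean_bind policy_val_def[abs_def])

lemma norm_policy_val_le:
  assumes "0 \<le> \<gamma>" "\<gamma> < 1" "\<And>z. norm (g z) \<le> C"
  shows "norm (policy_val P \<gamma> \<pi> g s) \<le> C / (1 - \<gamma>)"
  unfolding policy_val_def by (intro norm_mean_le norm_disc_le assms) auto

lemma policy_val_diff:
  assumes "0 \<le> \<gamma>" "\<gamma> < 1"
  shows "policy_val P \<gamma> \<pi> (\<lambda>z. f z - g z) s = policy_val P \<gamma> \<pi> f s - policy_val P \<gamma> \<pi> g s"
  unfolding policy_val_def
  by (subst mean_diff[symmetric]) (auto intro!: mean_cong simp: disc_diff[OF assms])

lemma policy_val_bounded_linear:
  fixes f :: "'b::{banach, second_countable_topology} \<Rightarrow> 'c::{banach, second_countable_topology}"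
  assumes "0 \<le> \<gamma>" "\<gamma> < 1" "bounded_linear f"
  shows "f (policy_val P \<gamma> \<pi> g s) = policy_val P \<gamma> \<pi> (\<lambda>z. f (g z)) s"
  unfolding policy_val_def disc_bounded_linear[OF assms, symmetric]
  by (rule integral_bounded_linear[OF assms(3), symmetric]) (simp add: integrable_measure_pmf_finite)

text \<open>Subtracting p - q from each summand leaves the sum unchanged, and makes the summand
  nonnegative by ln t \<le> t - 1 with t = q / p. A zero summand forces t = 1; where p vanishes the
  summand is q > 0.\<close>

lemma gibbs_inequality:
  fixes p q :: "'a::finite pmf"
  assumes "\<And>a. 0 < pmf q a"
  shows "0 \<le> (\<Sum>a\<in>UNIV. pmf p a * (ln (pmf p a) - ln (pmf q a)))" (is "0 \<le> ?KL")
    and "(\<Sum>a\<in>UNIV. pmf p a * (ln (pmf p a) - ln (pmf q a))) = 0 \<Longrightarrow> p = q"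
proof -
  define D where "D a = pmf p a * (ln (pmf p a) - ln (pmf q a)) - (pmf p a - pmf q a)" for a
  have D: "0 \<le> D a \<and> (D a = 0 \<longrightarrow> pmf p a = pmf q a)" for a
  proof (cases "pmf p a = 0")
    case True
    then show ?thesis using assms[of a] by (simp add: D_def)
  next
    case False
    then have p: "0 < pmf p a" by (simp add: pmf_pos)
    define t where "t = pmf q a / pmf p a"
    have t: "0 < t" using p assms by (simp add: t_def)
    have "D a = pmf p a * (t - 1 - ln t)"
      using p assms[of a] by (simp add: D_def t_def ln_div field_simps)
    moreover have "ln t \<le> t - 1" using t by (rule ln_le_minus_one)
    moreover have "t = 1" if "ln t = t - 1" using that t ln_eq_minus_one by blast
    ultimately show ?thesis using p by (auto simp: t_def)
  qed
  have "(\<Sum>a\<in>UNIV. D a) = ?KL - ((\<Sum>a\<in>UNIV. pmf p a) - (\<Sum>a\<in>UNIV. pmf q a))"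
    by (simp add: D_def sum_subtractf)
  also have "\<dots> = ?KL" by (simp add: sum_pmf_eq_1)
  finally have sum: "(\<Sum>a\<in>UNIV. D a) = ?KL" .
  show "0 \<le> ?KL" unfolding sum[symmetric] using D by (simp add: sum_nonneg)
  show "p = q" if "?KL = 0"
  proof (rule pmf_eqI)
    fix a
    have "D a = 0" using that D unfolding sum[symmetric] by (simp add: sum_nonneg_eq_0_iff)
    with D show "pmf p a = pmf q a" by blast
  qed
qed

text \<open>Log-sum-exp is monotone and commutes with adding a constant, hence nonexpansive in the
  sup norm. The soft Bellman operator inherits the factor \<gamma> from this.\<close>

lemma ln_sum_exp_diff_le:
  fixes u v :: "'a::finite \<Rightarrow> real"
  assumes "\<And>a. u a \<le> v a + \<delta>"
  shows "ln (\<Sum>a\<in>UNIV. exp (u a)) \<le> ln (\<Sum>a\<in>UNIV. exp (v a)) + \<delta>"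
proof -
  have pos: "0 < (\<Sum>a\<in>UNIV. exp (w a))" for w :: "'a \<Rightarrow> real"
    by (rule sum_pos) auto
  have "(\<Sum>a\<in>UNIV. exp (u a)) \<le> (\<Sum>a\<in>UNIV. exp (v a + \<delta>))"
    using assms by (intro sum_mono) simp
  also have "\<dots> = (\<Sum>a\<in>UNIV. exp (v a)) * exp \<delta>"
    by (simp add: exp_add sum_distrib_right)
  finally have "ln (\<Sum>a\<in>UNIV. exp (u a)) \<le> ln ((\<Sum>a\<in>UNIV. exp (v a)) * exp \<delta>)"
    using pos by (simp add: ln_mono)
  then show ?thesis using pos[of v] by (simp add: ln_mult_pos)
qed

text \<open>The slope of \<open>exp\<close> is at most 1 left of 0. It is applied to logarithms of
  probabilities.\<close>

lemma abs_exp_diff_le: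
  fixes u v :: real
  assumes "u \<le> 0" "v \<le> 0"
  shows "\<bar>exp u - exp v\<bar> \<le> \<bar>u - v\<bar>"
proof -
  have le: "exp u - exp v \<le> u - v" if "v \<le> u" "u \<le> 0" for u v :: real
  proof -
    have "1 - exp (v - u) \<le> u - v"
      using exp_ge_add_one_self[of "v - u"] by linarith
    then have "exp u * (1 - exp (v - u)) \<le> 1 * (u - v)"
      using that by (intro mult_mono) auto
    then show ?thesis by (simp add: right_diff_distrib flip: exp_add)
  qed
  show ?thesis
    using le[of v u] le[of u v] assms by (cases "v \<le> u") auto
qed

locale entropy_mdp =
  fixes P :: "('s::finite, 'a::finite) kernel" and \<gamma> \<tau> :: real
  assumes \<gamma>_pos: "0 < \<gamma>" and \<gamma>_less: "\<gamma> < 1" and \<tau>_pos: "0 < \<tau>"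
begin

lemma \<gamma>_nonneg: "0 \<le> \<gamma>" using \<gamma>_pos by simp

definition soft_v :: "('s \<Rightarrow> 'a \<Rightarrow> real) \<Rightarrow> 's \<Rightarrow> real" where
  "soft_v R = (SOME v. (\<lambda>s. \<tau> * ln (\<Sum>a\<in>UNIV. exp ((R s a + \<gamma> * mean (P s a) v) / \<tau>))) = v)"

definition soft_q :: "('s \<Rightarrow> 'a \<Rightarrow> real) \<Rightarrow> 's \<Rightarrow> 'a \<Rightarrow> real" where
  "soft_q R s a = R s a + \<gamma> * mean (P s a) (soft_v R)"

definition soft_policy :: "('s \<Rightarrow> 'a \<Rightarrow> real) \<Rightarrow> ('s, 'a) policy" where
  "soft_policy R s = embed_pmf (\<lambda>a. exp ((soft_q R s a - soft_v R s) / \<tau>))"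

text \<open>\<open>R\<close> and \<open>\<pi>\<close> are separate arguments so that the reward can
  change at a fixed policy, in which case the entropy cancels from differences.\<close>

definition reg_reward :: "('s \<Rightarrow> 'a \<Rightarrow> real) \<Rightarrow> ('s, 'a) policy \<Rightarrow> 's \<times> 'a \<Rightarrow> real" where
  "reg_reward R \<pi> z = R (fst z) (snd z) + \<tau> * policy_entropy (\<pi> (fst z))"

lemma soft_v_eq: "soft_v R s = \<tau> * ln (\<Sum>a\<in>UNIV. exp (soft_q R s a / \<tau>))"
proof -
  let ?T = "\<lambda>v s. \<tau> * ln (\<Sum>a\<in>UNIV. exp ((R s a + \<gamma> * mean (P s a) v) / \<tau>))"
  have "\<exists>v. ?T v = v"
  proof (rule finite_contraction_fixpoint[OF \<gamma>_nonneg \<gamma>_less])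
    fix u v :: "'s \<Rightarrow> real" and B s
    assume B: "\<And>w. norm (u w - v w) \<le> B"
    have le: "?T u s \<le> ?T v s + \<gamma> * B" if "\<And>w. norm (u w - v w) \<le> B" for u v
    proof -
      have "ln (\<Sum>a\<in>UNIV. exp ((R s a + \<gamma> * mean (P s a) u) / \<tau>))
          \<le> ln (\<Sum>a\<in>UNIV. exp ((R s a + \<gamma> * mean (P s a) v) / \<tau>)) + \<gamma> * B / \<tau>"
      proof (rule ln_sum_exp_diff_le)
        fix a
        have "norm (mean (P s a) (\<lambda>w. u w - v w)) \<le> B"
          using that by (intro norm_mean_le) auto
        then have "mean (P s a) u \<le> mean (P s a) v + B"
          by (simp add: mean_diff)
        from mult_left_mono[OF this \<gamma>_nonneg]
        show "(R s a + \<gamma> * mean (P s a) u) / \<tau> \<le> (R s a + \<gamma> * mean (P s a) v) / \<tau> + \<gamma> * B / \<tau>"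
          using \<tau>_pos by (simp add: divide_right_mono algebra_simps flip: add_divide_distrib)
      qed
      from mult_left_mono[OF this, of \<tau>] show ?thesis
        using \<tau>_pos by (simp add: algebra_simps)
    qed
    from le[of u v, OF B] le[of v u] B show "norm (?T u s - ?T v s) \<le> \<gamma> * B"
      by (simp add: abs_le_iff norm_minus_commute abs_minus_commute)
  qed
  from someI_ex[OF this, folded soft_v_def] have "?T (soft_v R) = soft_v R" .
  from fun_cong[OF this, of s] show ?thesis unfolding soft_q_def by (rule sym)
qed

lemma sum_exp_soft: "(\<Sum>a\<in>UNIV. exp ((soft_q R s a - soft_v R s) / \<tau>)) = 1"
proof -
  have pos: "0 < (\<Sum>a\<in>UNIV. exp (soft_q R s a / \<tau>))"
    by (rule sum_pos) auto
  have "exp (soft_v R s / \<tau>) = (\<Sum>a\<in>UNIV. exp (soft_q R s a / \<tau>))"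
    using pos \<tau>_pos by (simp add: soft_v_eq)
  then show ?thesis
    using pos by (simp add: diff_divide_distrib exp_diff flip: sum_divide_distrib)
qed

lemma pmf_soft_policy: "pmf (soft_policy R s) a = exp ((soft_q R s a - soft_v R s) / \<tau>)"
  unfolding soft_policy_def
proof (rule pmf_embed_pmf)
  show "(\<integral>\<^sup>+a. ennreal (exp ((soft_q R s a - soft_v R s) / \<tau>)) \<partial>count_space UNIV) = 1"
    by (simp add: nn_integral_count_space_finite sum_exp_soft)
qed auto

lemma soft_q_eq: "soft_q R s a = soft_v R s + \<tau> * ln (pmf (soft_policy R s) a)"
  using \<tau>_pos by (simp add: pmf_soft_policy)

text \<open>The Kullback-Leibler divergence of \<open>\<pi> s\<close> from the softmax policy at
  \<open>s\<close>.\<close>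

definition rel_entropy :: "('s \<Rightarrow> 'a \<Rightarrow> real) \<Rightarrow> ('s, 'a) policy \<Rightarrow> 's \<Rightarrow> real" where
  "rel_entropy R \<pi> s =
    (\<Sum>a\<in>UNIV. pmf (\<pi> s) a * (ln (pmf (\<pi> s) a) - ln (pmf (soft_policy R s) a)))"

lemma rel_entropy_nonneg: "0 \<le> rel_entropy R \<pi> s"
  unfolding rel_entropy_def by (rule gibbs_inequality) (simp add: pmf_soft_policy)

text \<open>The gap between the soft value and the value of any policy is itself a discounted value,
  with the divergence as running cost. Optimality of the softmax policy, its value and its
  uniqueness are all read off from this identity.\<close>

lemma soft_gap_eq:
  "soft_v R s - policy_val P \<gamma> \<pi> (reg_reward R \<pi>) s = \<tau> * rel_entropy R \<pi> s
    + \<gamma> * mean (\<pi> s) (\<lambda>a. mean (P s a) (\<lambda>w. soft_v R w - policy_val P \<gamma> \<pi> (reg_reward R \<pi>) w))"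
proof -
  let ?U = "policy_val P \<gamma> \<pi> (reg_reward R \<pi>)"
  have sum1: "(\<Sum>a\<in>UNIV. pmf (\<pi> s) a) = 1" by (simp add: sum_pmf_eq_1)
  have "?U s = mean (\<pi> s) (\<lambda>a. reg_reward R \<pi> (s, a) + \<gamma> * mean (P s a) ?U)"
    unfolding policy_val_eq[of P \<gamma> \<pi> _ s] by (simp add: disc_sa_step_eq[OF \<gamma>_nonneg \<gamma>_less])
  also have "\<dots> = mean (\<pi> s) (\<lambda>a. soft_q R s a + \<tau> * policy_entropy (\<pi> s)
      - \<gamma> * mean (P s a) (\<lambda>w. soft_v R w - ?U w))"
    by (intro mean_cong) (simp add: reg_reward_def soft_q_def mean_diff algebra_simps)
  also have "\<dots> = mean (\<pi> s) (soft_q R s) + \<tau> * policy_entropy (\<pi> s)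
      - \<gamma> * mean (\<pi> s) (\<lambda>a. mean (P s a) (\<lambda>w. soft_v R w - ?U w))"
    by (simp add: integrable_measure_pmf_finite)
  \<comment> \<open>Writing \<open>soft_q\<close> as \<open>soft_v\<close> plus \<tau> times the
    log-probability of the softmax policy turns expected \<open>soft_q\<close> plus entropy into
    \<open>soft_v\<close> minus the divergence.\<close>
  also have "mean (\<pi> s) (soft_q R s) + \<tau> * policy_entropy (\<pi> s) = soft_v R s - \<tau> * rel_entropy R \<pi> s"
    using sum1
    by (simp add: mean_eq_sum[of UNIV] soft_q_eq rel_entropy_def policy_entropy_def algebra_simps
        sum.distrib sum_subtractf sum_distrib_left flip: sum_distrib_right)
  finally show ?thesis by simp
qed

text \<open>The divergence is nonnegative, so the negative part of the gap is bounded by \<gamma>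
  times its own maximum and must vanish.\<close>

lemma policy_val_le_soft_v: "policy_val P \<gamma> \<pi> (reg_reward R \<pi>) s \<le> soft_v R s"
proof -
  define D where "D s = soft_v R s - policy_val P \<gamma> \<pi> (reg_reward R \<pi>) s" for s
  have "norm (max 0 (- D s)) \<le> 0 / (1 - \<gamma>)"
  proof (rule finite_contraction_le[OF \<gamma>_less])
    fix s B assume B: "\<And>w. norm (max 0 (- D w)) \<le> B"
    have "0 \<le> B" using order.trans[OF norm_ge_zero B[of s]] .
    have "- D w \<le> B" for w using B[of w] by simp
    then have "mean (\<pi> s) (\<lambda>a. mean (P s a) (\<lambda>w. - D w)) \<le> B"
      by (intro mean_le) auto
    then have "\<gamma> * - mean (\<pi> s) (\<lambda>a. mean (P s a) D) \<le> \<gamma> * B"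
      by (intro mult_left_mono \<gamma>_nonneg) simp
    moreover have "D s = \<tau> * rel_entropy R \<pi> s + \<gamma> * mean (\<pi> s) (\<lambda>a. mean (P s a) D)"
      unfolding D_def by (rule soft_gap_eq)
    moreover have "0 \<le> \<tau> * rel_entropy R \<pi> s"
      using rel_entropy_nonneg \<tau>_pos by simp
    ultimately have "- D s \<le> \<gamma> * B" by linarith
    then show "norm (max 0 (- D s)) \<le> 0 + \<gamma> * B"
      using \<open>0 \<le> B\<close> \<gamma>_nonneg by (simp add: max_def)
  qed
  then show ?thesis by (simp add: D_def)
qed

text \<open>For the softmax policy the running cost is zero, so the gap is contracted to
  zero.\<close>

lemma policy_val_soft_policy:
  "policy_val P \<gamma> (soft_policy R) (reg_reward R (soft_policy R)) s = soft_v R s"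
proof -
  define D where "D s = soft_v R s - policy_val P \<gamma> (soft_policy R) (reg_reward R (soft_policy R)) s" for s
  have "norm (D s) \<le> 0 / (1 - \<gamma>)"
  proof (rule finite_contraction_le[OF \<gamma>_less])
    fix s B assume "\<And>w. norm (D w) \<le> B"
    then have "norm (mean (soft_policy R s) (\<lambda>a. mean (P s a) D)) \<le> B"
      by (intro norm_mean_le) auto
    moreover have "D s = \<gamma> * mean (soft_policy R s) (\<lambda>a. mean (P s a) D)"
      unfolding D_def by (subst soft_gap_eq) (simp add: rel_entropy_def)
    ultimately show "norm (D s) \<le> 0 + \<gamma> * B"
      using \<gamma>_nonneg by (simp add: abs_mult mult_left_mono)
  qed
  then show ?thesis by (simp add: D_def)
qed

text \<open>A gap that is zero in every state leaves the divergence as the only term, and Gibbs'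
  equality case applies.\<close>

lemma soft_policy_unique:
  assumes "\<And>s. policy_val P \<gamma> \<pi> (reg_reward R \<pi>) s = soft_v R s"
  shows "\<pi> = soft_policy R"
proof
  fix s
  have "rel_entropy R \<pi> s = 0"
    using soft_gap_eq[of R s \<pi>] \<tau>_pos by (simp add: assms)
  then show "\<pi> s = soft_policy R s"
    unfolding rel_entropy_def by (intro gibbs_inequality(2)) (simp_all add: pmf_soft_policy)
qed

lemma opt_policy_eq_soft_policy:
  assumes "\<And>s. 0 < pmf \<rho> s"
  shows "opt_policy \<rho> P \<gamma> \<tau> r x = soft_policy (\<lambda>s a. r s a x)"
proof -
  let ?R = "\<lambda>s a. r s a x"
  have V: "V_fun P \<gamma> \<tau> r x \<pi> s = policy_val P \<gamma> \<pi> (reg_reward ?R \<pi>) s" for \<pi> s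
    unfolding V_fun_eq_mean_disc[OF \<gamma>_pos \<gamma>_less] policy_val_def reg_reward_def ..
  have le: "pmf \<rho> s * V_fun P \<gamma> \<tau> r x \<pi> s \<le> pmf \<rho> s * soft_v ?R s" for \<pi> s
    unfolding V by (intro mult_left_mono policy_val_le_soft_v) simp
  have opt: "V_fun P \<gamma> \<tau> r x (soft_policy ?R) s = soft_v ?R s" for s
    unfolding V by (rule policy_val_soft_policy)
  show ?thesis
    unfolding opt_policy_def
  proof (rule the_equality)
    show "\<forall>\<pi>'. (\<Sum>s\<in>UNIV. pmf \<rho> s * V_fun P \<gamma> \<tau> r x \<pi>' s)
        \<le> (\<Sum>s\<in>UNIV. pmf \<rho> s * V_fun P \<gamma> \<tau> r x (soft_policy ?R) s)"
      unfolding opt by (intro allI sum_mono le)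
  next
    fix \<pi> assume "\<forall>\<pi>'. (\<Sum>s\<in>UNIV. pmf \<rho> s * V_fun P \<gamma> \<tau> r x \<pi>' s)
        \<le> (\<Sum>s\<in>UNIV. pmf \<rho> s * V_fun P \<gamma> \<tau> r x \<pi> s)"
    then have "(\<Sum>s\<in>UNIV. pmf \<rho> s * soft_v ?R s) \<le> (\<Sum>s\<in>UNIV. pmf \<rho> s * V_fun P \<gamma> \<tau> r x \<pi> s)"
      by (metis (no_types, lifting) opt sum.cong)
    moreover have "(\<Sum>s\<in>UNIV. pmf \<rho> s * V_fun P \<gamma> \<tau> r x \<pi> s) \<le> (\<Sum>s\<in>UNIV. pmf \<rho> s * soft_v ?R s)"
      by (intro sum_mono le)
    ultimately have "(\<Sum>s\<in>UNIV. pmf \<rho> s * V_fun P \<gamma> \<tau> r x \<pi> s) = (\<Sum>s\<in>UNIV. pmf \<rho> s * soft_v ?R s)"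
      by simp
    \<comment> \<open>Termwise inequality with equal sums gives termwise equality; positivity of
      \<open>\<rho>\<close> then cancels the weights.\<close>
    then have "pmf \<rho> s * V_fun P \<gamma> \<tau> r x \<pi> s = pmf \<rho> s * soft_v ?R s" for s
      by (rule sum_mono_inv) (use le in auto)
    then have "V_fun P \<gamma> \<tau> r x \<pi> s = soft_v ?R s" for s
      using assms[of s] by (metis mult_cancel_left order_less_irrefl)
    then show "\<pi> = soft_policy ?R"
      unfolding V by (rule soft_policy_unique)
  qed
qed

section \<open>Sensitivity of the soft-optimal values and policy to the reward\<close>

lemma soft_v_diff_ge:
  "policy_val P \<gamma> (soft_policy R) (\<lambda>z. R' (fst z) (snd z) - R (fst z) (snd z)) s \<le> soft_v R' s - soft_v R s"
proof -
  \<comment> \<open>The policy optimal for \<open>R\<close> is merely admissible for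
    \<open>R'\<close>. Its entropy is the same under both rewards and cancels.\<close>
  have "policy_val P \<gamma> (soft_policy R) (\<lambda>z. R' (fst z) (snd z) - R (fst z) (snd z)) s =
      policy_val P \<gamma> (soft_policy R) (reg_reward R' (soft_policy R)) s
      - policy_val P \<gamma> (soft_policy R) (reg_reward R (soft_policy R)) s"
    unfolding policy_val_diff[OF \<gamma>_nonneg \<gamma>_less, symmetric] by (simp add: reg_reward_def)
  then show ?thesis
    using policy_val_le_soft_v[of "soft_policy R" R' s] policy_val_soft_policy[of R s] by simp
qed

text \<open>The lower bound with the two rewards exchanged, negated.\<close>

lemma soft_v_diff_le:
  "soft_v R' s - soft_v R s \<le> policy_val P \<gamma> (soft_policy R') (\<lambda>z. R' (fst z) (snd z) - R (fst z) (snd z)) s"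
  using soft_v_diff_ge[of R' R s]
    policy_val_bounded_linear[OF \<gamma>_nonneg \<gamma>_less bounded_linear_minus[OF bounded_linear_ident],
      of P "soft_policy R'" "\<lambda>z. R' (fst z) (snd z) - R (fst z) (snd z)" s]
  by simp

lemma abs_soft_v_diff_le:
  assumes "\<And>s a. \<bar>R' s a - R s a\<bar> \<le> D"
  shows "\<bar>soft_v R' s - soft_v R s\<bar> \<le> D / (1 - \<gamma>)"
proof -
  have "norm (policy_val P \<gamma> \<pi> (\<lambda>z. R' (fst z) (snd z) - R (fst z) (snd z)) s) \<le> D / (1 - \<gamma>)" for \<pi>
    using assms by (intro norm_policy_val_le \<gamma>_nonneg \<gamma>_less) simp
  from this[of "soft_policy R"] this[of "soft_policy R'"] show ?thesis
    using soft_v_diff_ge[of R R' s] soft_v_diff_le[of R' s R] by (simp add: abs_le_iff)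
qed

lemma abs_soft_q_diff_le:
  assumes "\<And>s a. \<bar>R' s a - R s a\<bar> \<le> D"
  shows "\<bar>soft_q R' s a - soft_q R s a\<bar> \<le> D / (1 - \<gamma>)"
proof -
  have "norm (mean (P s a) (\<lambda>w. soft_v R' w - soft_v R w)) \<le> D / (1 - \<gamma>)"
    using abs_soft_v_diff_le[OF assms] by (intro norm_mean_le) auto
  then have "\<gamma> * \<bar>mean (P s a) (\<lambda>w. soft_v R' w - soft_v R w)\<bar> \<le> \<gamma> * (D / (1 - \<gamma>))"
    by (intro mult_left_mono \<gamma>_nonneg) simp
  moreover have "soft_q R' s a - soft_q R s a =
      (R' s a - R s a) + \<gamma> * mean (P s a) (\<lambda>w. soft_v R' w - soft_v R w)"
    by (simp add: soft_q_def mean_diff algebra_simps)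
  ultimately have "\<bar>soft_q R' s a - soft_q R s a\<bar> \<le> D + \<gamma> * (D / (1 - \<gamma>))"
    using assms[of s a] \<gamma>_nonneg
      abs_triangle_ineq[of "R' s a - R s a" "\<gamma> * mean (P s a) (\<lambda>w. soft_v R' w - soft_v R w)"]
    unfolding abs_mult by linarith
  also have "\<dots> = D / (1 - \<gamma>)"
    using \<gamma>_less by (simp add: field_simps)
  finally show ?thesis .
qed

text \<open>The log-probability is the difference of \<open>soft_q\<close> and \<open>soft_v\<close>
  over \<tau>. Each of the two moves by at most D / (1 - \<gamma>), and \<open>exp\<close> does not
  enlarge the change because log-probabilities are nonpositive.\<close>

lemma abs_pmf_soft_policy_diff_le:
  assumes "\<And>s a. \<bar>R' s a - R s a\<bar> \<le> D"
  shows "\<bar>pmf (soft_policy R' s) a - pmf (soft_policy R s) a\<bar> \<le> 2 * D / (\<tau> * (1 - \<gamma>))"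
proof -
  have nonpos: "(soft_q R s a - soft_v R s) / \<tau> \<le> 0" for R
  proof -
    have "exp ((soft_q R s a - soft_v R s) / \<tau>) \<le> 1"
      unfolding pmf_soft_policy[symmetric] by (rule pmf_le_1)
    then show ?thesis by simp
  qed
  have "\<bar>pmf (soft_policy R' s) a - pmf (soft_policy R s) a\<bar>
      \<le> \<bar>(soft_q R' s a - soft_v R' s) / \<tau> - (soft_q R s a - soft_v R s) / \<tau>\<bar>"
    unfolding pmf_soft_policy by (intro abs_exp_diff_le nonpos)
  also have "\<dots> = \<bar>(soft_q R' s a - soft_q R s a) - (soft_v R' s - soft_v R s)\<bar> / \<tau>"
    using \<tau>_pos by (simp add: diff_divide_distrib[symmetric] abs_divide algebra_simps)
  also have "\<dots> \<le> (D / (1 - \<gamma>) + D / (1 - \<gamma>)) / \<tau>"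
  proof (rule divide_right_mono)
    have "\<bar>soft_v R' s - soft_v R s\<bar> \<le> D / (1 - \<gamma>)" "\<bar>soft_q R' s a - soft_q R s a\<bar> \<le> D / (1 - \<gamma>)"
      by (rule abs_soft_v_diff_le[OF assms], rule abs_soft_q_diff_le[OF assms])
    then show "\<bar>(soft_q R' s a - soft_q R s a) - (soft_v R' s - soft_v R s)\<bar> \<le> D / (1 - \<gamma>) + D / (1 - \<gamma>)"
      by linarith
  qed (use \<tau>_pos in simp)
  also have "\<dots> = 2 * D / (\<tau> * (1 - \<gamma>))"
    by (simp add: mult_2 mult.commute flip: add_divide_distrib)
  finally show ?thesis .
qed

end


section \<open>Gradients\<close>

text \<open>\<open>grad\<close> is a definite description, so it needs a witness: the Riesz vector
  of the derivative, assembled from the standard basis.\<close>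

lemma gderiv_grad:
  assumes "cont_diff g"
  shows "GDERIV g x :> grad g x"
proof -
  obtain g' where g': "(g has_derivative g') (at x)"
    using assms unfolding cont_diff_def differentiable_def by blast
  then have "linear g'" by (rule has_derivative_linear)
  then have "g' h = inner h (\<Sum>b\<in>Basis. g' b *\<^sub>R b)" for h
    by (subst (1) euclidean_representation[symmetric, of h])
      (simp add: linear_sum linear_scale inner_sum_right mult.commute)
  then have "g' = (\<lambda>h. inner h (\<Sum>b\<in>Basis. g' b *\<^sub>R b))" by (rule ext)
  with g' have "GDERIV g x :> (\<Sum>b\<in>Basis. g' b *\<^sub>R b)"
    unfolding gderiv_def by simp
  with grad_eqI[OF this] show ?thesis by simp
qed

lemma gderiv_mvt:
  fixes f :: "'v::real_inner \<Rightarrow> real"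
  assumes "\<And>z. GDERIV f z :> G z"
  obtains t where "0 < t" "t < 1" "f y - f x = inner (y - x) (G (x + t *\<^sub>R (y - x)))"
proof -
  have "((\<lambda>t. f (x + t *\<^sub>R (y - x))) has_real_derivative inner (y - x) (G (x + t *\<^sub>R (y - x)))) (at t)" for t
  proof -
    have "((\<lambda>t. x + t *\<^sub>R (y - x)) has_derivative (\<lambda>h. h *\<^sub>R (y - x))) (at t)"
      by (auto intro!: derivative_eq_intros)
    from has_derivative_compose[OF this assms[unfolded gderiv_def]] show ?thesis
      by (simp add: has_field_derivative_def mult_commute_abs)
  qed
  from MVT2[of 0 1 "\<lambda>t. f (x + t *\<^sub>R (y - x))", OF zero_less_one this] that show ?thesis
    by auto
qed

lemma abs_diff_le_of_norm_gderiv_le: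
  fixes f :: "'v::real_inner \<Rightarrow> real"
  assumes "\<And>z. GDERIV f z :> G z" "\<And>z. norm (G z) \<le> C"
  shows "\<bar>f y - f x\<bar> \<le> C * norm (y - x)"
proof -
  obtain t where "f y - f x = inner (y - x) (G (x + t *\<^sub>R (y - x)))"
    by (rule gderiv_mvt[OF assms(1)])
  then have "\<bar>f y - f x\<bar> \<le> norm (y - x) * norm (G (x + t *\<^sub>R (y - x)))"
    by (simp add: Cauchy_Schwarz_ineq2)
  also have "\<dots> \<le> norm (y - x) * C"
    by (intro mult_left_mono assms) simp
  finally show ?thesis by (simp add: mult.commute)
qed

text \<open>The mean value theorem on the segment takes the place of integrating the gradient,
  whence the constant \<open>L\<close> instead of L / 2.\<close>

lemma gderiv_taylor_le:
  fixes f :: "'v::real_inner \<Rightarrow> real"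
  assumes "\<And>z. GDERIV f z :> G z" "\<And>x y. norm (G x - G y) \<le> L * norm (x - y)"
  shows "\<bar>f y - f x - inner (y - x) (G x)\<bar> \<le> L * (norm (y - x))\<^sup>2"
proof (cases "y = x")
  case False
  \<comment> \<open>The sign of \<open>L\<close> is not assumed; the Lipschitz bound at two distinct
    points supplies it.\<close>
  have "0 \<le> L * norm (y - x)" using order.trans[OF norm_ge_zero assms(2)] .
  with False have "0 \<le> L" by (simp add: zero_le_mult_iff)
  obtain t where t: "0 < t" "t < 1" "f y - f x = inner (y - x) (G (x + t *\<^sub>R (y - x)))"
    by (rule gderiv_mvt[OF assms(1)])
  then have "\<bar>f y - f x - inner (y - x) (G x)\<bar> \<le> norm (y - x) * norm (G (x + t *\<^sub>R (y - x)) - G x)"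
    by (simp add: Cauchy_Schwarz_ineq2 flip: inner_diff_right)
  also have "\<dots> \<le> norm (y - x) * (L * (t * norm (y - x)))"
    using assms(2)[of "x + t *\<^sub>R (y - x)" x] t by (intro mult_left_mono) auto
  also have "\<dots> \<le> norm (y - x) * (L * (1 * norm (y - x)))"
    using \<open>0 \<le> L\<close> t by (intro mult_left_mono mult_right_mono) auto
  finally show ?thesis by (simp add: power2_eq_square algebra_simps)
qed simp

text \<open>A quadratic remainder at one point is what a squeeze between two policy values delivers,
  and it already identifies the gradient there.\<close>

lemma gderiv_of_taylor_le:
  fixes f :: "'v::real_inner \<Rightarrow> real"
  assumes "\<And>y. \<bar>f y - f x - inner (y - x) D\<bar> \<le> C * (norm (y - x))\<^sup>2"
  shows "GDERIV f x :> D"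
  unfolding gderiv_def has_derivative_at
proof
  show "bounded_linear (\<lambda>h. inner h D)" by (rule bounded_linear_inner_left)
  have lim: "((\<lambda>h. C * norm h) \<longlongrightarrow> 0) (at (0::'v))"
    using tendsto_mult[OF tendsto_const[of C] tendsto_norm[OF tendsto_ident_at[of 0 UNIV]]] by simp
  show "(\<lambda>h. norm (f (x + h) - f x - inner h D) / norm h) \<midarrow>0\<rightarrow> 0"
  proof (rule Lim_null_comparison[OF _ lim], rule always_eventually, rule allI)
    fix h
    have "norm (f (x + h) - f x - inner h D) / norm h \<le> C * (norm h)\<^sup>2 / norm h"
      using assms[of "x + h"] by (intro divide_right_mono) auto
    also have "\<dots> = C * norm h" by (simp add: power2_eq_square)
    finally show "norm (norm (f (x + h) - f x - inner h D) / norm h) \<le> C * norm h" by simp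
  qed
qed

text \<open>A unit step in the direction of \<open>D\<close> changes \<open>f\<close> by
  \<open>norm D\<close> up to \<open>C\<close>, while the bound on \<open>f\<close> allows a change
  of at most 2 B.\<close>

lemma norm_le_of_taylor_le:
  fixes f :: "'v::real_inner \<Rightarrow> real"
  assumes "\<And>y. \<bar>f y - f x - inner (y - x) D\<bar> \<le> C * (norm (y - x))\<^sup>2"
    and "\<And>y. \<bar>f y\<bar> \<le> B" "0 \<le> C"
  shows "norm D \<le> 2 * B + C"
proof (cases "D = 0")
  case True
  then show ?thesis using order.trans[OF abs_ge_zero assms(2)[of x]] assms(3) by simp
next
  case False
  define y where "y = x + D /\<^sub>R norm D"
  have "norm (y - x) = 1" "inner (y - x) D = norm D"
    using False by (simp_all add: y_def dot_square_norm power2_eq_square)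
  then show ?thesis
    using assms(1)[of y] assms(2)[of y] assms(2)[of x] by simp
qed


section \<open>Differentiability of the optimal values\<close>

lemma abs_pmf_diff_le_policy_vec:
  "\<bar>pmf (\<pi> s) a - pmf (\<pi>' s) a\<bar> \<le> norm (policy_vec \<pi> - policy_vec \<pi>')"
proof -
  have "\<bar>pmf (\<pi> s) a - pmf (\<pi>' s) a\<bar> = norm ((policy_vec \<pi> - policy_vec \<pi>') $ s $ a)"
    by (simp add: policy_vec_def)
  also have "\<dots> \<le> norm (policy_vec \<pi> - policy_vec \<pi>')"
    by (rule order.trans[OF Finite_Cartesian_Product.norm_nth_le Finite_Cartesian_Product.norm_nth_le])
  finally show ?thesis .
qed

lemma norm_policy_vec_diff_le:
  fixes \<pi> \<pi>' :: "('s::finite, 'a::finite) policy"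
  assumes "\<And>s a. \<bar>pmf (\<pi> s) a - pmf (\<pi>' s) a\<bar> \<le> \<delta>"
  shows "norm (policy_vec \<pi> - policy_vec \<pi>') \<le> real CARD('s) * real CARD('a) * \<delta>"
proof -
  have "norm (policy_vec \<pi> - policy_vec \<pi>') \<le> (\<Sum>s\<in>UNIV. norm ((policy_vec \<pi> - policy_vec \<pi>') $ s))"
    unfolding norm_vec_def[where 'a = "real^'a"] by (rule L2_set_le_sum) simp
  also have "\<dots> \<le> (\<Sum>s\<in>(UNIV::'s set). real CARD('a) * \<delta>)"
  proof (rule sum_mono)
    fix s
    have "norm ((policy_vec \<pi> - policy_vec \<pi>') $ s) \<le> (\<Sum>a\<in>UNIV. \<bar>(policy_vec \<pi> - policy_vec \<pi>') $ s $ a\<bar>)"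
      by (rule norm_le_l1_cart)
    also have "\<dots> \<le> (\<Sum>a\<in>(UNIV::'a set). \<delta>)"
      using assms by (intro sum_mono) (simp add: policy_vec_def)
    finally show "norm ((policy_vec \<pi> - policy_vec \<pi>') $ s) \<le> real CARD('a) * \<delta>" by simp
  qed
  finally show ?thesis by simp
qed

lemma abs_pmf_sa_step_diff_le:
  assumes "\<And>s a. \<bar>pmf (\<pi> s) a - pmf (\<pi>' s) a\<bar> \<le> \<delta>"
  shows "\<bar>pmf (sa_step P \<pi> z) w - pmf (sa_step P \<pi>' z) w\<bar> \<le> \<delta>"
proof -
  have "\<bar>pmf (sa_step P \<pi> z) w - pmf (sa_step P \<pi>' z) w\<bar> =
      pmf (P (fst z) (snd z)) (fst w) * \<bar>pmf (\<pi> (fst w)) (snd w) - pmf (\<pi>' (fst w)) (snd w)\<bar>"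
    by (simp add: pmf_sa_step abs_mult flip: right_diff_distrib)
  also have "\<dots> \<le> 1 * \<delta>"
    by (intro mult_mono assms pmf_le_1) auto
  finally show ?thesis by simp
qed

text \<open>The policy enters twice, through the first action and through the chain. The constant
  \<open>c\<close> is obtained before policies, reward and bounds, hence uniform in them.\<close>

lemma norm_policy_val_policy_diff_le:
  fixes P :: "('s::finite, 'a::finite) kernel"
  assumes \<gamma>: "0 \<le> \<gamma>" "\<gamma> < 1"
  obtains c where "0 \<le> c"
    "\<And>\<pi> \<pi>' \<delta> C s and g :: 's \<times> 'a \<Rightarrow> 'b::{banach, second_countable_topology}.
      (\<And>s a. \<bar>pmf (\<pi> s) a - pmf (\<pi>' s) a\<bar> \<le> \<delta>) \<Longrightarrow> (\<And>z. norm (g z) \<le> C) \<Longrightarrow>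
      norm (policy_val P \<gamma> \<pi> g s - policy_val P \<gamma> \<pi>' g s) \<le> c * \<delta> * C"
proof
  define c where "c = real CARD('s \<times> 'a) / (1 - \<gamma>) / (1 - \<gamma>) + real CARD('a) / (1 - \<gamma>)"
  show "0 \<le> c" using \<gamma> by (simp add: c_def)
  fix \<pi> \<pi>' :: "('s, 'a) policy" and \<delta> C s and g :: "'s \<times> 'a \<Rightarrow> 'b"
  assume \<delta>: "\<And>s a. \<bar>pmf (\<pi> s) a - pmf (\<pi>' s) a\<bar> \<le> \<delta>" and C: "\<And>z. norm (g z) \<le> C"
  let ?u = "disc (sa_step P \<pi>) \<gamma> g" and ?v = "disc (sa_step P \<pi>') \<gamma> g"
  have "policy_val P \<gamma> \<pi> g s - policy_val P \<gamma> \<pi>' g s =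
      mean (\<pi> s) (\<lambda>a. ?u (s, a) - ?v (s, a)) + (\<Sum>a\<in>UNIV. (pmf (\<pi> s) a - pmf (\<pi>' s) a) *\<^sub>R ?v (s, a))"
    by (simp add: policy_val_eq mean_eq_sum[of UNIV] scaleR_diff_right scaleR_diff_left sum_subtractf)
  also have "norm \<dots> \<le> real CARD('s \<times> 'a) * \<delta> * (C / (1 - \<gamma>)) / (1 - \<gamma>) + (\<Sum>a\<in>(UNIV::'a set). \<delta> * (C / (1 - \<gamma>)))"
  proof (intro norm_triangle_mono norm_mean_le sum_norm_le)
    show "norm (?u (s, a) - ?v (s, a)) \<le> real CARD('s \<times> 'a) * \<delta> * (C / (1 - \<gamma>)) / (1 - \<gamma>)" for a
      by (intro norm_disc_kernel_diff_le[OF \<gamma>] abs_pmf_sa_step_diff_le \<delta> C)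
    show "norm ((pmf (\<pi> s) a - pmf (\<pi>' s) a) *\<^sub>R ?v (s, a)) \<le> \<delta> * (C / (1 - \<gamma>))" for a
    proof -
      have "norm (?v (s, a)) \<le> C / (1 - \<gamma>)"
        by (rule norm_disc_le[OF \<gamma> C])
      with mult_mono[OF \<delta>[of s a] this] order.trans[OF abs_ge_zero \<delta>] show ?thesis by simp
    qed
  qed simp
  also have "\<dots> = c * \<delta> * C"
    by (simp add: c_def add_divide_distrib algebra_simps)
  finally show "norm (policy_val P \<gamma> \<pi> g s - policy_val P \<gamma> \<pi>' g s) \<le> c * \<delta> * C" .
qed

locale parametric_mdp = entropy_mdp P \<gamma> \<tau>
  for P :: "('s::finite, 'a::finite) kernel" and \<gamma> \<tau> :: real +
  fixes r :: "'s \<Rightarrow> 'a \<Rightarrow> real^'n \<Rightarrow> real" and C_rx L_r :: real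
  assumes r_diff: "\<And>s a. cont_diff (r s a)"
    and norm_grad_r_le: "\<And>s a x. norm (grad (r s a) x) \<le> C_rx"
    and grad_r_lip: "\<And>s a x y. norm (grad (r s a) x - grad (r s a) y) \<le> L_r * norm (x - y)"
begin

abbreviation rew :: "real^'n \<Rightarrow> 's \<Rightarrow> 'a \<Rightarrow> real" where
  "rew x \<equiv> \<lambda>s a. r s a x"

abbreviation opt :: "real^'n \<Rightarrow> ('s, 'a) policy" where
  "opt x \<equiv> soft_policy (rew x)"

definition grad_r :: "real^'n \<Rightarrow> 's \<times> 'a \<Rightarrow> real^'n" where
  "grad_r x z = grad (r (fst z) (snd z)) x"

lemma C_rx_nonneg: "0 \<le> C_rx"
  using order.trans[OF norm_ge_zero norm_grad_r_le] .

lemma norm_grad_r: "norm (grad_r x z) \<le> C_rx"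
  unfolding grad_r_def by (rule norm_grad_r_le)

lemma r_lip: "\<bar>r s a y - r s a x\<bar> \<le> C_rx * norm (y - x)"
  by (rule abs_diff_le_of_norm_gderiv_le[OF gderiv_grad[OF r_diff] norm_grad_r_le])

definition L_opt :: real where
  "L_opt = 2 * C_rx / (\<tau> * (1 - \<gamma>))"

lemma L_opt_nonneg: "0 \<le> L_opt"
  using C_rx_nonneg \<tau>_pos \<gamma>_less by (simp add: L_opt_def)

lemma opt_lip: "\<bar>pmf (opt y s) a - pmf (opt x s) a\<bar> \<le> L_opt * norm (y - x)"
  using abs_pmf_soft_policy_diff_le[of "rew y" "rew x", OF r_lip] by (simp add: L_opt_def mult.assoc)

text \<open>The envelope argument: the optimal value at \<open>y\<close> exceeds that of the policy optimal at \<open>x\<close>, and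
  conversely, so the increment of the optimal value is squeezed between two policy values of
  \<open>r(y) - r(x)\<close>, whose policies differ by \<open>O(\<parallel>y - x\<parallel>)\<close>.\<close>

lemma gderiv_soft_v: "GDERIV (\<lambda>x. soft_v (rew x) s) x :> policy_val P \<gamma> (opt x) (grad_r x) s"
proof -
  obtain c where c: "0 \<le> c"
    "\<And>\<pi> \<pi>' \<delta> C s and g :: 's \<times> 'a \<Rightarrow> real.
      (\<And>s a. \<bar>pmf (\<pi> s) a - pmf (\<pi>' s) a\<bar> \<le> \<delta>) \<Longrightarrow> (\<And>z. norm (g z) \<le> C) \<Longrightarrow>
      norm (policy_val P \<gamma> \<pi> g s - policy_val P \<gamma> \<pi>' g s) \<le> c * \<delta> * C"
    by (rule norm_policy_val_policy_diff_le[OF \<gamma>_nonneg \<gamma>_less]) blast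
  show ?thesis
  proof (rule gderiv_of_taylor_le)
    fix y
    define \<Delta> where "\<Delta> = (\<lambda>z. rew y (fst z) (snd z) - rew x (fst z) (snd z))"
    let ?V = "\<lambda>u. policy_val P \<gamma> (opt u) \<Delta> s"
    let ?D = "policy_val P \<gamma> (opt x) (grad_r x) s"
    have lower: "?V x \<le> soft_v (rew y) s - soft_v (rew x) s"
      unfolding \<Delta>_def by (rule soft_v_diff_ge)
    have upper: "soft_v (rew y) s - soft_v (rew x) s \<le> ?V y"
      unfolding \<Delta>_def by (rule soft_v_diff_le)
    \<comment> \<open>Second order, as a product of two first-order quantities: the change of the
      optimal policy and the size of the reward increment.\<close>
    have "norm (?V y - ?V x) \<le> c * (L_opt * norm (y - x)) * (C_rx * norm (y - x))"
      by (intro c opt_lip) (simp add: \<Delta>_def r_lip)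
    then have change: "\<bar>?V y - ?V x\<bar> \<le> c * L_opt * C_rx * (norm (y - x))\<^sup>2"
      by (simp add: power2_eq_square algebra_simps)
    have "inner (y - x) ?D = policy_val P \<gamma> (opt x) (\<lambda>z. inner (y - x) (grad_r x z)) s"
      by (rule policy_val_bounded_linear[OF \<gamma>_nonneg \<gamma>_less bounded_linear_inner_right])
    then have "?V x - inner (y - x) ?D = policy_val P \<gamma> (opt x) (\<lambda>z. \<Delta> z - inner (y - x) (grad_r x z)) s"
      by (simp add: policy_val_diff[OF \<gamma>_nonneg \<gamma>_less])
    \<comment> \<open>Linearizing the reward itself leaves its Taylor remainder, summed with
      discount.\<close>
    also have "norm \<dots> \<le> L_r * (norm (y - x))\<^sup>2 / (1 - \<gamma>)"
    proof (rule norm_policy_val_le[OF \<gamma>_nonneg \<gamma>_less])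
      show "norm (\<Delta> z - inner (y - x) (grad_r x z)) \<le> L_r * (norm (y - x))\<^sup>2" for z
        using gderiv_taylor_le[OF gderiv_grad[OF r_diff] grad_r_lip, of "fst z" "snd z" y x]
        by (simp add: \<Delta>_def grad_r_def)
    qed
    finally have "\<bar>?V x - inner (y - x) ?D\<bar> \<le> L_r / (1 - \<gamma>) * (norm (y - x))\<^sup>2" by simp
    with lower upper change
    have "\<bar>soft_v (rew y) s - soft_v (rew x) s - inner (y - x) ?D\<bar>
        \<le> c * L_opt * C_rx * (norm (y - x))\<^sup>2 + L_r / (1 - \<gamma>) * (norm (y - x))\<^sup>2"
      by linarith
    then show "\<bar>soft_v (rew y) s - soft_v (rew x) s - inner (y - x) ?D\<bar>
        \<le> (c * L_opt * C_rx + L_r / (1 - \<gamma>)) * (norm (y - x))\<^sup>2"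
      by (simp add: distrib_right)
  qed
qed

text \<open>Differentiating the definition of \<open>soft_q\<close> reproduces the recursion of
  \<open>disc\<close> for the reward gradients.\<close>

lemma gderiv_soft_q:
  "GDERIV (\<lambda>x. soft_q (rew x) s a) x :> disc (sa_step P (opt x)) \<gamma> (grad_r x) (s, a)"
proof -
  have "((\<lambda>x. r s a x + \<gamma> * (\<Sum>w\<in>UNIV. pmf (P s a) w * soft_v (rew x) w)) has_derivative
      (\<lambda>h. inner h (grad (r s a) x)
        + \<gamma> * (\<Sum>w\<in>UNIV. pmf (P s a) w * inner h (policy_val P \<gamma> (opt x) (grad_r x) w)))) (at x)"
    by (intro has_derivative_add has_derivative_mult_right has_derivative_sum
        gderiv_grad[OF r_diff, unfolded gderiv_def] gderiv_soft_v[unfolded gderiv_def])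
  moreover have "disc (sa_step P (opt x)) \<gamma> (grad_r x) (s, a) = grad (r s a) x
      + \<gamma> *\<^sub>R (\<Sum>w\<in>UNIV. pmf (P s a) w *\<^sub>R policy_val P \<gamma> (opt x) (grad_r x) w)"
    by (subst disc_sa_step_eq[OF \<gamma>_nonneg \<gamma>_less]) (simp add: grad_r_def mean_eq_sum[of UNIV])
  ultimately show ?thesis
    by (simp add: gderiv_def soft_q_def mean_eq_sum[of UNIV] inner_add_right inner_sum_right)
qed

end


section \<open>The hyper-gradient\<close>

lemma pmf_replicate_pmf:
  assumes "length xs = n"
  shows "pmf (replicate_pmf n p) xs = (\<Prod>i<n. pmf p (xs ! i))"
  using assms
proof (induction n arbitrary: xs)
  case (Suc n)
  then obtain y ys where xs: "xs = y # ys" "length ys = n"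
    by (metis length_Suc_conv)
  have "pmf (replicate_pmf (Suc n) p) xs = pmf p y * pmf (map_pmf ((#) y) (replicate_pmf n p)) (y # ys)"
    unfolding xs replicate_pmf.simps map_pmf_def
    by (rule pmf_bind_single) (auto simp: pmf_eq_0_set_pmf)
  also have "pmf (map_pmf ((#) y) (replicate_pmf n p)) (y # ys) = pmf (replicate_pmf n p) ys"
    by (rule pmf_map_inj') simp
  finally show ?case
    by (simp add: Suc.IH xs prod.lessThan_Suc_shift del: prod.lessThan_Suc replicate_pmf.simps)
qed simp

lemma length_roll_sa: "w \<in> set_pmf (roll_sa P \<pi> n z) \<Longrightarrow> length w = n"
  by (induction n arbitrary: z w) auto

lemma length_roll_s: "w \<in> set_pmf (roll_s P \<pi> n s) \<Longrightarrow> length w = n"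
  by (auto simp: roll_s_def dest: length_roll_sa)

lemma length_traj_pmf: "w \<in> set_pmf (traj_pmf \<rho> P H \<pi>) \<Longrightarrow> length w = H"
  by (auto simp: traj_pmf_def dest: length_roll_s)

lemma set_tuple_pmf: "set_pmf (replicate_pmf I (traj_pmf \<rho> P H \<pi>)) \<subseteq> traj_tuples I H"
  by (auto simp: set_replicate_pmf traj_tuples_def dest: length_traj_pmf)

lemma finite_traj_tuples: "finite (traj_tuples I H :: ('s::finite, 'a::finite) traj list set)"
proof -
  have "traj_tuples I H = {d. set d \<subseteq> {t :: ('s, 'a) traj. set t \<subseteq> UNIV \<and> length t = H} \<and> length d = I}"
    by (auto simp: traj_tuples_def)
  then show ?thesis
    by (simp only:) (intro finite_lists_length_eq finite)
qed

lemma finite_set_tuple_pmf: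
  "finite (set_pmf (replicate_pmf I (traj_pmf \<rho> (P :: ('s::finite, 'a::finite) kernel) H \<pi>)))"
  by (rule finite_subset[OF set_tuple_pmf finite_traj_tuples])

text \<open>Gauge for the joint dependence on point and policy: sampling uses an approximate policy,
  while the gradient of the objective belongs to the optimal one.\<close>

definition joint_dist :: "(real^'n) \<times> ('s::finite, 'a::finite) policy \<Rightarrow> (real^'n) \<times> ('s, 'a) policy \<Rightarrow> real" where
  "joint_dist p q = norm (fst p - fst q) + norm (policy_vec (snd p) - policy_vec (snd q))"

lemma joint_dist_nonneg: "0 \<le> joint_dist p q"
  by (simp add: joint_dist_def)

lemma bdd_lip_joint_pmf:
  "bdd_lip joint_dist (\<lambda>p :: (real^'n) \<times> ('s::finite, 'a::finite) policy. pmf (snd p s) a)"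
proof (rule bdd_lipI[where B = 1 and L = 1])
  show "norm (pmf (snd p s) a - pmf (snd q s) a) \<le> 1 * joint_dist p q" for p q :: "(real^'n) \<times> ('s, 'a) policy"
    using abs_pmf_diff_le_policy_vec[of "snd p" s a "snd q"] norm_ge_zero[of "fst p - fst q"]
    unfolding joint_dist_def by (simp add: add_increasing)
qed (auto simp: pmf_le_1 joint_dist_nonneg)

lemma bdd_lip_joint_fst:
  assumes "bdd_lip (\<lambda>x y. norm (x - y)) f"
  shows "bdd_lip joint_dist (\<lambda>p. f (fst p))"
  by (rule bdd_lip_compose[OF assms, of 1]) (simp_all add: joint_dist_def)

locale bilevel = parametric_mdp P \<gamma> \<tau> r C_rx L_r
  for P :: "('s::finite, 'a::finite) kernel" and \<gamma> \<tau> and r :: "'s \<Rightarrow> 'a \<Rightarrow> real^'n \<Rightarrow> real"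
    and C_rx L_r :: real +
  fixes \<rho>' :: "'s pmf" and P' :: "('s, 'a) kernel" and I H :: nat
    and l :: "('s, 'a) traj list \<Rightarrow> real^'n \<Rightarrow> real" and C_l L_l L_l1 :: real
  assumes H_pos: "1 \<le> H"
    and l_le: "\<And>d x. d \<in> traj_tuples I H \<Longrightarrow> \<bar>l d x\<bar> \<le> C_l"
    and l_diff: "\<And>d. d \<in> traj_tuples I H \<Longrightarrow> cont_diff (l d)"
    and l_lip: "\<And>d x y. d \<in> traj_tuples I H \<Longrightarrow> \<bar>l d x - l d y\<bar> \<le> L_l * norm (x - y)"
    and grad_l_lip: "\<And>d x y. d \<in> traj_tuples I H \<Longrightarrow> norm (grad (l d) x - grad (l d) y) \<le> L_l1 * norm (x - y)"
begin

abbreviation tuple_pmf :: "('s, 'a) policy \<Rightarrow> ('s, 'a) traj list pmf" where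
  "tuple_pmf \<pi> \<equiv> replicate_pmf I (traj_pmf \<rho>' P' H \<pi>)"

definition obj :: "real^'n \<Rightarrow> real" where
  "obj x = mean (tuple_pmf (opt x)) (\<lambda>d. l d x)"

text \<open>The gradient of the logarithm of the probability of \<open>d\<close> under the optimal policy is
  \<open>score / \<tau>\<close>.\<close>

definition score :: "('s, 'a) policy \<Rightarrow> ('s \<times> 'a \<Rightarrow> real^'n) \<Rightarrow> ('s, 'a) traj list \<Rightarrow> real^'n" where
  "score \<pi> g d = (\<Sum>i<I. \<Sum>h<H. disc (sa_step P \<pi>) \<gamma> g (d ! i ! h) - policy_val P \<gamma> \<pi> g (fst (d ! i ! h)))"

text \<open>The score-function formula for an arbitrary policy. It is the gradient of
  \<open>obj\<close> at \<open>\<pi> = opt x\<close>; for other policies it is what the estimator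
  approximates when it samples from \<open>\<pi>\<close>.\<close>

definition hyper_grad :: "real^'n \<Rightarrow> ('s, 'a) policy \<Rightarrow> real^'n" where
  "hyper_grad x \<pi> =
    mean (tuple_pmf \<pi>) (\<lambda>d. grad (l d) x + (l d x / \<tau>) *\<^sub>R score \<pi> (grad_r x) d)"

text \<open>The part of the probability of a tuple contributed by the initial law and the
  transitions; it involves no policy, so it is a constant factor under differentiation.\<close>

definition kernel_weight :: "('s, 'a) traj list \<Rightarrow> real" where
  "kernel_weight d = (\<Prod>i<I. pmf \<rho>' (fst (d ! i ! 0)) *
    (\<Prod>h<H-1. pmf (P' (fst (d ! i ! h)) (snd (d ! i ! h))) (fst (d ! i ! (h + 1)))))"

lemma pmf_tuple_pmf:
  assumes "d \<in> traj_tuples I H"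
  shows "pmf (tuple_pmf \<pi>) d =
    kernel_weight d * (\<Prod>i<I. \<Prod>h<H. pmf (\<pi> (fst (d ! i ! h))) (snd (d ! i ! h)))"
proof -
  obtain H' where H': "H = Suc H'" using H_pos by (cases H) auto
  have "pmf (traj_pmf \<rho>' P' H \<pi>) (d ! i) = pmf \<rho>' (fst (d ! i ! 0)) *
      (\<Prod>h<H-1. pmf (P' (fst (d ! i ! h)) (snd (d ! i ! h))) (fst (d ! i ! (h + 1)))) *
      (\<Prod>h<H. pmf (\<pi> (fst (d ! i ! h))) (snd (d ! i ! h)))" if "i < I" for i
  proof -
    have "length (d ! i) = H" using assms that by (auto simp: traj_tuples_def)
    from pmf_traj_pmf[OF H_pos this] show ?thesis
      by (simp add: H' prod.distrib mult_ac)
  qed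
  moreover have "length d = I" using assms by (simp add: traj_tuples_def)
  ultimately show ?thesis
    by (simp add: pmf_replicate_pmf kernel_weight_def prod.distrib)
qed

lemma pmf_tuple_opt:
  assumes "d \<in> traj_tuples I H"
  shows "pmf (tuple_pmf (opt x)) d = kernel_weight d * exp (\<Sum>i<I. \<Sum>h<H.
    (soft_q (rew x) (fst (d ! i ! h)) (snd (d ! i ! h)) - soft_v (rew x) (fst (d ! i ! h))) / \<tau>)"
  unfolding pmf_tuple_pmf[OF assms] pmf_soft_policy by (simp add: exp_sum)

text \<open>\<open>obj\<close> is a finite sum over tuples, and under softmax policies each
  probability is a constant times the exponential of a sum of \<open>soft_q\<close> minus
  \<open>soft_v\<close> over \<tau>. Differentiating the exponential returns the probability times
  \<open>score / \<tau>\<close>.\<close>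

lemma gderiv_obj: "GDERIV obj x :> hyper_grad x (opt x)"
proof -
  let ?T = "traj_tuples I H :: ('s, 'a) traj list set"
  let ?A = "\<lambda>d x. \<Sum>i<I. \<Sum>h<H.
    (soft_q (rew x) (fst (d ! i ! h)) (snd (d ! i ! h)) - soft_v (rew x) (fst (d ! i ! h))) / \<tau>"
  have obj: "obj = (\<lambda>x. \<Sum>d\<in>?T. kernel_weight d * exp (?A d x) * l d x)"
    unfolding obj_def
    by (rule ext, subst mean_eq_sum[OF finite_traj_tuples set_tuple_pmf]) (simp add: pmf_tuple_opt)
  have A: "(?A d has_derivative (\<lambda>h. inner h (score (opt x) (grad_r x) d) / \<tau>)) (at x)" for d
  proof -
    have "(?A d has_derivative (\<lambda>u. \<Sum>i<I. \<Sum>h<H.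
      (inner u (disc (sa_step P (opt x)) \<gamma> (grad_r x) (fst (d ! i ! h), snd (d ! i ! h)))
        - inner u (policy_val P \<gamma> (opt x) (grad_r x) (fst (d ! i ! h)))) / \<tau>)) (at x)"
      unfolding divide_inverse
      by (intro has_derivative_sum has_derivative_diff has_derivative_mult_left
          gderiv_soft_q[unfolded gderiv_def] gderiv_soft_v[unfolded gderiv_def])
    then show ?thesis
      by (simp add: score_def inner_sum_right inner_diff_right sum_divide_distrib)
  qed
  have E: "((\<lambda>x. exp (?A d x)) has_derivative
      (\<lambda>h. exp (?A d x) * (inner h (score (opt x) (grad_r x) d) / \<tau>))) (at x)" for d
    using has_derivative_exp[OF A[of d]] by (simp add: mult.commute)
  have "(obj has_derivative (\<lambda>h. \<Sum>d\<in>?T. kernel_weight d * exp (?A d x) * inner h (grad (l d) x)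
      + (kernel_weight d * (exp (?A d x) * (inner h (score (opt x) (grad_r x) d) / \<tau>))) * l d x)) (at x)"
    unfolding obj
    by (intro has_derivative_sum has_derivative_mult has_derivative_mult_right
        E gderiv_grad[OF l_diff, unfolded gderiv_def])
  also have "(\<lambda>h. \<Sum>d\<in>?T. kernel_weight d * exp (?A d x) * inner h (grad (l d) x)
      + (kernel_weight d * (exp (?A d x) * (inner h (score (opt x) (grad_r x) d) / \<tau>))) * l d x) =
      (\<lambda>h. inner h (hyper_grad x (opt x)))"
    unfolding hyper_grad_def
    by (rule ext, subst mean_eq_sum[OF finite_traj_tuples set_tuple_pmf])
      (auto simp: pmf_tuple_opt inner_sum_right inner_add_right algebra_simps intro!: sum.cong)
  finally show ?thesis unfolding gderiv_def .
qed

lemma hyper_obj_eq_obj: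
  assumes "\<And>s. 0 < pmf \<rho> s"
  shows "hyper_obj \<rho> P \<gamma> \<tau> r \<rho>' P' I H l = obj"
  by (rule ext) (simp add: hyper_obj_def upper_obj_def obj_def opt_policy_eq_soft_policy[OF assms])

section \<open>Boundedness and Lipschitz continuity of the hyper-gradient\<close>

lemma abs_obj_le: "\<bar>obj x\<bar> \<le> C_l"
  unfolding obj_def real_norm_def[symmetric]
  by (intro norm_mean_le finite_set_tuple_pmf) (auto intro!: l_le intro: set_tuple_pmf[THEN subsetD])

text \<open>The bound of \<open>norm_le_of_taylor_le\<close> for a function bounded by
  \<open>C_l\<close>; the maximum supplies the nonnegative remainder constant required
  there.\<close>

definition C_grad_l :: real where
  "C_grad_l = 2 * C_l + max L_l1 0"

lemma norm_grad_l_le: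
  assumes "d \<in> traj_tuples I H"
  shows "norm (grad (l d) x) \<le> C_grad_l"
  unfolding C_grad_l_def
proof (rule norm_le_of_taylor_le[OF gderiv_taylor_le[OF gderiv_grad[OF l_diff]]])
  show "norm (grad (l d) x - grad (l d) y) \<le> max L_l1 0 * norm (x - y)" for x y
    using order.trans[OF grad_l_lip[OF assms] mult_right_mono[OF max.cobounded1 norm_ge_zero]] .
qed (use assms l_le in auto)

lemma bdd_lip_hyper_grad: "bdd_lip joint_dist (\<lambda>p. hyper_grad (fst p) (snd p))"
proof -
  have step: "bdd_lip joint_dist (\<lambda>p. pmf (sa_step P (snd p) z) w)"
    for z w
    unfolding pmf_sa_step by (intro bdd_lip_mult bdd_lip_const bdd_lip_joint_pmf)
  have "bdd_lip (\<lambda>x y. norm (x - y)) (\<lambda>x. grad_r x z)" for z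
    unfolding grad_r_def by (rule bdd_lipI[OF norm_grad_r_le grad_r_lip]) simp
  note grad_r = bdd_lip_joint_fst[OF this]
  have disc: "bdd_lip joint_dist (\<lambda>p. disc (sa_step P (snd p)) \<gamma> (grad_r (fst p)) z)" for z
    by (intro bdd_lip_disc \<gamma>_nonneg \<gamma>_less grad_r step)
  have score: "bdd_lip joint_dist (\<lambda>p. score (snd p) (grad_r (fst p)) d)" for d
    unfolding score_def policy_val_eq
    by (intro bdd_lip_sum bdd_lip_diff disc bdd_lip_mean bdd_lip_joint_pmf)
  have l: "bdd_lip (\<lambda>x y. norm (x - y)) (l d)" if "d \<in> traj_tuples I H" for d
    by (rule bdd_lipI[where B = C_l and L = L_l]) (use that l_le l_lip in auto)
  have grad_l: "bdd_lip (\<lambda>x y. norm (x - y)) (grad (l d))" if "d \<in> traj_tuples I H" for d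
    by (rule bdd_lipI[OF norm_grad_l_le[OF that] grad_l_lip[OF that]]) simp
  have tuple: "bdd_lip joint_dist (\<lambda>p. pmf (tuple_pmf (snd p)) d)" if "d \<in> traj_tuples I H"
    for d
    unfolding pmf_tuple_pmf[OF that]
    by (intro bdd_lip_mult bdd_lip_const bdd_lip_prod bdd_lip_joint_pmf)
  show ?thesis
    unfolding hyper_grad_def mean_eq_sum[OF finite_traj_tuples set_tuple_pmf] divide_inverse
    by (intro bdd_lip_sum bdd_lip_scaleR bdd_lip_add bdd_lip_mult bdd_lip_const score tuple
        bdd_lip_joint_fst l grad_l)
qed

text \<open>The optimal policy is Lipschitz in \<open>x\<close>, so joint Lipschitz continuity can
  be composed with \<open>x\<close> paired with \<open>opt x\<close>.\<close>

lemma bdd_lip_hyper_grad_opt: "bdd_lip (\<lambda>x y. norm (x - y)) (\<lambda>x. hyper_grad x (opt x))"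
proof -
  have "norm (policy_vec (opt x) - policy_vec (opt y))
      \<le> real CARD('s) * real CARD('a) * (L_opt * norm (x - y))" for x y
    by (rule norm_policy_vec_diff_le) (rule opt_lip)
  then have "joint_dist (x, opt x) (y, opt y) \<le> (1 + real CARD('s) * real CARD('a) * L_opt) * norm (x - y)" for x y
    by (simp add: joint_dist_def algebra_simps)
  with L_opt_nonneg show ?thesis
    using bdd_lip_compose[OF bdd_lip_hyper_grad, of "1 + real CARD('s) * real CARD('a) * L_opt"
        "\<lambda>x. (x, opt x)" "\<lambda>x y. norm (x - y)"] by simp
qed

end


section \<open>Independent draws\<close>

definition lists_of :: "'z set \<Rightarrow> nat \<Rightarrow> 'z list set" where
  "lists_of A n = {xs. set xs \<subseteq> A \<and> length xs = n}"

lemma finite_lists_of: "finite A \<Longrightarrow> finite (lists_of A n)"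
  unfolding lists_of_def by (rule finite_lists_length_eq)

lemma traj_tuples_eq: "traj_tuples I H = lists_of (lists_of UNIV H) I"
  by (auto simp: traj_tuples_def lists_of_def)

lemma set_replicate_pmf_lists_of: "set_pmf p \<subseteq> A \<Longrightarrow> set_pmf (replicate_pmf n p) \<subseteq> lists_of A n"
  by (auto simp: set_replicate_pmf lists_of_def)

lemma set_map_draw_lists_of:
  assumes "ys \<in> lists_of B n" "\<And>y. y \<in> B \<Longrightarrow> set_pmf (f y) \<subseteq> A"
  shows "set_pmf (map_draw f ys) \<subseteq> lists_of A n"
proof -
  have "set_pmf (map_draw f ys) \<subseteq> lists_of A (length ys)" if "set ys \<subseteq> B"
    using that by (induction ys) (fastforce simp: lists_of_def dest: assms(2))+
  with assms(1) show ?thesis by (auto simp: lists_of_def)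
qed

lemma map_nth_replicate_pmf:
  "i < n \<Longrightarrow> map_pmf (\<lambda>xs. xs ! i) (replicate_pmf n p) = p"
proof (induction n arbitrary: i)
  case (Suc n)
  then show ?case
    by (cases i) (simp_all add: map_bind_pmf bind_return_pmf' map_pmf_def[symmetric] pmf.map_comp o_def)
qed simp

lemma map_nth_map_draw:
  "i < length ys \<Longrightarrow> map_pmf (\<lambda>zs. zs ! i) (map_draw f ys) = f (ys ! i)"
proof (induction ys arbitrary: i)
  case (Cons y ys)
  then show ?case
    by (cases i) (simp_all add: map_bind_pmf bind_return_pmf' map_pmf_def[symmetric] pmf.map_comp o_def)
qed simp

lemma mean_nth_replicate_pmf: "i < n \<Longrightarrow> mean (replicate_pmf n p) (\<lambda>xs. f (xs ! i)) = mean p f"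
  using integral_map_pmf[of "\<lambda>xs. xs ! i" "replicate_pmf n p" f] by (simp add: map_nth_replicate_pmf)

lemma mean_nth_map_draw: "i < length ys \<Longrightarrow> mean (map_draw f ys) (\<lambda>zs. g (zs ! i)) = mean (f (ys ! i)) g"
  using integral_map_pmf[of "\<lambda>zs. zs ! i" "map_draw f ys" g] by (simp add: map_nth_map_draw)

lemma finite_set_replicate_pmf:
  "finite (set_pmf p) \<Longrightarrow> finite (set_pmf (replicate_pmf n p))"
  by (rule finite_subset[OF set_replicate_pmf_lists_of[OF order_refl] finite_lists_of])

lemma finite_set_map_draw:
  "(\<And>y. finite (set_pmf (f y))) \<Longrightarrow> finite (set_pmf (map_draw f ys))"
  by (induction ys) auto

text \<open>Drawing all tuples and then all branches has the same law as drawing independent triples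
  of a tuple with its branches. This makes the summands of the estimator independent. The
  continuation \<open>c\<close> lets the induction pass through the nested draws.\<close>

lemma bind_replicate_map_draw:
  "bind_pmf (replicate_pmf n p) (\<lambda>D. bind_pmf (map_draw f D) (\<lambda>X. bind_pmf (map_draw g D) (\<lambda>Y. c D X Y))) =
   bind_pmf (replicate_pmf n (bind_pmf p (\<lambda>d. bind_pmf (f d) (\<lambda>x. bind_pmf (g d) (\<lambda>y. return_pmf (d, x, y))))))
     (\<lambda>R. c (map fst R) (map (fst \<circ> snd) R) (map (snd \<circ> snd) R))"
proof (induction n arbitrary: c)
  case 0
  then show ?case by (simp add: bind_return_pmf)
next
  case (Suc n)
  let ?R = "replicate_pmf n p"
  \<comment> \<open>Both branch draws for the head must precede the draws for the tail; independent
    draws commute.\<close>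
  have "bind_pmf ?R (\<lambda>D. bind_pmf (f d) (\<lambda>x. bind_pmf (map_draw f D) (\<lambda>X.
      bind_pmf (g d) (\<lambda>y. bind_pmf (map_draw g D) (\<lambda>Y. c (d # D) (x # X) (y # Y)))))) =
    bind_pmf (f d) (\<lambda>x. bind_pmf (g d) (\<lambda>y. bind_pmf ?R (\<lambda>D. bind_pmf (map_draw f D) (\<lambda>X.
      bind_pmf (map_draw g D) (\<lambda>Y. c (d # D) (x # X) (y # Y))))))" for d
    by (subst bind_commute_pmf, subst (2) bind_commute_pmf, subst (3) bind_commute_pmf) simp
  then show ?case
    by (simp add: bind_assoc_pmf bind_return_pmf Suc.IH)
qed

text \<open>Independent centred vectors are orthogonal in mean square, so adding one more
  contributes exactly its own second moment.\<close>

lemma mean_norm_sum_replicate_pmf: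
  fixes Y :: "'z \<Rightarrow> 'b::{real_inner, banach, second_countable_topology}"
  assumes p: "finite (set_pmf p)" and "mean p Y = 0"
  shows "mean (replicate_pmf n p) (\<lambda>xs. (norm (\<Sum>i<n. Y (xs ! i)))\<^sup>2) = real n * mean p (\<lambda>x. (norm (Y x))\<^sup>2)"
proof (induction n)
  case 0
  then show ?case by simp
next
  case (Suc n)
  let ?R = "replicate_pmf n p" and ?S = "\<lambda>xs. \<Sum>i<n. Y (xs ! i)"
  have fin: "finite (set_pmf ?R)" by (rule finite_set_replicate_pmf[OF p])
  have "mean ?R (\<lambda>xs. Y (xs ! i)) = 0" if "i < n" for i
    using mean_nth_replicate_pmf[OF that, of p Y] assms(2) by simp
  then have S0: "mean ?R ?S = 0"
    by (simp add: mean_sum[OF fin])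
  have inner0: "mean ?R (\<lambda>xs. inner (Y x) (?S xs)) = 0" for x
    using integral_inner_right[of "Y x" ?R ?S] S0 by (simp add: integrable_measure_pmf_finite[OF fin])
  have "mean ?R (\<lambda>xs. (norm (Y x + ?S xs))\<^sup>2) = (norm (Y x))\<^sup>2 + mean ?R (\<lambda>xs. (norm (?S xs))\<^sup>2)" for x
  proof -
    have "mean ?R (\<lambda>xs. (norm (Y x + ?S xs))\<^sup>2) =
        mean ?R (\<lambda>xs. (norm (Y x))\<^sup>2 + 2 * inner (Y x) (?S xs) + (norm (?S xs))\<^sup>2)"
      by (intro mean_cong) (simp add: power2_norm_eq_inner inner_add inner_commute)
    also have "\<dots> = (norm (Y x))\<^sup>2 + 2 * mean ?R (\<lambda>xs. inner (Y x) (?S xs)) + mean ?R (\<lambda>xs. (norm (?S xs))\<^sup>2)"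
      by (subst mean_add[OF fin])+ simp
    finally show ?thesis by (simp add: inner0)
  qed
  note split = this
  have "mean (replicate_pmf (Suc n) p) (\<lambda>xs. (norm (\<Sum>i<Suc n. Y (xs ! i)))\<^sup>2) =
      mean p (\<lambda>x. mean ?R (\<lambda>xs. (norm (Y x + ?S xs))\<^sup>2))"
    by (simp add: mean_bind p fin map_pmf_def[symmetric] sum.lessThan_Suc_shift del: sum.lessThan_Suc)
  also have "\<dots> = mean p (\<lambda>x. (norm (Y x))\<^sup>2) + mean ?R (\<lambda>xs. (norm (?S xs))\<^sup>2)"
    unfolding split by (simp add: mean_add[OF p])
  finally show ?case by (simp add: Suc.IH algebra_simps)
qed


lemma norm_sum_sq_le: "(norm (a + b))\<^sup>2 \<le> 2 * (norm a)\<^sup>2 + 2 * (norm b)\<^sup>2"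
  for a b :: "'v::real_normed_vector"
proof -
  have "(norm (a + b))\<^sup>2 \<le> (norm a + norm b)\<^sup>2"
    by (intro power_mono norm_triangle_ineq) simp
  also have "\<dots> \<le> 2 * (norm a)\<^sup>2 + 2 * (norm b)\<^sup>2"
    using sum_squares_bound[of "norm a" "norm b"] by (simp add: power2_sum)
  finally show ?thesis .
qed


section \<open>The hyper-gradient estimator\<close>

lemma set_roll_sa: "set_pmf (roll_sa P \<pi> n z) \<subseteq> lists_of UNIV n"
  by (auto simp: lists_of_def dest: length_roll_sa)

lemma set_roll_s: "set_pmf (roll_s P \<pi> n s) \<subseteq> lists_of UNIV n"
  by (auto simp: lists_of_def dest: length_roll_s)

lemma finite_set_roll_sa: "finite (set_pmf (roll_sa (P :: ('s::finite, 'a::finite) kernel) \<pi> n z))"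
  by (rule finite_subset[OF set_roll_sa]) (simp add: finite_lists_of)

lemma finite_set_roll_s: "finite (set_pmf (roll_s (P :: ('s::finite, 'a::finite) kernel) \<pi> n s))"
  by (rule finite_subset[OF set_roll_s]) (simp add: finite_lists_of)

text \<open>The rollout begins with \<open>z\<close> itself, so its term of index 0 is the
  \<open>g z\<close> of the recursion and the tail is a shorter rollout from a successor.\<close>

lemma mean_roll_sa:
  fixes P :: "('s::finite, 'a::finite) kernel"
  shows "mean (roll_sa P \<pi> n z) (\<lambda>w. \<Sum>t<n. \<gamma> ^ t *\<^sub>R g (w ! t)) = disc_upto (sa_step P \<pi>) \<gamma> g n z"
proof (induction n arbitrary: z)
  case 0
  then show ?case by simp
next
  case (Suc n)
  let ?B = "bind_pmf (sa_step P \<pi> z) (roll_sa P \<pi> n)"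
  have fin: "finite (set_pmf ?B)" by (simp add: finite_set_roll_sa)
  have "mean (roll_sa P \<pi> (Suc n) z) (\<lambda>w. \<Sum>t<Suc n. \<gamma> ^ t *\<^sub>R g (w ! t)) =
      mean ?B (\<lambda>w. g z + \<gamma> *\<^sub>R (\<Sum>t<n. \<gamma> ^ t *\<^sub>R g (w ! t)))"
    by (simp add: sum.lessThan_Suc_shift scaleR_sum_right del: sum.lessThan_Suc)
  also have "\<dots> = g z + \<gamma> *\<^sub>R mean ?B (\<lambda>w. \<Sum>t<n. \<gamma> ^ t *\<^sub>R g (w ! t))"
    by (simp add: mean_add[OF fin])
  also have "mean ?B (\<lambda>w. \<Sum>t<n. \<gamma> ^ t *\<^sub>R g (w ! t)) = mean (sa_step P \<pi> z) (disc_upto (sa_step P \<pi>) \<gamma> g n)"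
    by (simp add: mean_bind finite_set_roll_sa Suc.IH)
  finally show ?case by simp
qed

lemma mean_roll_s:
  fixes P :: "('s::finite, 'a::finite) kernel"
  shows "mean (roll_s P \<pi> n s) (\<lambda>w. \<Sum>t<n. \<gamma> ^ t *\<^sub>R g (w ! t)) =
    mean (sa_init \<pi> s) (disc_upto (sa_step P \<pi>) \<gamma> g n)"
  unfolding roll_s_def by (simp add: mean_bind finite_set_roll_sa mean_roll_sa)

text \<open>A finite set carrying the samples of every policy at once, so that the random policy of
  an iteration does not affect the range of summation.\<close>

definition sample_set :: "nat \<Rightarrow> nat \<Rightarrow> nat \<Rightarrow> nat \<Rightarrow> nat \<Rightarrow> ('s, 'a) sample set" where
  "sample_set I H M J T = lists_of (traj_tuples I H) M \<times>
    lists_of (lists_of (lists_of (lists_of (lists_of UNIV T) J) H) I) M \<times>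
    lists_of (lists_of (lists_of (lists_of (lists_of UNIV T) J) H) I) M"

lemma finite_sample_set: "finite (sample_set I H M J T :: ('s::finite, 'a::finite) sample set)"
  unfolding sample_set_def traj_tuples_eq
  by (intro finite_cartesian_product finite_lists_of) simp_all

lemma set_sample_pmf:
  fixes P :: "('s, 'a) kernel"
  shows "set_pmf (sample_pmf \<rho>' P' I H P M J T \<pi>) \<subseteq> sample_set I H M J T"
proof -
  have D: "set_pmf (replicate_pmf M (replicate_pmf I (traj_pmf \<rho>' P' H \<pi>))) \<subseteq> lists_of (traj_tuples I H) M"
    by (rule set_replicate_pmf_lists_of[OF set_tuple_pmf])
  have draw: "set_pmf (map_draw (map_draw (map_draw (\<lambda>z. replicate_pmf J (q z)))) D)
      \<subseteq> lists_of (lists_of (lists_of (lists_of (lists_of UNIV T) J) H) I) M"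
    if "D \<in> lists_of (traj_tuples I H) M" "\<And>z. set_pmf (q z) \<subseteq> lists_of UNIV T"
    for D :: "('s, 'a) traj list list" and q :: "'s \<times> 'a \<Rightarrow> ('s, 'a) traj pmf"
    using that unfolding traj_tuples_eq
    by (intro set_map_draw_lists_of[where B = "lists_of (lists_of UNIV H) I"]
        set_map_draw_lists_of[where B = "lists_of UNIV H"] set_map_draw_lists_of[where B = UNIV]
        set_replicate_pmf_lists_of) auto
  have q: "set_pmf (map_draw (map_draw (map_draw (\<lambda>z. replicate_pmf J (roll_sa P \<pi> T z)))) D)
      \<subseteq> lists_of (lists_of (lists_of (lists_of (lists_of UNIV T) J) H) I) M"
    if "D \<in> lists_of (traj_tuples I H) M" for D :: "('s, 'a) traj list list"
    by (intro draw that set_roll_sa)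
  have v: "set_pmf (map_draw (map_draw (map_draw (\<lambda>z. replicate_pmf J (roll_s P \<pi> T (fst z))))) D)
      \<subseteq> lists_of (lists_of (lists_of (lists_of (lists_of UNIV T) J) H) I) M"
    if "D \<in> lists_of (traj_tuples I H) M" for D :: "('s, 'a) traj list list"
    by (intro draw that set_roll_s)
  show ?thesis
    unfolding sample_pmf_def sample_set_def
    by (auto dest: subsetD[OF D] subsetD[OF q] subsetD[OF v])
qed

text \<open>The bound holds for every list \<open>js\<close>: any entry is some state-action pair,
  and the gradient bound covers all pairs.\<close>

lemma norm_disc_grad_est_le:
  assumes "0 \<le> \<gamma>" "\<gamma> < 1" and C: "\<And>s a. norm (grad (r s a) x) \<le> C"
  shows "norm (disc_grad_est \<gamma> r J T js x) \<le> C / (1 - \<gamma>)"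
proof -
  have "0 \<le> C" using order.trans[OF norm_ge_zero C] .
  have "norm (\<Sum>t<T. \<gamma> ^ t *\<^sub>R grad (r (fst (js ! j ! t)) (snd (js ! j ! t))) x) \<le> C / (1 - \<gamma>)" for j
  proof -
    have "norm (\<Sum>t<T. \<gamma> ^ t *\<^sub>R grad (r (fst (js ! j ! t)) (snd (js ! j ! t))) x) \<le> (\<Sum>t<T. \<gamma> ^ t * C)"
      using assms by (intro sum_norm_le) (simp add: mult_left_mono)
    also have "\<dots> \<le> (\<Sum>t. \<gamma> ^ t * C)"
      using assms \<open>0 \<le> C\<close> by (intro sum_le_suminf summable_mult2 summable_geometric) auto
    also have "\<dots> = C / (1 - \<gamma>)"
      using assms by (simp add: suminf_geometric suminf_mult2[symmetric] summable_geometric)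
    finally show ?thesis .
  qed
  then have "norm (\<Sum>j<J. \<Sum>t<T. \<gamma> ^ t *\<^sub>R grad (r (fst (js ! j ! t)) (snd (js ! j ! t))) x)
      \<le> (\<Sum>j<J. C / (1 - \<gamma>))"
    by (rule sum_norm_le)
  from mult_left_mono[OF this, of "1 / real J"]
  have "norm (disc_grad_est \<gamma> r J T js x) \<le> (1 / real J) * (\<Sum>j<J. C / (1 - \<gamma>))"
    unfolding disc_grad_est_def by simp
  also have "\<dots> \<le> C / (1 - \<gamma>)" using assms \<open>0 \<le> C\<close> by simp
  finally show ?thesis .
qed

section \<open>Size, bias and variance of the estimator\<close>

context bilevel
begin

text \<open>The contribution of one tuple and its branches; the estimator is the average of
  \<open>M\<close> of these.\<close>

definition term_est :: "nat \<Rightarrow> nat \<Rightarrow> real^'n \<Rightarrow>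
    ('s, 'a) traj list \<times> ('s, 'a) traj list list list \<times> ('s, 'a) traj list list list \<Rightarrow> real^'n" where
  "term_est J T x = (\<lambda>(d, \<xi>, \<zeta>). grad (l d) x + (l d x / \<tau>) *\<^sub>R (\<Sum>i<I. \<Sum>h<H.
    disc_grad_est \<gamma> r J T (\<xi> ! i ! h) x - disc_grad_est \<gamma> r J T (\<zeta> ! i ! h) x))"

definition term_pmf :: "nat \<Rightarrow> nat \<Rightarrow> ('s, 'a) policy \<Rightarrow>
    (('s, 'a) traj list \<times> ('s, 'a) traj list list list \<times> ('s, 'a) traj list list list) pmf" where
  "term_pmf J T \<pi> = bind_pmf (tuple_pmf \<pi>) (\<lambda>d.
    bind_pmf (map_draw (map_draw (\<lambda>z. replicate_pmf J (roll_sa P \<pi> T z))) d) (\<lambda>\<xi>.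
    bind_pmf (map_draw (map_draw (\<lambda>z. replicate_pmf J (roll_s P \<pi> T (fst z)))) d) (\<lambda>\<zeta>.
    return_pmf (d, \<xi>, \<zeta>))))"

definition C_est :: real where
  "C_est = C_grad_l + C_l / \<tau> * (real I * (real H * (C_rx / (1 - \<gamma>) + C_rx / (1 - \<gamma>))))"

abbreviation est :: "nat \<Rightarrow> nat \<Rightarrow> nat \<Rightarrow> ('s, 'a) sample \<Rightarrow> real^'n \<Rightarrow> real^'n" where
  "est \<equiv> hypergrad_est \<gamma> \<tau> r I H l"

abbreviation samples :: "nat \<Rightarrow> nat \<Rightarrow> nat \<Rightarrow> ('s, 'a) policy \<Rightarrow> ('s, 'a) sample pmf" where
  "samples \<equiv> sample_pmf \<rho>' P' I H P"

lemma hypergrad_est_eq: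
  "est M J T (D, \<xi>, \<zeta>) x = (1 / real M) *\<^sub>R (\<Sum>m<M. term_est J T x (D ! m, \<xi> ! m, \<zeta> ! m))"
  by (simp add: hypergrad_est_def term_est_def sum.distrib scaleR_add_right scaleR_sum_right mult.commute)

text \<open>A sample is a transposed list of \<open>M\<close> independent triples with law
  \<open>term_pmf\<close>.\<close>

lemma sample_pmf_eq:
  "samples M J T \<pi> = map_pmf (\<lambda>R. (map fst R, map (fst \<circ> snd) R, map (snd \<circ> snd) R))
    (replicate_pmf M (term_pmf J T \<pi>))"
  unfolding sample_pmf_def term_pmf_def pair_pmf_def map_pmf_def bind_assoc_pmf bind_return_pmf
  by (rule bind_replicate_map_draw)

lemma finite_set_term_pmf: "finite (set_pmf (term_pmf J T \<pi>))"
  unfolding term_pmf_def set_bind_pmf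
  by (intro finite_UN_I finite_set_tuple_pmf finite_set_map_draw finite_set_replicate_pmf
      finite_set_roll_sa finite_set_roll_s) simp

lemma C_l_nonneg: "0 \<le> C_l"
  using order.trans[OF abs_ge_zero abs_obj_le] .

lemma norm_term_est_le:
  assumes "d \<in> traj_tuples I H"
  shows "norm (term_est J T x (d, \<xi>, \<zeta>)) \<le> C_est"
proof -
  have "norm (\<Sum>i<I. \<Sum>h<H. disc_grad_est \<gamma> r J T (\<xi> ! i ! h) x - disc_grad_est \<gamma> r J T (\<zeta> ! i ! h) x)
      \<le> (\<Sum>i<I. \<Sum>h<H. C_rx / (1 - \<gamma>) + C_rx / (1 - \<gamma>))"
    by (intro sum_norm_le order.trans[OF norm_triangle_ineq4] add_mono
        norm_disc_grad_est_le \<gamma>_nonneg \<gamma>_less norm_grad_r_le)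
  moreover have "\<bar>l d x / \<tau>\<bar> \<le> C_l / \<tau>"
    using l_le[OF assms, of x] \<tau>_pos by (simp add: abs_divide divide_right_mono)
  ultimately have "norm ((l d x / \<tau>) *\<^sub>R (\<Sum>i<I. \<Sum>h<H. disc_grad_est \<gamma> r J T (\<xi> ! i ! h) x - disc_grad_est \<gamma> r J T (\<zeta> ! i ! h) x))
      \<le> C_l / \<tau> * (real I * (real H * (C_rx / (1 - \<gamma>) + C_rx / (1 - \<gamma>))))"
    unfolding norm_scaleR using C_l_nonneg \<tau>_pos by (intro mult_mono) simp_all
  then show ?thesis
    unfolding term_est_def C_est_def prod.case
    by (rule norm_triangle_mono[OF norm_grad_l_le[OF assms]])
qed

text \<open>A pathwise bound at every point \<open>x\<close>. It keeps the directions
  \<open>h k\<close> bounded along the run.\<close>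

lemma norm_est_le:
  assumes "s \<in> sample_set I H M J T" "1 \<le> M"
  shows "norm (est M J T s x) \<le> C_est"
proof -
  obtain D \<xi> \<zeta> where s: "s = (D, \<xi>, \<zeta>)" by (cases s) auto
  have "D ! m \<in> traj_tuples I H" if "m < M" for m
    using assms(1) that unfolding s sample_set_def lists_of_def by (auto intro!: subsetD[OF _ nth_mem])
  then have "norm (\<Sum>m<M. term_est J T x (D ! m, \<xi> ! m, \<zeta> ! m)) \<le> (\<Sum>m<M. C_est)"
    by (intro sum_norm_le norm_term_est_le) auto
  then show ?thesis
    using assms(2) unfolding s hypergrad_est_eq by (simp add: field_simps)
qed

text \<open>Supplies measurability of the estimate at the random iterate, one sample value at a
  time.\<close>

lemma continuous_est:
  assumes "s \<in> sample_set I H M J T"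
  shows "continuous_on UNIV (est M J T s)"
proof -
  obtain D \<xi> \<zeta> where s: "s = (D, \<xi>, \<zeta>)" by (cases s) auto
  have D: "D ! m \<in> traj_tuples I H" if "m < M" for m
    using assms(1) that unfolding s sample_set_def lists_of_def by (auto intro!: subsetD[OF _ nth_mem])
  have l: "continuous_on UNIV (l d)" "continuous_on UNIV (grad (l d))" if "d \<in> traj_tuples I H" for d
    using l_diff[OF that] unfolding cont_diff_def
    by (auto intro!: continuous_at_imp_continuous_on differentiable_imp_continuous_within)
  have r: "continuous_on UNIV (grad (r s a))" for s a
    using r_diff unfolding cont_diff_def by blast
  show ?thesis
    unfolding s hypergrad_est_eq term_est_def disc_grad_est_def prod.case divide_inverse
    by (intro continuous_intros l r D) auto
qed

lemma mean_disc_grad_est: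
  assumes "1 \<le> J" "finite (set_pmf q)"
  shows "mean (replicate_pmf J q) (\<lambda>js. disc_grad_est \<gamma> r J T js x) = mean q (\<lambda>w. \<Sum>t<T. \<gamma> ^ t *\<^sub>R grad_r x (w ! t))"
proof -
  have "mean (replicate_pmf J q) (\<lambda>js. disc_grad_est \<gamma> r J T js x) =
      (1 / real J) *\<^sub>R (\<Sum>j<J. mean (replicate_pmf J q) (\<lambda>js. \<Sum>t<T. \<gamma> ^ t *\<^sub>R grad_r x (js ! j ! t)))"
    unfolding disc_grad_est_def grad_r_def
    by (simp add: mean_sum[OF finite_set_replicate_pmf[OF assms(2)], symmetric])
  also have "\<dots> = (1 / real J) *\<^sub>R (\<Sum>j<J. mean q (\<lambda>w. \<Sum>t<T. \<gamma> ^ t *\<^sub>R grad_r x (w ! t)))"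
    by (intro arg_cong2[where f = scaleR] sum.cong refl
        mean_nth_replicate_pmf[where f = "\<lambda>w. \<Sum>t<T. \<gamma> ^ t *\<^sub>R grad_r x (w ! t)"]) simp
  finally show ?thesis using assms(1) by (simp add: sum_constant_scaleR del: sum_constant)
qed

definition score_upto :: "nat \<Rightarrow> ('s, 'a) policy \<Rightarrow> ('s \<times> 'a \<Rightarrow> real^'n) \<Rightarrow> ('s, 'a) traj list \<Rightarrow> real^'n" where
  "score_upto T \<pi> g d = (\<Sum>i<I. \<Sum>h<H. disc_upto (sa_step P \<pi>) \<gamma> g T (d ! i ! h)
    - mean (sa_init \<pi> (fst (d ! i ! h))) (disc_upto (sa_step P \<pi>) \<gamma> g T))"

text \<open>Given the tuple, the expression is affine in the branch estimates of each single slot,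
  so their means can be inserted. These are values truncated after \<open>T\<close> steps.\<close>

lemma mean_term_est:
  assumes "1 \<le> J"
  shows "mean (term_pmf J T \<pi>) (term_est J T x) =
    mean (tuple_pmf \<pi>) (\<lambda>d. grad (l d) x + (l d x / \<tau>) *\<^sub>R score_upto T \<pi> (grad_r x) d)"
proof -
  let ?q = "\<lambda>z. replicate_pmf J (roll_sa P \<pi> T z)" and ?v = "\<lambda>z. replicate_pmf J (roll_s P \<pi> T (fst z))"
  have fin: "finite (set_pmf (map_draw (map_draw ?q) d))" "finite (set_pmf (map_draw (map_draw ?v) d))" for d
    by (intro finite_set_map_draw finite_set_replicate_pmf finite_set_roll_sa finite_set_roll_s)+
  have "mean (term_pmf J T \<pi>) (term_est J T x) = mean (tuple_pmf \<pi>) (\<lambda>d.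
      mean (map_draw (map_draw ?q) d) (\<lambda>\<xi>. mean (map_draw (map_draw ?v) d) (\<lambda>\<zeta>. term_est J T x (d, \<xi>, \<zeta>))))"
    unfolding term_pmf_def by (simp add: mean_bind finite_set_tuple_pmf fin)
  also have "\<dots> = mean (tuple_pmf \<pi>) (\<lambda>d. grad (l d) x + (l d x / \<tau>) *\<^sub>R score_upto T \<pi> (grad_r x) d)"
  proof (rule mean_cong)
    fix d assume "d \<in> set_pmf (tuple_pmf \<pi>)"
    then have "d \<in> traj_tuples I H" using set_tuple_pmf by blast
    then have len: "length d = I" "length (d ! i) = H" if "i < I" for i
      using that by (auto simp: traj_tuples_def)
    \<comment> \<open>Only the marginal law of slot (i, h) of the nested draws matters.\<close>
    have nth: "mean (map_draw (map_draw F) d) (\<lambda>X. disc_grad_est \<gamma> r J T (X ! i ! h) x) =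
        mean (F (d ! i ! h)) (\<lambda>js. disc_grad_est \<gamma> r J T js x)" if "i < I" "h < H" for F i h
      using that len[OF that(1)]
        mean_nth_map_draw[of i d "map_draw F" "\<lambda>X. disc_grad_est \<gamma> r J T (X ! h) x"]
        mean_nth_map_draw[of h "d ! i" F "\<lambda>js. disc_grad_est \<gamma> r J T js x"] by simp
    show "mean (map_draw (map_draw ?q) d) (\<lambda>\<xi>. mean (map_draw (map_draw ?v) d) (\<lambda>\<zeta>. term_est J T x (d, \<xi>, \<zeta>))) =
        grad (l d) x + (l d x / \<tau>) *\<^sub>R score_upto T \<pi> (grad_r x) d"
      unfolding term_est_def score_upto_def prod.case
      by (simp add: mean_add mean_diff mean_sum fin nth mean_disc_grad_est[OF assms] finite_set_roll_sa
          finite_set_roll_s mean_roll_sa[where g = "grad_r x"] mean_roll_s[where g = "grad_r x"])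
  qed
  finally show ?thesis .
qed

definition C_bias :: real where
  "C_bias = C_l / \<tau> * (real I * (real H * (C_rx / (1 - \<gamma>) + C_rx / (1 - \<gamma>))))"

text \<open>Compared at the sampling policy itself, truncation of the rollouts is the only source of
  bias.\<close>

lemma norm_mean_term_est_diff_le:
  assumes "1 \<le> J"
  shows "norm (mean (term_pmf J T \<pi>) (term_est J T x) - hyper_grad x \<pi>) \<le> C_bias * \<gamma> ^ T"
proof -
  have upto: "norm (disc_upto (sa_step P \<pi>) \<gamma> (grad_r x) T z - disc (sa_step P \<pi>) \<gamma> (grad_r x) z)
      \<le> \<gamma> ^ T * (C_rx / (1 - \<gamma>))" for z
    by (rule norm_disc_upto_diff_le[OF \<gamma>_nonneg \<gamma>_less norm_grad_r])
  have score: "norm (score_upto T \<pi> (grad_r x) d - score \<pi> (grad_r x) d)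
      \<le> (\<Sum>i<I. \<Sum>h<H. \<gamma> ^ T * (C_rx / (1 - \<gamma>)) + \<gamma> ^ T * (C_rx / (1 - \<gamma>)))" for d
  proof -
    have eq: "score_upto T \<pi> (grad_r x) d - score \<pi> (grad_r x) d = (\<Sum>i<I. \<Sum>h<H.
        (disc_upto (sa_step P \<pi>) \<gamma> (grad_r x) T (d ! i ! h) - disc (sa_step P \<pi>) \<gamma> (grad_r x) (d ! i ! h))
        - mean (sa_init \<pi> (fst (d ! i ! h)))
            (\<lambda>z. disc_upto (sa_step P \<pi>) \<gamma> (grad_r x) T z - disc (sa_step P \<pi>) \<gamma> (grad_r x) z))"
      unfolding score_upto_def score_def policy_val_def
      by (simp add: mean_diff algebra_simps flip: sum_subtractf)
    show ?thesis
      unfolding eq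
      by (intro sum_norm_le order.trans[OF norm_triangle_ineq4] add_mono norm_mean_le upto) simp
  qed
  have eq: "mean (term_pmf J T \<pi>) (term_est J T x) - hyper_grad x \<pi> =
      mean (tuple_pmf \<pi>) (\<lambda>d. (l d x / \<tau>) *\<^sub>R (score_upto T \<pi> (grad_r x) d - score \<pi> (grad_r x) d))"
    unfolding mean_term_est[OF assms] hyper_grad_def mean_diff[OF finite_set_tuple_pmf, symmetric]
    by (intro mean_cong) (simp add: algebra_simps)
  have "norm (mean (term_pmf J T \<pi>) (term_est J T x) - hyper_grad x \<pi>) \<le> C_l / \<tau> *
      (\<Sum>i<I. \<Sum>h<H. \<gamma> ^ T * (C_rx / (1 - \<gamma>)) + \<gamma> ^ T * (C_rx / (1 - \<gamma>)))"
    unfolding eq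
  proof (rule norm_mean_le[OF finite_set_tuple_pmf])
    fix d assume "d \<in> set_pmf (tuple_pmf \<pi>)"
    then have "d \<in> traj_tuples I H" using set_tuple_pmf by blast
    then have "\<bar>l d x / \<tau>\<bar> \<le> C_l / \<tau>"
      using l_le \<tau>_pos by (simp add: abs_divide divide_right_mono)
    then show "norm ((l d x / \<tau>) *\<^sub>R (score_upto T \<pi> (grad_r x) d - score \<pi> (grad_r x) d)) \<le> C_l / \<tau> *
      (\<Sum>i<I. \<Sum>h<H. \<gamma> ^ T * (C_rx / (1 - \<gamma>)) + \<gamma> ^ T * (C_rx / (1 - \<gamma>)))"
      unfolding norm_scaleR using C_l_nonneg \<tau>_pos by (intro mult_mono score) simp_all
  qed
  also have "\<dots> = C_bias * \<gamma> ^ T"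
    by (simp add: C_bias_def algebra_simps)
  finally show ?thesis .
qed

text \<open>Bias and variance around an arbitrary target \<open>c\<close>. One term differs from its
  mean by at most 2 \<open>C_est\<close>, averaging \<open>M\<close> independent terms divides the
  second moment by \<open>M\<close>, and the outer factors 2 come from splitting the square.\<close>

lemma mean_est_sq_le:
  assumes "1 \<le> M" "1 \<le> J"
  shows "mean (samples M J T \<pi>) (\<lambda>s. (norm (est M J T s x - c))\<^sup>2) \<le>
    2 * (2 * C_est)\<^sup>2 / real M + 2 * (norm (mean (term_pmf J T \<pi>) (term_est J T x) - c))\<^sup>2"
proof -
  let ?p = "term_pmf J T \<pi>"
  define \<mu> where "\<mu> = mean ?p (term_est J T x)"
  define Y where "Y z = term_est J T x z - \<mu>" for z
  have fin: "finite (set_pmf ?p)" by (rule finite_set_term_pmf)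
  have bd: "norm (term_est J T x z) \<le> C_est" if "z \<in> set_pmf ?p" for z
  proof -
    from that have "fst z \<in> traj_tuples I H"
      unfolding term_pmf_def using set_tuple_pmf by fastforce
    then show ?thesis by (metis norm_term_est_le prod.collapse)
  qed
  have "norm \<mu> \<le> C_est" unfolding \<mu>_def by (rule norm_mean_le[OF fin bd])
  then have Y_le: "norm (Y z) \<le> 2 * C_est" if "z \<in> set_pmf ?p" for z
    using norm_triangle_ineq4[of "term_est J T x z" \<mu>] bd[OF that] by (simp add: Y_def)
  have Y0: "mean ?p Y = 0" unfolding Y_def by (simp add: mean_diff[OF fin] \<mu>_def)
  have le: "(norm ((1 / real M) *\<^sub>R (\<Sum>m<M. term_est J T x (R ! m)) - c))\<^sup>2
      \<le> 2 / (real M)\<^sup>2 * (norm (\<Sum>m<M. Y (R ! m)))\<^sup>2 + 2 * (norm (\<mu> - c))\<^sup>2" for R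
  proof -
    have eq: "(1 / real M) *\<^sub>R (\<Sum>m<M. term_est J T x (R ! m)) - c = (1 / real M) *\<^sub>R (\<Sum>m<M. Y (R ! m)) + (\<mu> - c)"
      using assms(1) by (simp add: Y_def sum_subtractf scaleR_diff_right sum_constant_scaleR del: sum_constant)
    show ?thesis
      unfolding eq
      using norm_sum_sq_le[of "(1 / real M) *\<^sub>R (\<Sum>m<M. Y (R ! m))" "\<mu> - c"]
      by (simp add: power_divide)
  qed
  have finR: "finite (set_pmf (replicate_pmf M ?p))" by (rule finite_set_replicate_pmf[OF fin])
  have "mean (samples M J T \<pi>) (\<lambda>s. (norm (est M J T s x - c))\<^sup>2) =
      mean (replicate_pmf M ?p) (\<lambda>R. (norm ((1 / real M) *\<^sub>R (\<Sum>m<M. term_est J T x (R ! m)) - c))\<^sup>2)"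
    unfolding sample_pmf_eq integral_map_pmf hypergrad_est_eq
  proof (rule mean_cong)
    fix R assume "R \<in> set_pmf (replicate_pmf M ?p)"
    then have "length R = M" by (simp add: set_replicate_pmf)
    then show "(norm ((1 / real M) *\<^sub>R (\<Sum>m<M. term_est J T x (map fst R ! m, map (fst \<circ> snd) R ! m, map (snd \<circ> snd) R ! m)) - c))\<^sup>2
        = (norm ((1 / real M) *\<^sub>R (\<Sum>m<M. term_est J T x (R ! m)) - c))\<^sup>2"
      by simp
  qed
  also have "\<dots> \<le> mean (replicate_pmf M ?p) (\<lambda>R. 2 / (real M)\<^sup>2 * (norm (\<Sum>m<M. Y (R ! m)))\<^sup>2 + 2 * (norm (\<mu> - c))\<^sup>2)"
    by (rule mean_mono[OF finR le])
  also have "\<dots> = 2 / (real M)\<^sup>2 * (real M * mean ?p (\<lambda>z. (norm (Y z))\<^sup>2)) + 2 * (norm (\<mu> - c))\<^sup>2"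
    unfolding mean_norm_sum_replicate_pmf[OF fin Y0, symmetric] by (simp add: mean_add[OF finR])
  also have "\<dots> \<le> 2 / (real M)\<^sup>2 * (real M * (2 * C_est)\<^sup>2) + 2 * (norm (\<mu> - c))\<^sup>2"
    by (intro add_mono mult_left_mono mean_le[OF fin] power_mono Y_le) auto
  also have "2 / (real M)\<^sup>2 * (real M * (2 * C_est)\<^sup>2) = 2 * (2 * C_est)\<^sup>2 / real M"
    using assms(1) by (simp add: power2_eq_square)
  finally show ?thesis unfolding \<mu>_def .
qed

text \<open>Variance, truncation and inexact policy, in this order. \<open>C\<close> is obtained
  before configuration, policy and point, so it holds along every run and for every
  \<open>K\<close>.\<close>

lemma mean_est_hyper_grad_sq_le:
  obtains C where "0 \<le> C"
    "\<And>M J T \<pi> x. 1 \<le> M \<Longrightarrow> 1 \<le> J \<Longrightarrow>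
      mean (samples M J T \<pi>) (\<lambda>s. (norm (est M J T s x - hyper_grad x (opt x)))\<^sup>2)
      \<le> C * (1 / real M + \<gamma> ^ T + (norm (policy_vec \<pi> - policy_vec (opt x)))\<^sup>2)"
proof -
  obtain B L where L: "0 \<le> L"
    "\<And>p q. norm (hyper_grad (fst p) (snd p) - hyper_grad (fst q) (snd q)) \<le> L * joint_dist p q"
    using bdd_lip_hyper_grad by (rule bdd_lipE) blast
  define C where "C = max (2 * (2 * C_est)\<^sup>2) (max (4 * C_bias\<^sup>2) (4 * L\<^sup>2))"
  show ?thesis
  proof
    show "0 \<le> C" unfolding C_def by (simp add: max.coboundedI1)
    fix M J T :: nat and \<pi> and x :: "real^'n" assume MJ: "1 \<le> M" "1 \<le> J"
    let ?\<delta> = "norm (policy_vec \<pi> - policy_vec (opt x))"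
    let ?\<mu> = "mean (term_pmf J T \<pi>) (term_est J T x)"
    have "norm (hyper_grad x \<pi> - hyper_grad x (opt x)) \<le> L * ?\<delta>"
      using L(2)[of "(x, \<pi>)" "(x, opt x)"] by (simp add: joint_dist_def)
    then have "(norm (hyper_grad x \<pi> - hyper_grad x (opt x)))\<^sup>2 \<le> (L * ?\<delta>)\<^sup>2"
      by (intro power_mono) auto
    moreover have "(norm (?\<mu> - hyper_grad x \<pi>))\<^sup>2 \<le> C_bias\<^sup>2 * \<gamma> ^ T"
    proof -
      have "(norm (?\<mu> - hyper_grad x \<pi>))\<^sup>2 \<le> (C_bias * \<gamma> ^ T)\<^sup>2"
        by (intro power_mono norm_mean_term_est_diff_le MJ) auto
      also have "\<dots> = C_bias\<^sup>2 * (\<gamma> ^ T * \<gamma> ^ T)"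
        by (simp add: power2_eq_square)
      \<comment> \<open>One factor \<gamma>^T is given away; the remaining one is as small as the
        variance term.\<close>
      also have "\<dots> \<le> C_bias\<^sup>2 * (\<gamma> ^ T * 1)"
        using \<gamma>_nonneg \<gamma>_less by (intro mult_left_mono power_le_one) auto
      finally show ?thesis by simp
    qed
    moreover have "(norm (?\<mu> - hyper_grad x (opt x)))\<^sup>2
        \<le> 2 * (norm (?\<mu> - hyper_grad x \<pi>))\<^sup>2 + 2 * (norm (hyper_grad x \<pi> - hyper_grad x (opt x)))\<^sup>2"
      using norm_sum_sq_le[of "?\<mu> - hyper_grad x \<pi>" "hyper_grad x \<pi> - hyper_grad x (opt x)"] by simp
    ultimately have "mean (samples M J T \<pi>) (\<lambda>s. (norm (est M J T s x - hyper_grad x (opt x)))\<^sup>2)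
        \<le> 2 * (2 * C_est)\<^sup>2 * (1 / real M) + 4 * C_bias\<^sup>2 * \<gamma> ^ T + 4 * L\<^sup>2 * ?\<delta>\<^sup>2"
      using mean_est_sq_le[OF MJ, of T \<pi> x "hyper_grad x (opt x)"] by (simp add: power_mult_distrib)
    also have "\<dots> \<le> C * (1 / real M) + C * \<gamma> ^ T + C * ?\<delta>\<^sup>2"
      using \<gamma>_nonneg by (intro add_mono mult_right_mono) (auto simp: C_def)
    finally show "mean (samples M J T \<pi>) (\<lambda>s. (norm (est M J T s x - hyper_grad x (opt x)))\<^sup>2)
        \<le> C * (1 / real M + \<gamma> ^ T + ?\<delta>\<^sup>2)" by (simp add: algebra_simps)
  qed
qed

end


section \<open>Expectations over fresh samples\<close>

text \<open>The sample has finitely many values, so a quantity depending on it and on the past is a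
  sum over values \<open>d\<close> of an \<open>F\<close>-measurable coefficient times the indicator
  of \<open>S \<omega> = d\<close>. In the integral that indicator may be replaced by its
  conditional probability, which produces the mean under \<open>q \<omega>\<close>.\<close>

lemma (in prob_space) fresh_sample:
  fixes S :: "'a \<Rightarrow> 'd" and q :: "'a \<Rightarrow> 'd pmf"
  assumes sub: "subalgebra M F" and S: "S \<in> measurable M (count_space UNIV)"
    and N: "finite N" "\<And>\<omega>. set_pmf (q \<omega>) \<subseteq> N"
    and cond: "\<And>d. AE \<omega> in M. real_cond_exp M F (indicat_real {\<omega> \<in> space M. S \<omega> = d}) \<omega> = pmf (q \<omega>) d"
  shows AE_fresh_sample: "AE \<omega> in M. S \<omega> \<in> N"
    and integrable_fresh_sample: "\<lbrakk>\<And>d. d \<in> N \<Longrightarrow> f d \<in> borel_measurable F; \<And>d \<omega>. d \<in> N \<Longrightarrow> \<bar>f d \<omega>\<bar> \<le> B\<rbrakk> \<Longrightarrow>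
      integrable M (\<lambda>\<omega>. \<Sum>d\<in>N. f d \<omega> * indicat_real {\<omega> \<in> space M. S \<omega> = d} \<omega>)"
    and integral_fresh_sample_le: "\<lbrakk>\<And>d. d \<in> N \<Longrightarrow> f d \<in> borel_measurable F; \<And>d \<omega>. d \<in> N \<Longrightarrow> \<bar>f d \<omega>\<bar> \<le> B;
      AE \<omega> in M. mean (q \<omega>) (\<lambda>d. f d \<omega>) \<le> c\<rbrakk> \<Longrightarrow>
      (\<integral>\<omega>. (\<Sum>d\<in>N. f d \<omega> * indicat_real {\<omega> \<in> space M. S \<omega> = d} \<omega>) \<partial>M) \<le> c"
proof -
  interpret finite_measure_subalgebra M F
    by unfold_locales (rule sub)
  define A where "A d = {\<omega> \<in> space M. S \<omega> = d}" for d
  define E where "E d = real_cond_exp M F (indicat_real (A d))" for d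
  have A[measurable]: "A d \<in> events" for d
    using measurable_sets[OF S, of "{d}"] by (simp add: A_def vimage_def Int_def conj_commute)
  have cond': "AE \<omega> in M. \<forall>d\<in>N. E d \<omega> = pmf (q \<omega>) d"
    using cond N(1) by (simp add: AE_ball_countable countable_finite E_def A_def)
  have int_ind: "integrable M (indicat_real (A d))" for d
    by (rule integrable_real_indicator[OF A]) (simp add: emeasure_eq_measure)
  have intE: "integrable M (E d)" and eqE: "expectation (E d) = prob (A d)" for d
    unfolding E_def using real_cond_exp_int[OF int_ind] by (simp_all add: A)
  {
    \<comment> \<open>The conditional probabilities of the values in \<open>N\<close> add up to 1
      almost surely, so \<open>N\<close> carries the sample.\<close>
    have "prob {\<omega> \<in> space M. S \<omega> \<in> N} = prob (\<Union>d\<in>N. A d)"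
      by (rule arg_cong[where f = prob]) (auto simp: A_def)
    also have "\<dots> = (\<Sum>d\<in>N. prob (A d))"
      by (rule finite_measure_finite_Union[OF N(1)]) (auto simp: disjoint_family_on_def A_def intro: A[unfolded A_def])
    also have "\<dots> = expectation (\<lambda>\<omega>. \<Sum>d\<in>N. E d \<omega>)"
      by (simp add: intE eqE)
    also have "\<dots> = expectation (\<lambda>_. 1)"
    proof (rule integral_cong_AE)
      show "AE \<omega> in M. (\<Sum>d\<in>N. E d \<omega>) = 1"
        using cond' by eventually_elim (use N in \<open>simp add: sum_pmf_eq_1\<close>)
    qed (auto intro!: borel_measurable_sum borel_measurable_integrable[OF intE])
    finally have "prob {\<omega> \<in> space M. S \<omega> \<in> N} = 1" by (simp add: prob_space)
    then show "AE \<omega> in M. S \<omega> \<in> N"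
      by (rule AE_prob_1[THEN AE_mp]) auto
  }
  assume f: "\<And>d. d \<in> N \<Longrightarrow> f d \<in> borel_measurable F" and B: "\<And>d \<omega>. d \<in> N \<Longrightarrow> \<bar>f d \<omega>\<bar> \<le> B"
  have int: "integrable M (\<lambda>\<omega>. f d \<omega> * indicat_real (A d) \<omega>)" if "d \<in> N" for d
  proof (rule integrable_const_bound[of _ B])
    have [measurable]: "f d \<in> borel_measurable M"
      by (rule measurable_from_subalg[OF sub f[OF that]])
    show "(\<lambda>\<omega>. f d \<omega> * indicat_real (A d) \<omega>) \<in> borel_measurable M" by measurable
    show "AE \<omega> in M. norm (f d \<omega> * indicat_real (A d) \<omega>) \<le> B"
      using B[OF that] by (auto simp: abs_mult indicator_def intro: order.trans[OF abs_ge_zero])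
  qed
  then show "integrable M (\<lambda>\<omega>. \<Sum>d\<in>N. f d \<omega> * indicat_real {\<omega> \<in> space M. S \<omega> = d} \<omega>)"
    unfolding A_def[symmetric] by (rule Bochner_Integration.integrable_sum)
  assume c: "AE \<omega> in M. mean (q \<omega>) (\<lambda>d. f d \<omega>) \<le> c"
  have ind: "indicat_real (A d) \<in> borel_measurable M" for d by simp
  \<comment> \<open>The \<open>F\<close>-measurable coefficient moves past the conditional
    expectation of the indicator.\<close>
  have E: "integrable M (\<lambda>\<omega>. f d \<omega> * E d \<omega>)"
    "(\<integral>\<omega>. f d \<omega> * E d \<omega> \<partial>M) = (\<integral>\<omega>. f d \<omega> * indicat_real (A d) \<omega> \<partial>M)" if "d \<in> N" for d
    unfolding E_def by (rule real_cond_exp_intg[OF int[OF that] f[OF that] ind])+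
  have "(\<integral>\<omega>. (\<Sum>d\<in>N. f d \<omega> * indicat_real (A d) \<omega>) \<partial>M) = (\<integral>\<omega>. (\<Sum>d\<in>N. f d \<omega> * E d \<omega>) \<partial>M)"
    using E int by simp
  also have "\<dots> \<le> (\<integral>\<omega>. c \<partial>M)"
  proof (rule integral_mono_AE)
    show "AE \<omega> in M. (\<Sum>d\<in>N. f d \<omega> * E d \<omega>) \<le> c"
      using cond' c
    proof eventually_elim
      case (elim \<omega>)
      have "(\<Sum>d\<in>N. f d \<omega> * E d \<omega>) = mean (q \<omega>) (\<lambda>d. f d \<omega>)"
        using elim(1) by (simp add: mean_eq_sum[OF N] mult.commute)
      with elim(2) show ?case by simp
    qed
  qed (auto intro: E)
  finally show "(\<integral>\<omega>. (\<Sum>d\<in>N. f d \<omega> * indicat_real {\<omega> \<in> space M. S \<omega> = d} \<omega>) \<partial>M) \<le> c"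
    by (simp add: A_def prob_space)
qed


section \<open>Descent along the iterates\<close>

text \<open>Polarization of the inner product of \<open>h\<close> and \<open>g\<close> yields a
  negative multiple of the squared norm of \<open>h\<close>, which absorbs the second-order term up
  to order \<beta>^3; boundedness of \<open>h\<close> controls the rest.\<close>

lemma gradient_step_le:
  fixes f :: "'v::real_inner \<Rightarrow> real"
  assumes taylor: "\<bar>f (x - \<beta> *\<^sub>R h) - f x - inner (- \<beta> *\<^sub>R h) g\<bar> \<le> L * (norm (\<beta> *\<^sub>R h))\<^sup>2"
    and "0 \<le> \<beta>" and h: "norm h \<le> B"
  shows "\<beta> / 2 * (norm g)\<^sup>2 \<le> f x - f (x - \<beta> *\<^sub>R h) + \<beta> / 2 * (norm (h - g))\<^sup>2 + L\<^sup>2 * B\<^sup>2 / 2 * \<beta> ^ 3"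
proof -
  have "inner (- \<beta> *\<^sub>R h) g = - \<beta> / 2 * ((norm h)\<^sup>2 + (norm g)\<^sup>2 - (norm (h - g))\<^sup>2)"
    by (simp add: power2_norm_eq_inner inner_diff inner_commute algebra_simps)
  moreover have "f (x - \<beta> *\<^sub>R h) - f x \<le> inner (- \<beta> *\<^sub>R h) g + L * \<beta>\<^sup>2 * (norm h)\<^sup>2"
    using taylor by (simp add: power_mult_distrib)
  \<comment> \<open>from \<open>0 \<le> (1 - L \<beta>)\<^sup>2\<close>, which avoids comparing \<open>\<beta>\<close> with \<open>1 / L\<close>\<close>
  moreover have "L * \<beta>\<^sup>2 * (norm h)\<^sup>2 \<le> (\<beta> / 2 + L\<^sup>2 * \<beta> ^ 3 / 2) * (norm h)\<^sup>2"
  proof (rule mult_right_mono)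
    have "0 \<le> \<beta> / 2 * (1 - L * \<beta>)\<^sup>2" using assms(2) by simp
    then show "L * \<beta>\<^sup>2 \<le> \<beta> / 2 + L\<^sup>2 * \<beta> ^ 3 / 2"
      by (simp add: power2_eq_square power3_eq_cube algebra_simps)
  qed simp
  moreover have "L\<^sup>2 * \<beta> ^ 3 / 2 * (norm h)\<^sup>2 \<le> L\<^sup>2 * \<beta> ^ 3 / 2 * B\<^sup>2"
    using h assms(2) by (intro mult_left_mono power_mono) auto
  ultimately show ?thesis by (simp add: algebra_simps)
qed

text \<open>The harmonic number minus the logarithm decreases from its value 1 at
  \<open>K = 1\<close>.\<close>

lemma sum_inverse_le: "(\<Sum>k=1..K. 1 / real k) \<le> 1 + ln (real K)" if "1 \<le> K"
proof -
  have "harm K - ln (real K) \<le> 1"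
    using decseqD[OF decseq_harm_diff_ln, of 0 "K - 1"] that by (simp add: harm_Suc harm_expand)
  then show ?thesis by (simp add: harm_def inverse_eq_divide)
qed

locale step_sizes =
  fixes n :: nat and \<beta> \<mu> :: "nat \<Rightarrow> real"
  assumes n_pos: "1 \<le> n"
    and \<beta>: "\<And>k. 1 \<le> k \<Longrightarrow> \<beta> k = 1 / (real n + real k) powr (1/3)"
    and \<mu>1: "0 \<le> \<mu> 1" "\<mu> 1 \<le> 1"
    and \<mu>: "\<And>k. 1 \<le> k \<Longrightarrow> \<mu> (k + 1) = max (15/16) (1 - (\<beta> k)\<^sup>2)"
begin

lemma \<beta>_pos: "1 \<le> k \<Longrightarrow> 0 < \<beta> k"
  by (simp add: \<beta>)

lemma \<beta>_le_1: "1 \<le> k \<Longrightarrow> \<beta> k \<le> 1"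
  by (simp add: \<beta> ge_one_powr_ge_zero)

lemma \<beta>_cube: "1 \<le> k \<Longrightarrow> \<beta> k ^ 3 = 1 / (real n + real k)"
  by (simp add: \<beta> power_divide powr_powr flip: powr_realpow)

lemma \<beta>_cube_le: "1 \<le> k \<Longrightarrow> \<beta> k ^ 3 \<le> 1 / real k"
  by (simp add: \<beta>_cube frac_le)

lemma \<beta>_antimono: "1 \<le> j \<Longrightarrow> j \<le> k \<Longrightarrow> \<beta> k \<le> \<beta> j"
  by (simp add: \<beta> frac_le powr_mono2)

text \<open>The index 1 is separate because \<open>\<mu> 1\<close> is arbitrary in [0, 1]. From 2
  on, the maximum in the rule gives the two bounds 1/16 and the square of the previous step
  size.\<close>

lemma one_minus_\<mu>:
  assumes "1 \<le> k"
  shows "0 \<le> 1 - \<mu> k" "1 - \<mu> k \<le> 1" "2 \<le> k \<Longrightarrow> 1 - \<mu> k \<le> 1/16" "\<beta> k * (1 - \<mu> k)\<^sup>2 \<le> 1 / real k"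
proof -
  have "0 \<le> 1 - \<mu> k \<and> 1 - \<mu> k \<le> 1 \<and> (2 \<le> k \<longrightarrow> 1 - \<mu> k \<le> 1/16) \<and> \<beta> k * (1 - \<mu> k)\<^sup>2 \<le> 1 / real k"
  proof (cases "k = 1")
    case True
    have "\<beta> 1 * (1 - \<mu> 1)\<^sup>2 \<le> 1 * 1\<^sup>2"
      using \<mu>1 \<beta>_le_1[of 1] \<beta>_pos[of 1] by (intro mult_mono power_mono) auto
    with True \<mu>1 show ?thesis by simp
  next
    case False
    then obtain j where j: "k = j + 1" "1 \<le> j"
      using assms that[of "k - 1"] by simp
    have le: "0 \<le> 1 - \<mu> k" "1 - \<mu> k \<le> 1/16" "1 - \<mu> k \<le> (\<beta> j)\<^sup>2"
      unfolding j(1) \<mu>[OF j(2)]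
      using max.cobounded1[of "15/16" "1 - (\<beta> j)\<^sup>2"] max.cobounded2[of "1 - (\<beta> j)\<^sup>2" "15/16"]
      by (simp, linarith, linarith)
    have "\<beta> k * (1 - \<mu> k)\<^sup>2 \<le> 1 * ((\<beta> j)\<^sup>2)\<^sup>2"
      using \<beta>_le_1[of k] le assms by (intro mult_mono power_mono) auto
    also have "\<dots> = \<beta> j * \<beta> j ^ 3"
      by (simp add: power2_eq_square power3_eq_cube)
    also have "\<dots> \<le> 1 * \<beta> j ^ 3"
      using \<beta>_le_1[OF j(2)] \<beta>_pos[OF j(2)] by (intro mult_right_mono) auto
    \<comment> \<open>The cube belongs to the previous step size; the shift \<open>n \<ge> 1\<close>
      makes up for the lost index.\<close>
    also have "\<dots> \<le> 1 / real k"
      using n_pos j by (simp add: \<beta>_cube frac_le)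
    finally show ?thesis using le by simp
  qed
  then show "0 \<le> 1 - \<mu> k" "1 - \<mu> k \<le> 1" "2 \<le> k \<Longrightarrow> 1 - \<mu> k \<le> 1/16" "\<beta> k * (1 - \<mu> k)\<^sup>2 \<le> 1 / real k"
    by auto
qed

text \<open>Since \<open>1 - \<mu>\<^sub>k \<le> \<beta>\<^sub>k\<^sub>-\<^sub>1\<^sup>2\<close>, the momentum term contributes only a harmonic series, however
  crudely it is bounded.\<close>

lemma momentum_descent:
  fixes f :: "'v::real_inner \<Rightarrow> real" and x h g g' :: "nat \<Rightarrow> 'v"
  assumes taylor: "\<And>y z. \<bar>f z - f y - inner (z - y) (G y)\<bar> \<le> L * (norm (z - y))\<^sup>2"
    and f: "\<And>y. \<bar>f y\<bar> \<le> C"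
    and g: "\<And>k. k \<in> {1..K} \<Longrightarrow> norm (g k) \<le> B" "\<And>k. k \<in> {1..K} \<Longrightarrow> norm (g' k) \<le> B"
    and h: "\<And>k. k \<in> {1..K} \<Longrightarrow> h k = g k + (1 - \<mu> k) *\<^sub>R (h (k - 1) - g' k)"
    and x: "\<And>k. k \<in> {1..K} \<Longrightarrow> x (k + 1) = x k - \<beta> k *\<^sub>R h k"
    and B: "0 \<le> B"
  defines "B' \<equiv> 2 * B + norm (h 0)"
  shows "(\<Sum>k=1..K. \<beta> k / 2 * (norm (G (x k)))\<^sup>2) \<le> 2 * C +
    (\<Sum>k=1..K. \<beta> k * (norm (g k - G (x k)))\<^sup>2 + ((B' + B)\<^sup>2 + L\<^sup>2 * B'\<^sup>2 / 2) * (1 / real k))"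
proof -
  \<comment> \<open>\<open>B'\<close> is what the first iteration can produce when its correction is
    not damped at all. Afterwards the factor 1/16 keeps the ball invariant: B + (B' + B) / 16 \<le>
    B' because B' \<ge> 2 B.\<close>
  have h_le: "norm (h k) \<le> B'" if "k \<le> K" for k
    using that
  proof (induction k)
    case 0
    then show ?case using B by (simp add: B'_def)
  next
    case (Suc k)
    then have k: "Suc k \<in> {1..K}" by simp
    have "norm (h (Suc k)) \<le> norm (g (Suc k)) + (1 - \<mu> (Suc k)) * norm (h k - g' (Suc k))"
      using norm_triangle_ineq[of "g (Suc k)" "(1 - \<mu> (Suc k)) *\<^sub>R (h k - g' (Suc k))"]
        one_minus_\<mu>(1)[of "Suc k"] by (simp add: h[OF k])
    also have "\<dots> \<le> B + (1 - \<mu> (Suc k)) * (norm (h k) + B)"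
      using g[OF k] one_minus_\<mu>(1)[of "Suc k"] norm_triangle_ineq4[of "h k" "g' (Suc k)"]
      by (intro add_mono mult_left_mono) auto
    also have "\<dots> \<le> B'"
    proof (cases "k = 0")
      case True
      have "(1 - \<mu> (Suc k)) * (norm (h k) + B) \<le> 1 * (norm (h k) + B)"
        using one_minus_\<mu>(2)[of "Suc k"] B by (intro mult_right_mono) auto
      with True show ?thesis by (simp add: B'_def)
    next
      case False
      have "(1 - \<mu> (Suc k)) * (norm (h k) + B) \<le> 1/16 * (B' + B)"
        using one_minus_\<mu>(3)[of "Suc k"] False Suc B by (intro mult_mono) auto
      moreover have "B + 1/16 * (B' + B) \<le> B'"
        using B norm_ge_zero[of "h 0"] unfolding B'_def by argo
      ultimately show ?thesis by argo
    qed
    finally show ?case .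
  qed
  have step: "\<beta> k / 2 * (norm (G (x k)))\<^sup>2 \<le> f (x k) - f (x (k + 1)) +
      (\<beta> k * (norm (g k - G (x k)))\<^sup>2 + ((B' + B)\<^sup>2 + L\<^sup>2 * B'\<^sup>2 / 2) * (1 / real k))" if k: "k \<in> {1..K}" for k
  proof -
    let ?e = "g k - G (x k)" and ?m = "(1 - \<mu> k) *\<^sub>R (h (k - 1) - g' k)"
    from k have k1: "1 \<le> k" by simp
    note \<beta>k = \<beta>_pos[OF k1]
    have "\<beta> k / 2 * (norm (G (x k)))\<^sup>2 \<le> f (x k) - f (x k - \<beta> k *\<^sub>R h k)
        + \<beta> k / 2 * (norm (h k - G (x k)))\<^sup>2 + L\<^sup>2 * B'\<^sup>2 / 2 * \<beta> k ^ 3"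
      using taylor[of "x k - \<beta> k *\<^sub>R h k" "x k"] \<beta>k h_le[of k] k by (intro gradient_step_le) auto
    moreover have "L\<^sup>2 * B'\<^sup>2 / 2 * \<beta> k ^ 3 \<le> L\<^sup>2 * B'\<^sup>2 / 2 * (1 / real k)"
      by (intro mult_left_mono \<beta>_cube_le[OF k1]) simp
    moreover have "\<beta> k / 2 * (norm (h k - G (x k)))\<^sup>2 \<le> \<beta> k * (norm ?e)\<^sup>2 + (B' + B)\<^sup>2 * (1 / real k)"
    proof -
      \<comment> \<open>The error of the fresh estimate, small in conditional mean square, plus the
        damped correction, bounded pathwise.\<close>
      have eq: "h k - G (x k) = ?e + ?m" by (simp add: h[OF k])
      have "(norm (h k - G (x k)))\<^sup>2 \<le> 2 * (norm ?e)\<^sup>2 + 2 * (norm ?m)\<^sup>2"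
        unfolding eq by (rule norm_sum_sq_le)
      from mult_left_mono[OF this, of "\<beta> k / 2"]
      have "\<beta> k / 2 * (norm (h k - G (x k)))\<^sup>2 \<le> \<beta> k * (norm ?e)\<^sup>2 + \<beta> k * (norm ?m)\<^sup>2"
        using \<beta>k by (simp add: distrib_left)
      moreover have "\<beta> k * (norm ?m)\<^sup>2 \<le> (B' + B)\<^sup>2 * (1 / real k)"
      proof -
        have "k - 1 \<le> K" using k by auto
        then have "norm (h (k - 1) - g' k) \<le> B' + B"
          using norm_triangle_ineq4[of "h (k - 1)" "g' k"] h_le[of "k - 1"] g(2)[OF k] by linarith
        then have "(norm (h (k - 1) - g' k))\<^sup>2 \<le> (B' + B)\<^sup>2"
          by (intro power_mono) auto
        from mult_mono[OF one_minus_\<mu>(4)[OF k1] this]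
        have "\<beta> k * (1 - \<mu> k)\<^sup>2 * (norm (h (k - 1) - g' k))\<^sup>2 \<le> 1 / real k * (B' + B)\<^sup>2" by simp
        then show ?thesis by (simp add: power_mult_distrib mult.assoc)
      qed
      ultimately show ?thesis by linarith
    qed
    ultimately show ?thesis
      unfolding x[OF k] distrib_right by linarith
  qed
  have "(\<Sum>k=1..K. f (x k) - f (x (k + 1))) = f (x 1) - f (x (K + 1))" for K
    by (induction K) simp_all
  then have "(\<Sum>k=1..K. f (x k) - f (x (k + 1))) = f (x 1) - f (x (K + 1))" .
  also have "\<dots> \<le> 2 * C"
    using f[of "x 1"] f[of "x (K + 1)"] by linarith
  finally have tele: "(\<Sum>k=1..K. f (x k) - f (x (k + 1))) \<le> 2 * C" .
  have "(\<Sum>k=1..K. \<beta> k / 2 * (norm (G (x k)))\<^sup>2) \<le> (\<Sum>k=1..K. f (x k) - f (x (k + 1)) +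
      (\<beta> k * (norm (g k - G (x k)))\<^sup>2 + ((B' + B)\<^sup>2 + L\<^sup>2 * B'\<^sup>2 / 2) * (1 / real k)))"
    by (intro sum_mono step)
  also have "\<dots> = (\<Sum>k=1..K. f (x k) - f (x (k + 1))) +
      (\<Sum>k=1..K. \<beta> k * (norm (g k - G (x k)))\<^sup>2 + ((B' + B)\<^sup>2 + L\<^sup>2 * B'\<^sup>2 / 2) * (1 / real k))"
    by (rule sum.distrib)
  finally show ?thesis using tele by linarith
qed

end


section \<open>The convergence rate\<close>

context bilevel
begin

text \<open>The descent inequality holds along almost every path; only the squared errors of the
  fresh estimates need probability, and the conditional law of the samples bounds their
  expectations.\<close>

lemma run_gradient_sum_le:
  fixes W :: "'w measure"
  assumes mse: "\<And>M J T \<pi> x. 1 \<le> M \<Longrightarrow> 1 \<le> J \<Longrightarrow>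
      mean (samples M J T \<pi>) (\<lambda>s. (norm (est M J T s x - hyper_grad x (opt x)))\<^sup>2)
      \<le> C * (1 / real M + \<gamma> ^ T + (norm (policy_vec \<pi> - policy_vec (opt x)))\<^sup>2)"
    and "0 \<le> C"
    and taylor: "\<And>y z. \<bar>obj z - obj y - inner (z - y) (hyper_grad y (opt y))\<bar> \<le> L * (norm (z - y))\<^sup>2"
    and \<rho>: "\<And>s. 0 < pmf \<rho> s"
    and steps: "step_sizes n \<beta> \<mu>" and \<epsilon>: "\<And>k. 1 \<le> k \<Longrightarrow> \<epsilon> k = (\<beta> k)\<^sup>2"
    and KMJ: "1 \<le> K" "K \<le> M" "1 \<le> J" and T: "\<gamma> ^ T \<le> 1 / real K"
    and run: "stoc_sobirl_run \<rho> P \<gamma> \<tau> r \<rho>' P' I H l K M J T \<beta> \<mu> \<epsilon> x\<^sub>1 h\<^sub>0 W F \<pi> smp x h"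
  defines "B \<equiv> 2 * C_est + norm h\<^sub>0"
  shows "(\<Sum>k=1..K. \<beta> k / 2 * (\<integral>\<omega>. (norm (hyper_grad (x k \<omega>) (opt (x k \<omega>))))\<^sup>2 \<partial>W))
    \<le> 2 * C_l + (3 * C + ((B + C_est)\<^sup>2 + L\<^sup>2 * B\<^sup>2 / 2)) * (1 + ln (real K))"
proof -
  interpret step_sizes n \<beta> \<mu> by (rule steps)
  note run = run[unfolded stoc_sobirl_run_def]
  interpret W: prob_space W using run by blast
  define G where "G y = hyper_grad y (opt y)" for y
  define N where "N = (sample_set I H M J T :: ('s, 'a) sample set)"
  \<comment> \<open>The squared error that iteration \<open>k\<close> would make with sample value
    \<open>d\<close>: known before the draw, as it depends on \<open>x k\<close> only.\<close>
  define f where "f k d \<omega> = (norm (est M J T d (x k \<omega>) - G (x k \<omega>)))\<^sup>2" for k d \<omega>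
  \<comment> \<open>The actual squared error, written as a sum over sample values so that the
    conditional law applies.\<close>
  define Z where "Z k \<omega> = (\<Sum>d\<in>N. f k d \<omega> * indicat_real {\<omega> \<in> space W. smp k \<omega> = d} \<omega>)" for k \<omega>
  define c where "c = (B + C_est)\<^sup>2 + L\<^sup>2 * B\<^sup>2 / 2"
  have M: "1 \<le> M" using KMJ by simp
  obtain B\<^sub>G where B\<^sub>G: "0 \<le> B\<^sub>G" "\<And>y. norm (G y) \<le> B\<^sub>G"
    using bdd_lip_hyper_grad_opt unfolding G_def by (rule bdd_lipE) blast
  have contG: "continuous_on UNIV G"
    unfolding G_def by (rule bdd_lip_continuous_on[OF bdd_lip_hyper_grad_opt])
  have est_le: "norm (est M J T d y) \<le> C_est" if "d \<in> N" for d y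
    using norm_est_le[OF that[unfolded N_def] M] .
  have finN: "finite N" and setN: "set_pmf (samples M J T \<pi>) \<subseteq> N" for \<pi>
    unfolding N_def by (rule finite_sample_set, rule set_sample_pmf)
  have sub: "subalgebra W (F k)" and x_meas: "x k \<in> borel_measurable (F k)"
    and smp_meas: "smp k \<in> measurable W (count_space UNIV)" if "k \<in> {1..K}" for k
    using run that by blast+
  have x_meas_W[measurable]: "x k \<in> borel_measurable W" if "k \<in> {1..K}" for k
    by (rule measurable_from_subalg[OF sub[OF that] x_meas[OF that]])
  have cond: "AE \<omega> in W. real_cond_exp W (F k) (indicat_real {\<omega> \<in> space W. smp k \<omega> = d}) \<omega> =
      pmf (samples M J T (\<pi> k \<omega>)) d" if "k \<in> {1..K}" for k d
    using run that by blast
  note fresh = W.AE_fresh_sample[OF sub smp_meas finN setN cond]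
    W.integrable_fresh_sample[OF sub smp_meas finN setN cond]
    W.integral_fresh_sample_le[OF sub smp_meas finN setN cond]
  have f_meas: "f k d \<in> borel_measurable (F k)" if "k \<in> {1..K}" "d \<in> N" for k d
  proof -
    have "continuous_on UNIV (\<lambda>y. (norm (est M J T d y - G y))\<^sup>2)"
      using continuous_est that(2) unfolding N_def by (intro continuous_intros contG)
    from measurable_compose[OF x_meas[OF that(1)] borel_measurable_continuous_onI[OF this]]
    show ?thesis by (simp add: f_def[abs_def])
  qed
  have f_le: "\<bar>f k d \<omega>\<bar> \<le> (C_est + B\<^sub>G)\<^sup>2" if "d \<in> N" for k d \<omega>
  proof -
    have "norm (est M J T d (x k \<omega>) - G (x k \<omega>)) \<le> C_est + B\<^sub>G"
      using norm_triangle_ineq4 est_le[OF that] B\<^sub>G(2) by (rule order.trans[OF _ add_mono])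
    then show ?thesis by (simp add: f_def power_mono)
  qed
  have Z_int: "integrable W (Z k)" if "k \<in> {1..K}" for k
    unfolding Z_def by (rule fresh(2)[OF that that that f_meas[OF that] f_le])
  have Z_le: "(\<integral>\<omega>. Z k \<omega> \<partial>W) \<le> C * (1 / real M + \<gamma> ^ T + \<epsilon> k)" if "k \<in> {1..K}" for k
    unfolding Z_def
  proof (rule fresh(3)[OF that that that f_meas[OF that] f_le])
    have "AE \<omega> in W. (norm (policy_vec (\<pi> k \<omega>) - policy_vec (opt_policy \<rho> P \<gamma> \<tau> r (x k \<omega>))))\<^sup>2 \<le> \<epsilon> k"
      using run that by blast
    then show "AE \<omega> in W. mean (samples M J T (\<pi> k \<omega>)) (\<lambda>d. f k d \<omega>) \<le> C * (1 / real M + \<gamma> ^ T + \<epsilon> k)"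
    proof eventually_elim
      case (elim \<omega>)
      have "mean (samples M J T (\<pi> k \<omega>)) (\<lambda>d. f k d \<omega>) \<le> C * (1 / real M + \<gamma> ^ T
          + (norm (policy_vec (\<pi> k \<omega>) - policy_vec (opt (x k \<omega>))))\<^sup>2)"
        unfolding f_def G_def by (rule mse[OF M KMJ(3)])
      also have "\<dots> \<le> C * (1 / real M + \<gamma> ^ T + \<epsilon> k)"
        using elim \<open>0 \<le> C\<close> unfolding opt_policy_eq_soft_policy[OF \<rho>] by (intro mult_left_mono) auto
      finally show ?case .
    qed
  qed
  \<comment> \<open>Each of the three errors contributes at most 1/k: \<open>M \<ge> K\<close> and
    \<gamma>^T \<le> 1/K give 1/K for the first two, and \<open>\<beta> k * \<epsilon> k\<close> is
    the cube of the step size.\<close>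
  have \<beta>Z_le: "\<beta> k * (\<integral>\<omega>. Z k \<omega> \<partial>W) \<le> 3 * C * (1 / real k)" if k: "k \<in> {1..K}" for k
  proof -
    have k1: "1 \<le> k" using k by simp
    have le: "1 / real K \<le> 1 / real k" "1 / real M \<le> 1 / real K" "0 \<le> 1 / real M"
      using k KMJ by (auto intro!: divide_left_mono)
    have "\<beta> k * (\<integral>\<omega>. Z k \<omega> \<partial>W) \<le> \<beta> k * (C * (1 / real M + \<gamma> ^ T + \<epsilon> k))"
      using \<beta>_pos[OF k1] by (intro mult_left_mono Z_le k) simp
    also have "\<dots> = C * (\<beta> k * (1 / real M + \<gamma> ^ T) + \<beta> k ^ 3)"
      by (simp add: \<epsilon>[OF k1] power2_eq_square power3_eq_cube algebra_simps)
    also have "\<dots> \<le> C * (1 * (1 / real M + \<gamma> ^ T) + 1 / real k)"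
      using \<beta>_le_1[OF k1] le(3) \<gamma>_nonneg \<open>0 \<le> C\<close>
      by (intro mult_left_mono add_mono mult_right_mono \<beta>_cube_le k1) auto
    also have "\<dots> \<le> C * (3 * (1 / real k))"
    proof (rule mult_left_mono[OF _ \<open>0 \<le> C\<close>])
      have "1 * (c + d) + b \<le> 3 * b" if "a \<le> b" "c \<le> a" "d \<le> a" for a b c d :: real
        using that by simp
      from this[OF le(1,2) T] show "1 * (1 / real M + \<gamma> ^ T) + 1 / real k \<le> 3 * (1 / real k)" .
    qed
    finally show ?thesis by (simp add: mult.commute)
  qed
  have G_int: "integrable W (\<lambda>\<omega>. (norm (G (x k \<omega>)))\<^sup>2)" if "k \<in> {1..K}" for k
  proof (rule W.integrable_const_bound[of _ "B\<^sub>G\<^sup>2"])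
    have "continuous_on UNIV (\<lambda>y. (norm (G y))\<^sup>2)" by (intro continuous_intros contG)
    from measurable_compose[OF x_meas_W[OF that] borel_measurable_continuous_onI[OF this]]
    show "(\<lambda>\<omega>. (norm (G (x k \<omega>)))\<^sup>2) \<in> borel_measurable W" .
  qed (auto intro!: power_mono B\<^sub>G(2))
  have smp_N: "AE \<omega> in W. \<forall>k\<in>{1..K}. smp k \<omega> \<in> N"
    using fresh(1) by (subst AE_ball_countable) auto
  have pointwise: "AE \<omega> in W. (\<Sum>k=1..K. \<beta> k / 2 * (norm (G (x k \<omega>)))\<^sup>2) \<le>
      2 * C_l + (\<Sum>k=1..K. \<beta> k * Z k \<omega> + c * (1 / real k))"
    using smp_N AE_space
  proof eventually_elim
    case (elim \<omega>)
    \<comment> \<open>Here \<open>g'\<close> is the estimate at the previous point on the current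
      samples; it only has to be bounded.\<close>
    have "(\<Sum>k=1..K. \<beta> k / 2 * (norm (G (x k \<omega>)))\<^sup>2) \<le> 2 * C_l +
      (\<Sum>k=1..K. \<beta> k * (norm (est M J T (smp k \<omega>) (x k \<omega>) - G (x k \<omega>)))\<^sup>2
        + ((2 * C_est + norm (h 0 \<omega>) + C_est)\<^sup>2 + L\<^sup>2 * (2 * C_est + norm (h 0 \<omega>))\<^sup>2 / 2) * (1 / real k))"
    proof (rule momentum_descent[where f = obj and G = G and h = "\<lambda>k. h k \<omega>" and x = "\<lambda>k. x k \<omega>"
          and g = "\<lambda>k. est M J T (smp k \<omega>) (x k \<omega>)"
          and g' = "\<lambda>k. est M J T (smp k \<omega>) (x (k - 1) \<omega>)"])
      show "\<bar>obj z - obj y - inner (z - y) (G y)\<bar> \<le> L * (norm (z - y))\<^sup>2" for y z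
        unfolding G_def by (rule taylor)
      have "smp 1 \<omega> \<in> N" using elim(1) KMJ(1) by simp
      from order.trans[OF norm_ge_zero est_le[OF this]] show "0 \<le> C_est" .
      show "\<bar>obj y\<bar> \<le> C_l" for y by (rule abs_obj_le)
      fix k assume k: "k \<in> {1..K}"
      with elim(1) show "norm (est M J T (smp k \<omega>) (x k \<omega>)) \<le> C_est"
        "norm (est M J T (smp k \<omega>) (x (k - 1) \<omega>)) \<le> C_est"
        by (blast intro: est_le)+
      show "h k \<omega> = est M J T (smp k \<omega>) (x k \<omega>) +
          (1 - \<mu> k) *\<^sub>R (h (k - 1) \<omega> - est M J T (smp k \<omega>) (x (k - 1) \<omega>))"
        "x (k + 1) \<omega> = x k \<omega> - \<beta> k *\<^sub>R h k \<omega>"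
        using run k elim(2) by blast+
    qed
    moreover have "Z k \<omega> = (norm (est M J T (smp k \<omega>) (x k \<omega>) - G (x k \<omega>)))\<^sup>2" if "k \<in> {1..K}" for k
    proof -
      have "Z k \<omega> = (\<Sum>d\<in>N. if d = smp k \<omega> then f k d \<omega> else 0)"
        unfolding Z_def by (intro sum.cong refl) (use elim(2) in \<open>auto simp: indicator_def\<close>)
      also have "\<dots> = f k (smp k \<omega>) \<omega>"
        using finN elim(1) that by simp
      finally show ?thesis by (simp add: f_def)
    qed
    moreover have "h 0 \<omega> = h\<^sub>0" using run elim(2) by blast
    ultimately show ?case by (simp add: c_def B_def)
  qed
  have "(\<Sum>k=1..K. \<beta> k / 2 * (\<integral>\<omega>. (norm (G (x k \<omega>)))\<^sup>2 \<partial>W)) =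
      (\<integral>\<omega>. (\<Sum>k=1..K. \<beta> k / 2 * (norm (G (x k \<omega>)))\<^sup>2) \<partial>W)"
    by (simp add: Bochner_Integration.integral_sum G_int)
  also have "\<dots> \<le> (\<integral>\<omega>. 2 * C_l + (\<Sum>k=1..K. \<beta> k * Z k \<omega> + c * (1 / real k)) \<partial>W)"
    using pointwise by (intro integral_mono_AE) (auto intro!: Bochner_Integration.integrable_sum
        Bochner_Integration.integrable_add integrable_mult_right G_int Z_int)
  also have "\<dots> = 2 * C_l + (\<Sum>k=1..K. \<beta> k * (\<integral>\<omega>. Z k \<omega> \<partial>W) + c * (1 / real k))"
  proof -
    have int: "integrable W (\<lambda>\<omega>. \<beta> k * Z k \<omega> + c * (1 / real k))" if "k \<in> {1..K}" for k
      by (intro Bochner_Integration.integrable_add integrable_mult_right Z_int[OF that]) simp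
    have "integrable W (\<lambda>\<omega>. \<Sum>k=1..K. \<beta> k * Z k \<omega> + c * (1 / real k))"
      by (rule Bochner_Integration.integrable_sum[OF int])
    from Bochner_Integration.integral_add[OF W.integrable_const this, of "2 * C_l"]
    have "(\<integral>\<omega>. 2 * C_l + (\<Sum>k=1..K. \<beta> k * Z k \<omega> + c * (1 / real k)) \<partial>W) =
        2 * C_l + (\<integral>\<omega>. (\<Sum>k=1..K. \<beta> k * Z k \<omega> + c * (1 / real k)) \<partial>W)"
      by (simp add: W.prob_space)
    also have "(\<integral>\<omega>. (\<Sum>k=1..K. \<beta> k * Z k \<omega> + c * (1 / real k)) \<partial>W) =
        (\<Sum>k=1..K. \<integral>\<omega>. \<beta> k * Z k \<omega> + c * (1 / real k) \<partial>W)"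
      by (rule Bochner_Integration.integral_sum[OF int])
    also have "(\<Sum>k=1..K. \<integral>\<omega>. \<beta> k * Z k \<omega> + c * (1 / real k) \<partial>W) =
        (\<Sum>k=1..K. \<beta> k * (\<integral>\<omega>. Z k \<omega> \<partial>W) + c * (1 / real k))"
      by (intro sum.cong refl) (simp add: Z_int W.prob_space)
    finally show ?thesis .
  qed
  also have "\<dots> \<le> 2 * C_l + (\<Sum>k=1..K. (3 * C + c) * (1 / real k))"
    using \<beta>Z_le by (intro add_left_mono sum_mono) (simp add: distrib_right del: times_divide_eq_right)
  also have "\<dots> = 2 * C_l + (3 * C + c) * (\<Sum>k=1..K. 1 / real k)"
    by (simp add: sum_distrib_left)
  also have "\<dots> \<le> 2 * C_l + (3 * C + c) * (1 + ln (real K))"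
    using \<open>0 \<le> C\<close> by (intro add_left_mono mult_left_mono sum_inverse_le KMJ) (simp add: c_def)
  finally show ?thesis by (simp add: G_def c_def)
qed

end

text \<open>The ceiling solves \<gamma>^T \<le> 1/K for T. The summand 1 keeps the length positive
  when the logarithm vanishes, and with the rounding it explains the 2 in the constant.\<close>

lemma rollout_length:
  assumes "0 < \<gamma>" "\<gamma> < 1"
  defines "T \<equiv> \<lambda>K. nat \<lceil>ln (real K) / ln (1 / \<gamma>)\<rceil> + 1"
  shows "1 \<le> K \<Longrightarrow> \<gamma> ^ T K \<le> 1 / real K"
    and "(\<lambda>K. real (T K)) \<in> O(\<lambda>K. ln (real K))"
proof -
  have pos: "0 < ln (1 / \<gamma>)" using assms(1,2) by simp
  have le: "ln (real K) / ln (1 / \<gamma>) \<le> real (T K)" for K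
    unfolding T_def by linarith
  show "\<gamma> ^ T K \<le> 1 / real K" if "1 \<le> K"
  proof -
    have "ln (real K) \<le> real (T K) * ln (1 / \<gamma>)"
      using le[of K] pos by (simp add: divide_le_eq)
    then have "ln (\<gamma> ^ T K) \<le> ln (1 / real K)"
      using assms(1,2) that by (simp add: ln_realpow ln_div)
    then show ?thesis using assms(1) that by simp
  qed
  show "(\<lambda>K. real (T K)) \<in> O(\<lambda>K. ln (real K))"
  proof (rule bigoI[where c = "1 / ln (1 / \<gamma>) + 2"])
    have "eventually (\<lambda>K::nat. 1 \<le> ln (real K)) sequentially" by real_asymp
    then show "eventually (\<lambda>K. norm (real (T K)) \<le> (1 / ln (1 / \<gamma>) + 2) * norm (ln (real K))) sequentially"
    proof eventually_elim
      case (elim K)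
      have "0 \<le> ln (real K) / ln (1 / \<gamma>)" using elim pos by simp
      then have "real (T K) \<le> ln (real K) / ln (1 / \<gamma>) + 2"
        unfolding T_def by linarith
      also have "\<dots> \<le> ln (real K) / ln (1 / \<gamma>) + 2 * ln (real K)" using elim by simp
      finally show ?case using elim by (simp add: distrib_right)
    qed
  qed
qed

theorem theorem7p7:
  fixes P P' :: "('s::finite, 'a::finite) kernel"
    and \<rho> \<rho>' :: "'s pmf"
    and r :: "'s \<Rightarrow> 'a \<Rightarrow> real^'n \<Rightarrow> real"
    and l :: "('s, 'a) traj list \<Rightarrow> real^'n \<Rightarrow> real"
    and \<gamma> \<tau> C_r C_rx L_r C_l L_l L_l1 L_\<pi> L_V1 L_\<phi> L_S :: real
    and I H :: nat
  assumes "0 < \<gamma>" "\<gamma> < 1" "0 < \<tau>"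
    and "\<And>s. pmf \<rho> s > 0"
    and "I \<ge> 1" "H \<ge> 1"
    and "\<And>s a. cont_diff (r s a)"
    and "\<And>s a x. \<bar>r s a x\<bar> \<le> C_r"
    and "\<And>s a x. norm (grad (r s a) x) \<le> C_rx"
    and "\<And>s a x y. norm (grad (r s a) x - grad (r s a) y) \<le> L_r * norm (x - y)"
    and "\<And>d x. d \<in> traj_tuples I H \<Longrightarrow> \<bar>l d x\<bar> \<le> C_l"
    and "\<And>d. d \<in> traj_tuples I H \<Longrightarrow> cont_diff (l d)"
    and "\<And>d x y. d \<in> traj_tuples I H \<Longrightarrow> \<bar>l d x - l d y\<bar> \<le> L_l * norm (x - y)"
    and "\<And>d x y. d \<in> traj_tuples I H \<Longrightarrow> norm (grad (l d) x - grad (l d) y) \<le> L_l1 * norm (x - y)"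
    and "L_\<pi> = 2 * sqrt (real CARD('s) * real CARD('a)) * C_rx / (\<tau> * (1 - \<gamma>))"
    and "L_V1 = (1 + \<gamma>) * C_rx * L_\<pi> * sqrt (real CARD('a)) / (1 - \<gamma>)\<^sup>2 + L_r / (1 - \<gamma>)"
    and "L_\<phi> = L_l1 + L_l * real H * real I * L_\<pi> * sqrt (real CARD('a))
           + 2 / \<tau> * real H * real I * (C_l * L_V1 + C_rx / (1 - \<gamma>) * L_l)
           + 2 * (real H)\<^sup>2 * (real I)\<^sup>2 * C_l * C_rx * L_\<pi> / (\<tau> * (1 - \<gamma>)) * sqrt (real CARD('a))"
    and "L_S = L_l1 + 2 * real H * real I / (\<tau> * (1 - \<gamma>)) * (C_l * L_r + C_rx * L_l)"
  shows "\<exists>M J T :: nat \<Rightarrow> nat.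
     (\<forall>K. M K \<ge> 1 \<and> J K \<ge> 1 \<and> T K \<ge> 1) \<and>
     (\<lambda>K. real (M K)) \<in> O(\<lambda>K. real K powr (4/3)) \<and>
     (\<lambda>K. real (J K)) \<in> O(\<lambda>K. 1) \<and>
     (\<lambda>K. real (T K)) \<in> O(\<lambda>K. ln (real K)) \<and>
     (\<forall>(n\<^sub>\<beta>::nat) \<beta> \<mu> \<epsilon> x\<^sub>1 h\<^sub>0 (W :: nat \<Rightarrow> 'w measure) F \<pi> smp x h.
        n\<^sub>\<beta> \<ge> 3 \<longrightarrow>
        L_\<phi> / (real n\<^sub>\<beta> + 1) powr (1/3) + 2 * (L_S + L_\<phi>) / (real n\<^sub>\<beta> + 1) powr (2/3) \<le> 1 \<longrightarrow>
        (\<forall>k\<ge>1. \<beta> k = 1 / (real n\<^sub>\<beta> + real k) powr (1/3)) \<longrightarrow>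
        0 \<le> \<mu> 1 \<longrightarrow> \<mu> 1 \<le> 1 \<longrightarrow>
        (\<forall>k\<ge>1. \<mu> (k + 1) = max (15/16) (1 - (\<beta> k)\<^sup>2)) \<longrightarrow>
        (\<forall>k\<ge>1. \<epsilon> k = (\<beta> k)\<^sup>2) \<longrightarrow>
        (\<forall>K\<ge>1. stoc_sobirl_run \<rho> P \<gamma> \<tau> r \<rho>' P' I H l K (M K) (J K) (T K) \<beta> \<mu> \<epsilon> x\<^sub>1 h\<^sub>0
                  (W K) (F K) (\<pi> K) (smp K) (x K) (h K)) \<longrightarrow>
        (let avg = (\<lambda>K. 1 / real K * (\<Sum>k=1..K.
                     \<integral>\<omega>. (norm (grad (hyper_obj \<rho> P \<gamma> \<tau> r \<rho>' P' I H l) (x K k \<omega>)))\<^sup>2 \<partial>W K))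
         in avg \<in> O(\<lambda>K. ln (real K) / real K powr (2/3)) \<and>
            avg \<in> soft_bigo (\<lambda>K. real K powr (-2/3))))"
proof -
  interpret bilevel P \<gamma> \<tau> r C_rx L_r \<rho>' P' I H l C_l L_l L_l1
    by unfold_locales (fact assms)+
  have grad_obj: "grad (hyper_obj \<rho> P \<gamma> \<tau> r \<rho>' P' I H l) y = hyper_grad y (opt y)" for y
    unfolding hyper_obj_eq_obj[OF assms(4)] by (rule grad_eqI[OF gderiv_obj])
  obtain C where C: "0 \<le> C" "\<And>M J T \<pi> x. 1 \<le> M \<Longrightarrow> 1 \<le> J \<Longrightarrow>
      mean (samples M J T \<pi>) (\<lambda>s. (norm (est M J T s x - hyper_grad x (opt x)))\<^sup>2)
      \<le> C * (1 / real M + \<gamma> ^ T + (norm (policy_vec \<pi> - policy_vec (opt x)))\<^sup>2)"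
    by (rule mean_est_hyper_grad_sq_le) blast
  obtain L where "\<And>y z. norm (hyper_grad y (opt y) - hyper_grad z (opt z)) \<le> L * norm (y - z)"
    using bdd_lip_hyper_grad_opt by (rule bdd_lipE) blast
  note taylor = gderiv_taylor_le[OF gderiv_obj this]
  \<comment> \<open>The variance term only needs \<open>M K \<ge> K\<close>, which is within the
    order K^(4/3); adding 1 covers \<open>K = 0\<close>.\<close>
  define M where "M K = K + 1" for K :: nat
  define T where "T K = nat \<lceil>ln (real K) / ln (1 / \<gamma>)\<rceil> + 1" for K :: nat
  note T = rollout_length[OF assms(1,2), folded T_def]
  show ?thesis
  \<comment> \<open>One branch trajectory per pair is enough: its variance is averaged over the
    \<open>M\<close> independent tuples.\<close>
  proof (rule exI[of _ M], rule exI[of _ "\<lambda>_. 1"], rule exI[of _ T], intro conjI allI impI)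
    show "(\<lambda>K. real (M K)) \<in> O(\<lambda>K. real K powr (4/3))"
      unfolding M_def by real_asymp
    show "(\<lambda>K. real (T K)) \<in> O(\<lambda>K. ln (real K))"
      unfolding T_def by (rule rollout_length(2)[OF assms(1,2)])
  next
    fix n\<^sub>\<beta> :: nat and \<beta> \<mu> \<epsilon> :: "nat \<Rightarrow> real" and x\<^sub>1 h\<^sub>0 :: "real^'n" and W :: "nat \<Rightarrow> 'w measure" and F \<pi> smp x h
    assume n: "3 \<le> n\<^sub>\<beta>" and \<beta>: "\<forall>k\<ge>1. \<beta> k = 1 / (real n\<^sub>\<beta> + real k) powr (1/3)"
      and \<mu>: "0 \<le> \<mu> 1" "\<mu> 1 \<le> 1" "\<forall>k\<ge>1. \<mu> (k + 1) = max (15/16) (1 - (\<beta> k)\<^sup>2)"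
      and \<epsilon>: "\<forall>k\<ge>1. \<epsilon> k = (\<beta> k)\<^sup>2"
      and run: "\<forall>K\<ge>1. stoc_sobirl_run \<rho> P \<gamma> \<tau> r \<rho>' P' I H l K (M K) 1 (T K) \<beta> \<mu> \<epsilon> x\<^sub>1 h\<^sub>0
                  (W K) (F K) (\<pi> K) (smp K) (x K) (h K)"
    have steps: "step_sizes n\<^sub>\<beta> \<beta> \<mu>"
      using n \<beta> \<mu> by unfold_locales auto
    interpret step_sizes n\<^sub>\<beta> \<beta> \<mu> by (rule steps)
    define E where "E K k = (\<integral>\<omega>. (norm (hyper_grad (x K k \<omega>) (opt (x K k \<omega>))))\<^sup>2 \<partial>W K)" for K k
    define avg where "avg K = 1 / real K * (\<Sum>k=1..K. E K k)" for K
    define B where "B = 2 * C_est + norm h\<^sub>0"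
    \<comment> \<open>Built from constants of the problem and \<open>h\<^sub>0\<close> alone, which
      all runs share, hence independent of \<open>K\<close>.\<close>
    define D where "D = 3 * C + ((B + C_est)\<^sup>2 + L\<^sup>2 * B\<^sup>2 / 2)"
    have "0 \<le> D" using C(1) by (simp add: D_def)
    have E_nonneg: "0 \<le> E K k" for K k
      unfolding E_def by (rule Bochner_Integration.integral_nonneg) simp
    have avg_le: "norm (avg K) \<le> 2 * (2 * C_l + D) * norm ((real n\<^sub>\<beta> + real K) powr (1/3) / real K * (1 + ln (real K)))"
      if K: "1 \<le> K" for K
    proof -
      \<comment> \<open>The step sizes decrease, so the last one is a lower bound for all
        weights.\<close>
      have "\<beta> K / 2 * (\<Sum>k=1..K. E K k) \<le> (\<Sum>k=1..K. \<beta> k / 2 * E K k)"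
        unfolding sum_distrib_left
        by (intro sum_mono mult_right_mono divide_right_mono \<beta>_antimono E_nonneg) auto
      also have "\<dots> \<le> 2 * C_l + D * (1 + ln (real K))"
        unfolding E_def D_def B_def
        by (rule run_gradient_sum_le[OF C(2,1) taylor assms(4) steps _ K _ _ T(1)[OF K] run[rule_format, OF K]])
          (use \<epsilon> in \<open>auto simp: M_def\<close>)
      also have "\<dots> \<le> (2 * C_l + D) * (1 + ln (real K))"
        using C_l_nonneg K mult_left_mono[of 1 "1 + ln (real K)" "2 * C_l"] by (simp add: distrib_right)
      finally have "(\<Sum>k=1..K. E K k) \<le> (2 * C_l + D) * (1 + ln (real K)) / (\<beta> K / 2)"
        using \<beta>_pos[OF K] by (simp add: pos_le_divide_eq mult.commute)
      also have "\<dots> = 2 * (2 * C_l + D) * ((real n\<^sub>\<beta> + real K) powr (1/3) * (1 + ln (real K)))"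
        using K \<beta> by simp
      finally have "avg K \<le> 1 / real K * (2 * (2 * C_l + D) * ((real n\<^sub>\<beta> + real K) powr (1/3) * (1 + ln (real K))))"
        unfolding avg_def by (rule mult_left_mono) simp
      also have "\<dots> = 2 * (2 * C_l + D) * ((real n\<^sub>\<beta> + real K) powr (1/3) / real K * (1 + ln (real K)))"
        by simp
      finally have "avg K \<le> 2 * (2 * C_l + D) * ((real n\<^sub>\<beta> + real K) powr (1/3) / real K * (1 + ln (real K)))" .
      moreover have "0 \<le> avg K"
        unfolding avg_def by (intro mult_nonneg_nonneg sum_nonneg E_nonneg) simp
      moreover have "0 \<le> (real n\<^sub>\<beta> + real K) powr (1/3) / real K * (1 + ln (real K))"
        using K by simp
      ultimately show ?thesis by (simp only: real_norm_def abs_of_nonneg)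
    qed
    have "avg \<in> O(\<lambda>K. (real n\<^sub>\<beta> + real K) powr (1/3) / real K * (1 + ln (real K)))"
      by (rule bigoI, rule eventually_mono[OF eventually_ge_at_top[of 1] avg_le])
    \<comment> \<open>Dividing by \<open>K\<close> times the last step size leaves (n + K)^(1/3) /
      K, of order K^(-2/3) for the fixed shift.\<close>
    also have "(\<lambda>K::nat. (real n\<^sub>\<beta> + real K) powr (1/3) / real K * (1 + ln (real K)))
        \<in> O(\<lambda>K. ln (real K) / real K powr (2/3))"
      by real_asymp
    finally have bigo: "avg \<in> O(\<lambda>K. ln (real K) / real K powr (2/3))" .
    moreover have "avg \<in> soft_bigo (\<lambda>K. real K powr (-2/3))"
    proof -
      \<comment> \<open>A single logarithmic factor is hidden, so the exponent \<open>p = 1\<close>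
        is the witness.\<close>
      have "(\<lambda>K. real K powr (-2/3) * ln (real K) ^ 1) = (\<lambda>K. ln (real K) / real K powr (2/3))"
        by (rule ext) (simp add: powr_minus_divide)
      then have "avg \<in> O(\<lambda>K. real K powr (-2/3) * ln (real K) ^ 1)"
        using bigo by (simp only:)
      then show ?thesis unfolding soft_bigo_def by blast
    qed
    ultimately show "let avg = (\<lambda>K. 1 / real K * (\<Sum>k=1..K.
                     \<integral>\<omega>. (norm (grad (hyper_obj \<rho> P \<gamma> \<tau> r \<rho>' P' I H l) (x K k \<omega>)))\<^sup>2 \<partial>W K))
         in avg \<in> O(\<lambda>K. ln (real K) / real K powr (2/3)) \<and>
            avg \<in> soft_bigo (\<lambda>K. real K powr (-2/3))"
      unfolding grad_obj Let_def avg_def[abs_def] E_def by blast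
  qed (auto simp: M_def T_def)
qed

end
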